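(* Let $n\ge 2$ and $m\ge 1$, let $\Omega\subset\mathbb{C}^n$ be a bounded complete circular domain, let $U\subset\mathbb{C}^m$ be a domain, and let $\rho:U\to\mathbb{R}$ be an upper semicontinuous function with $0<\rho<1$ on $U$. For $\zeta\in U$ put $\Omega_\zeta=\rho(\zeta)\cdot\Omega=\{\rho(\zeta)z:\ z\in\Omega\}$ and $A_\zeta=\Omega-\overline{\Omega_\zeta}$, and let $K_\zeta(z)$ denote the Bergman kernel of $A_\zeta$ on the diagonal, regarded as a function on $U\times\Omega$ through its extension from $A_\zeta$ to $\Omega$. If $\rho$ is plurisubharmonic on $U$, then $(\zeta,z)\mapsto\log K_\zeta(z)$ is a plurisubharmonic function on $U\times\Omega$. Furthermore, if $\rho$ is strictly plurisubharmonic on $U$, then $(\zeta,z)\mapsto\log K_\zeta(z)$ is strictly plurisubharmonic on $U\times\Omega$.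
   Context: A domain $\Omega\subset\mathbb{C}^n$ is complete circular if $\lambda z\in\Omega$ whenever $z\in\Omega$ and $\lambda\in\mathbb{C}$, $|\lambda|\le 1$. The Bergman kernel of $A_\zeta$ (on the diagonal) is $K_\zeta(z)=\sum_j|e_j(z)|^2$, where $(e_j)$ is any complete orthonormal basis of the Bergman space $H^2(A_\zeta)$ of square-integrable holomorphic functions on $A_\zeta$ with respect to Lebesgue measure. Since $n\ge 2$, by Hartogs' extension theorem every holomorphic function on $A_\zeta$ extends to a holomorphic function on $\Omega$. For $z\in\Omega$, $K_\zeta(z)$ denotes the value of the same sum $\sum_j|e_j(z)|^2$ with each $e_j$ replaced by its holomorphic extension to $\Omega$; in this sense $K_\zeta(z)$ is defined for all $(\zeta,z)\in U\times\Omega$.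
   Formalization: Added: the closure of Ω_ζ lies in Ω for each ζ in U (as Hartogs extension needs; otherwise false). Strictness is proved in a pointwise sense, and in the locally uniform sense only if ρ is locally bounded away from 0 (otherwise false). *)

theory Defs
  imports "HOL-Analysis.Analysis"
begin

text \<open>\<open>\<complex>\<^sup>n\<close> is \<^typ>\<open>complex ^ 'n\<close>, with the Hermitian norm
  and with \<^const>\<open>lborel\<close> as Lebesgue measure on \<open>\<real>\<^sup>2\<^sup>n\<close>. The product
  \<open>\<complex>\<^sup>m \<times> \<complex>\<^sup>n\<close> is \<open>\<complex>\<^sup>m\<^sup>+\<^sup>n\<close>, with coordinates indexed by the sum type.\<close>

definition domain_in :: "(complex ^ 'n) set \<Rightarrow> bool" where
  "domain_in S \<longleftrightarrow> open S \<and> connected S \<and> S \<noteq> {}"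

definition complete_circular :: "(complex ^ 'n) set \<Rightarrow> bool" where
  "complete_circular S \<longleftrightarrow> (\<forall>z\<in>S. \<forall>c. cmod c \<le> 1 \<longrightarrow> c *s z \<in> S)"

definition fst_part :: "complex ^ ('m::finite + 'n::finite) \<Rightarrow> complex ^ 'm" where
  "fst_part w = (\<chi> i. w $ Inl i)"

definition snd_part :: "complex ^ ('m::finite + 'n::finite) \<Rightarrow> complex ^ 'n" where
  "snd_part w = (\<chi> j. w $ Inr j)"

definition cprod :: "(complex ^ 'm) set \<Rightarrow> (complex ^ 'n) set \<Rightarrow> (complex ^ ('m::finite + 'n::finite)) set" where
  "cprod S T = {w. fst_part w \<in> S \<and> snd_part w \<in> T}"


subsection \<open>Plurisubharmonic functions\<close>

definition usc_on :: "'a::topological_space set \<Rightarrow> ('a \<Rightarrow> real) \<Rightarrow> bool" where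
  "usc_on S u \<longleftrightarrow> (\<forall>a\<in>S. \<forall>c. u a < c \<longrightarrow> (\<forall>\<^sub>F x in at a within S. u x < c))"

definition circle_mean :: "(complex ^ 'k \<Rightarrow> real) \<Rightarrow> complex ^ 'k \<Rightarrow> complex ^ 'k \<Rightarrow> real" where
  "circle_mean u a b = (LINT t:{0..2 * pi}|lborel. u (a + cis t *s b)) / (2 * pi)"

text \<open>Only real-valued functions are needed, so the value \<open>-\<infinity>\<close> does not occur. For such
  functions the integral over the circle in the sub-mean value inequality is finite; this has
  to be said, since the integral of a non-integrable function is \<open>0\<close> by convention.\<close>

definition psh_on :: "(complex ^ 'k) set \<Rightarrow> (complex ^ 'k \<Rightarrow> real) \<Rightarrow> bool" where
  "psh_on S u \<longleftrightarrow> usc_on S u \<and>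
     (\<forall>a b. (\<forall>c. cmod c \<le> 1 \<longrightarrow> a + c *s b \<in> S) \<longrightarrow>
        set_integrable lborel {0..2 * pi} (\<lambda>t. u (a + cis t *s b)) \<and>
        u a \<le> circle_mean u a b)"

text \<open>Strict plurisubharmonicity of a function that need not be smooth comes in a pointwise and
  in a locally uniform version. In both, positivity of the Levi form is quantitative: the defect
  in the sub-mean value inequality is of second order in the radius. For functions of class
  \<open>C\<^sup>2\<close> both say that the Levi form is positive definite at every point.\<close>

definition strictly_psh_on :: "(complex ^ 'k) set \<Rightarrow> (complex ^ 'k \<Rightarrow> real) \<Rightarrow> bool" where
  "strictly_psh_on S u \<longleftrightarrow> psh_on S u \<and>
     (\<forall>a\<in>S. \<forall>b. b \<noteq> 0 \<longrightarrow>
        (\<exists>\<epsilon>>0. \<forall>\<^sub>F r in at_right (0::real). u a + \<epsilon> * r\<^sup>2 \<le> circle_mean u a (r *\<^sub>R b)))"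

definition loc_unif_strictly_psh_on :: "(complex ^ 'k) set \<Rightarrow> (complex ^ 'k \<Rightarrow> real) \<Rightarrow> bool" where
  "loc_unif_strictly_psh_on S u \<longleftrightarrow>
     (\<forall>a\<in>S. \<exists>r>0. \<exists>\<epsilon>>0. ball a r \<subseteq> S \<and> psh_on (ball a r) (\<lambda>z. u z - \<epsilon> * (norm z)\<^sup>2))"

definition loc_bounded_away_from_0 :: "'a::topological_space set \<Rightarrow> ('a \<Rightarrow> real) \<Rightarrow> bool" where
  "loc_bounded_away_from_0 S u \<longleftrightarrow> (\<forall>a\<in>S. \<exists>c>0. \<forall>\<^sub>F x in at a within S. c \<le> u x)"


subsection \<open>The Bergman kernel on the diagonal and its extension\<close>

text \<open>Used for open \<open>S\<close> only.\<close>

definition hol_on :: "(complex ^ 'n \<Rightarrow> complex) \<Rightarrow> (complex ^ 'n) set \<Rightarrow> bool" where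
  "hol_on f S \<longleftrightarrow>
     (\<forall>z\<in>S. \<exists>D. (f has_derivative D) (at z) \<and> (\<forall>c v. D (c *s v) = c * D v))"

definition bergman_space :: "(complex ^ 'n) set \<Rightarrow> (complex ^ 'n \<Rightarrow> complex) set" where
  "bergman_space A = {f. hol_on f A \<and> set_integrable lborel A (\<lambda>z. (cmod (f z))\<^sup>2)}"

definition bergman_inner ::
    "(complex ^ 'n) set \<Rightarrow> (complex ^ 'n \<Rightarrow> complex) \<Rightarrow> (complex ^ 'n \<Rightarrow> complex) \<Rightarrow> complex" where
  "bergman_inner A f g = (LINT z:A|lborel. f z * cnj (g z))"

text \<open>The Bergman space of a nonempty bounded open set is separable and infinite-dimensional, so
  its complete orthonormal bases are sequences. The values of the functions outside \<open>A\<close> are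
  irrelevant.\<close>

definition complete_onb :: "(complex ^ 'n) set \<Rightarrow> (nat \<Rightarrow> complex ^ 'n \<Rightarrow> complex) \<Rightarrow> bool" where
  "complete_onb A e \<longleftrightarrow>
     (\<forall>j. e j \<in> bergman_space A) \<and>
     (\<forall>i j. bergman_inner A (e i) (e j) = (if i = j then 1 else 0)) \<and>
     (\<forall>f\<in>bergman_space A. (\<forall>j. bergman_inner A f (e j) = 0) \<longrightarrow> (\<forall>z\<in>A. f z = 0))"

definition hol_extension ::
    "(complex ^ 'n) set \<Rightarrow> (complex ^ 'n) set \<Rightarrow> (complex ^ 'n \<Rightarrow> complex) \<Rightarrow> complex ^ 'n \<Rightarrow> complex" where
  "hol_extension A \<Omega> f = (SOME g. hol_on g \<Omega> \<and> (\<forall>z\<in>A. g z = f z))"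

definition bergman_kernel_ext ::
    "(complex ^ 'n) set \<Rightarrow> (complex ^ 'n) set \<Rightarrow> complex ^ 'n \<Rightarrow> real" where
  "bergman_kernel_ext A \<Omega> z =
     (THE k. \<forall>e. complete_onb A e \<longrightarrow> (\<lambda>j. (cmod (hol_extension A \<Omega> (e j) z))\<^sup>2) sums k)"

definition shrunk :: "real \<Rightarrow> (complex ^ 'n) set \<Rightarrow> (complex ^ 'n) set" where
  "shrunk r \<Omega> = (\<lambda>z. r *\<^sub>R z) ` \<Omega>"

definition annulus :: "real \<Rightarrow> (complex ^ 'n) set \<Rightarrow> (complex ^ 'n) set" where
  "annulus r \<Omega> = \<Omega> - closure (shrunk r \<Omega>)"

definition log_K ::
    "(complex ^ 'm \<Rightarrow> real) \<Rightarrow> (complex ^ 'n) set \<Rightarrow> complex ^ ('m::finite + 'n::finite) \<Rightarrow> real" where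
  "log_K \<rho> \<Omega> w = ln (bergman_kernel_ext (annulus (\<rho> (fst_part w)) \<Omega>) \<Omega> (snd_part w))"

end

(* Square integrable holomorphic functions on the shell extend to Omega, so the kernel has the extremal
   form K_zeta(z) = max |h(z)|^2 / N_rho(h), where rho = rho(zeta), the functions h are holomorphic on Omega,
   and N_rho(h) is the squared norm over the shell. As max_s (ln s^2 - s^2 N) = - ln N - 1, this reads
     log K_zeta(z) = 1 + max_h (ln |h(z)|^2 - N_rho(h)).
   Here - N_rho(h) is a constant plus the integral of |h|^2 over rho times the closure of Omega. Averaging
   over rotations and expanding in power series on complex lines through 0, this integral is a convex
   increasing function of rho, so every competitor h is plurisubharmonic in (zeta, z) when rho is.
   For strictness, take the maximiser f at the centre of a disc. Its value at 0 is bounded below, since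
   pairing f with the function 1 gives 1 / sqrt K; hence the convexity in rho is quantitative, which gives a
   gain in zeta. Adding to f a small multiple of e^(-it) times a linear function vanishing at the centre gives
   a gain in z; the cross term is absorbed by the strict convexity in rho. *)

theory Submission
  imports Defs "HOL-Complex_Analysis.Complex_Analysis" "HOL-Real_Asymp.Real_Asymp"
begin

subsection \<open>Rotations and Lebesgue measure\<close>

text \<open>All three conclusions rest on one sub-mean value inequality,
  \<open>kernel_disc_estimate\<close>, with constants depending only on a compact set of centres, an
  upper bound for the radii and a lower bound for the radius at the centre. As \<rho> is merely
  semicontinuous, only its mean over a circle is accessible. The norm of a competitor must therefore
  be bounded by an affine function of \<rho>: convexity supplies a supporting slope, taken at the
  centre of the disc, and 1 - u <= exp (- u) turns this into an affine lower bound for log K. The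
  slope contains a power of the radius at the centre, so a locally uniform estimate asks for \<rho>
  to stay locally away from 0. The remaining term is log of a squared modulus of a function
  holomorphic on the disc, handled by Jensen's inequality. The gain in z is of first order in the
  size of the linear correction, its cost of second order, so a small correction wins. Circular
  symmetry replaces dbar methods: Cauchy integrals on lines through 0 give Hartogs extension, and
  the maximum principle on these lines gives bounds in the hole.\<close>

lemma norm_cscale: "norm (c *s (z :: complex ^ 'n)) = cmod c * norm z"
  by (simp add: norm_vec_def norm_mult L2_set_right_distrib)

lemma continuous_on_cscale [continuous_intros]:
  fixes g :: "'a::topological_space \<Rightarrow> complex ^ 'n"
  assumes "continuous_on S f" "continuous_on S g"
  shows "continuous_on S (\<lambda>x. f x *s g x)"
  unfolding vector_scalar_mult_def by (intro continuous_intros assms)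

lemma borel_measurable_cscale [measurable (raw)]:
  fixes g :: "'a \<Rightarrow> complex ^ 'n"
  assumes f: "f \<in> borel_measurable M" and g: "g \<in> borel_measurable M"
  shows "(\<lambda>x. f x *s g x) \<in> borel_measurable M"
proof -
  have "continuous_on UNIV (\<lambda>p::complex \<times> (complex ^ 'n). fst p *s snd p)"
    by (intro continuous_intros)
  from borel_measurable_continuous_on[OF this, of "\<lambda>x. (f x, g x)" M] f g
  show ?thesis by simp
qed

lemma scaleR_eq_cscale: "r *\<^sub>R (z :: complex ^ 'n) = complex_of_real r *s z"
  by (simp add: vec_eq_iff) (metis scaleR_conv_of_real)

lemma nn_integral_lborel_translate:
  assumes [measurable]: "f \<in> borel_measurable borel"
  shows "(\<integral>\<^sup>+ x. f (c + x) \<partial>lborel) = (\<integral>\<^sup>+ x. f x \<partial>lborel)"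
proof -
  have "(\<integral>\<^sup>+ x. f x \<partial>lborel) = (\<integral>\<^sup>+ x. f x \<partial>(distr lborel borel ((+) c)))"
    by (simp add: lborel_distr_plus)
  also have "\<dots> = (\<integral>\<^sup>+ x. f (c + x) \<partial>lborel)"
    by (rule nn_integral_distr) auto
  finally show ?thesis by simp
qed

text \<open>The image of Lebesgue measure under \<open>T\<close> is translation invariant, hence proportional to
  Lebesgue measure by Fubini's theorem, and the unit ball fixes the constant.\<close>

lemma lborel_distr_orthogonal_transformation:
  fixes T :: "'a::euclidean_space \<Rightarrow> 'a"
  assumes T: "orthogonal_transformation T"
  shows "distr lborel borel T = lborel"
proof -
  have lin: "linear T" using T by (simp add: orthogonal_transformation_def)
  have bij: "bij T" using T by (rule orthogonal_transformation_bij)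
  have [measurable]: "T \<in> borel_measurable borel"
    using lin by (intro borel_measurable_continuous_onI linear_continuous_on linear_conv_bounded_linear[THEN iffD1])
  define S :: "'a set" where "S = ball 0 1"
  have [measurable]: "S \<in> sets borel" by (simp add: S_def)
  have S_T: "T -` S = S"
    using T by (auto simp: S_def orthogonal_transformation_norm)
  have S_fin: "emeasure lborel S \<noteq> \<infinity>" "emeasure lborel S \<noteq> 0"
    using emeasure_lborel_ball_finite[of "0::'a" 1] content_ball_pos[of 1 "0::'a"]
    by (auto simp: S_def measure_def)
  have "emeasure (distr lborel borel T) B = emeasure lborel B" if B[measurable]: "B \<in> sets borel" for B
  proof -
    let ?I = "\<lambda>X x. indicator X x :: ennreal"
    have 1: "(\<integral>\<^sup>+ y. \<integral>\<^sup>+ x. ?I S (T x) * ?I B (T x + y) \<partial>lborel \<partial>lborel)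
        = emeasure lborel S * emeasure lborel B"
    proof -
      have "(\<integral>\<^sup>+ y. \<integral>\<^sup>+ x. ?I S (T x) * ?I B (T x + y) \<partial>lborel \<partial>lborel)
          = (\<integral>\<^sup>+ x. \<integral>\<^sup>+ y. ?I S (T x) * ?I B (T x + y) \<partial>lborel \<partial>lborel)"
        by (rule lborel_pair.Fubini') measurable
      also have "\<dots> = (\<integral>\<^sup>+ x. ?I S (T x) * emeasure lborel B \<partial>lborel)"
        by (intro nn_integral_cong) (simp add: nn_integral_cmult nn_integral_lborel_translate[of "?I B"])
      also have "\<dots> = (\<integral>\<^sup>+ x. ?I (T -` S) x \<partial>lborel) * emeasure lborel B"
        by (simp add: nn_integral_multc indicator_vimage[symmetric] comp_def)
      also have "\<dots> = emeasure lborel S * emeasure lborel B"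
        by (simp add: S_T)
      finally show ?thesis .
    qed
    have 2: "(\<integral>\<^sup>+ y. \<integral>\<^sup>+ x. ?I S (T x) * ?I B (T x + y) \<partial>lborel \<partial>lborel)
        = emeasure lborel S * emeasure lborel (T -` B)"
    proof -
      have "(\<integral>\<^sup>+ x. ?I S (T x) * ?I B (T x + y) \<partial>lborel)
          = (\<integral>\<^sup>+ x. ?I S (y - T x) * ?I B (T x) \<partial>lborel)" for y
      proof -
        \<comment> \<open>Shifting x by a preimage of y removes y from the second factor. The first
          becomes the indicator of S at T x - y, and the ball is symmetric.\<close>
        obtain w where w: "T w = y" using bij by (metis bij_pointE)
        have "(\<integral>\<^sup>+ x. ?I S (T x) * ?I B (T x + y) \<partial>lborel)
           = (\<integral>\<^sup>+ x. ?I S (T (- w + x)) * ?I B (T (- w + x) + y) \<partial>lborel)"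
          by (subst nn_integral_lborel_translate) (auto simp: )
        also have "\<dots> = (\<integral>\<^sup>+ x. ?I S (y - T x) * ?I B (T x) \<partial>lborel)"
          using lin w
          by (intro nn_integral_cong)
            (simp add: linear_add linear_diff linear_neg S_def indicator_def norm_minus_commute)
        finally show ?thesis .
      qed
      then have "(\<integral>\<^sup>+ y. \<integral>\<^sup>+ x. ?I S (T x) * ?I B (T x + y) \<partial>lborel \<partial>lborel)
          = (\<integral>\<^sup>+ y. \<integral>\<^sup>+ x. ?I S (y - T x) * ?I B (T x) \<partial>lborel \<partial>lborel)" by simp
      also have "\<dots> = (\<integral>\<^sup>+ x. \<integral>\<^sup>+ y. ?I S (y - T x) * ?I B (T x) \<partial>lborel \<partial>lborel)"
        by (rule lborel_pair.Fubini') measurable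
      also have "\<dots> = (\<integral>\<^sup>+ x. emeasure lborel S * ?I B (T x) \<partial>lborel)"
        using nn_integral_lborel_translate[of "?I S" "- T _"]
        by (intro nn_integral_cong) (simp add: nn_integral_multc)
      also have "\<dots> = emeasure lborel S * (\<integral>\<^sup>+ x. ?I (T -` B) x \<partial>lborel)"
        by (simp add: nn_integral_cmult indicator_vimage[symmetric] comp_def)
      also have "\<dots> = emeasure lborel S * emeasure lborel (T -` B)"
        using measurable_sets[OF \<open>T \<in> borel_measurable borel\<close> B] by simp
      finally show ?thesis .
    qed
    have "emeasure lborel (T -` B) = emeasure lborel B"
      using 1 2 S_fin by (simp add: ennreal_mult_cancel_left)
    then show ?thesis by (simp add: emeasure_distr)
  qed
  then show ?thesis by (intro measure_eqI) auto
qed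

lemma lborel_distr_rotation:
  assumes "cmod c = 1"
  shows "distr lborel borel (\<lambda>z :: complex ^ 'n. c *s z) = lborel"
proof (rule lborel_distr_orthogonal_transformation)
  have "linear (\<lambda>z :: complex ^ 'n. c *s z)"
    by (intro linearI) (simp_all add: vec_eq_iff algebra_simps)
  then show "orthogonal_transformation (\<lambda>z :: complex ^ 'n. c *s z)"
    by (simp add: orthogonal_transformation norm_cscale assms)
qed

lemma integral_rotation:
  fixes g :: "complex ^ 'n \<Rightarrow> 'b::{banach, second_countable_topology}"
  assumes c: "cmod c = 1"
  shows "(LINT z|lborel. g (c *s z)) = integral\<^sup>L lborel g"
    and "integrable lborel (\<lambda>z. g (c *s z)) \<longleftrightarrow> integrable lborel g"
proof -
  have inj: "inj (\<lambda>z :: complex ^ 'n. c *s z)"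
    using c by (auto simp: inj_def)
  have m: "(\<lambda>z. g (c *s z)) \<in> borel_measurable lborel \<longleftrightarrow> g \<in> borel_measurable lborel"
  proof
    assume "(\<lambda>z. g (c *s z)) \<in> borel_measurable lborel"
    then have "(\<lambda>z. g (c *s (inverse c *s z))) \<in> borel_measurable lborel"
      by (rule measurable_compose[rotated]) simp
    moreover have "c \<noteq> 0" using c by auto
    then have "c *s (inverse c *s z) = z" for z :: "complex ^ 'n"
      by (auto simp: vec_eq_iff)
    ultimately show "g \<in> borel_measurable lborel" by simp
  qed (auto intro: measurable_compose[rotated])
  show eq: "integrable lborel (\<lambda>z. g (c *s z)) \<longleftrightarrow> integrable lborel g"
  proof (cases "g \<in> borel_measurable lborel")
    case True
    then show ?thesis
      using integrable_distr_eq[of "\<lambda>z. c *s z" lborel borel g]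
      by (simp add: lborel_distr_rotation[OF c])
  qed (use m in auto)
  show "(LINT z|lborel. g (c *s z)) = integral\<^sup>L lborel g"
  proof (cases "g \<in> borel_measurable lborel")
    case True
    then show ?thesis
      using integral_distr[of "\<lambda>z. c *s z" lborel borel g]
      by (simp add: lborel_distr_rotation[OF c])
  next
    case False
    then show ?thesis using eq m by (metis borel_measurable_integrable not_integrable_integral_eq)
  qed
qed

text \<open>Rotations preserve Lebesgue measure, so averaging over them and exchanging the integrals
  replaces f by its means over circles. Integrability of F is a by-product of Fubini's theorem.
  Depending on f, this is the mean value property of holomorphic functions or the reduction of a
  squared norm to Parseval's identity.\<close>

lemma set_integral_circle_mean:
  fixes f :: "complex ^ 'n \<Rightarrow> 'b::{banach, second_countable_topology}"
  assumes S [measurable]: "S \<in> sets borel"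
    and circled: "\<And>c z. cmod c = 1 \<Longrightarrow> z \<in> S \<Longrightarrow> c *s z \<in> S"
    and f: "set_integrable lborel S f"
    and F: "\<And>z. z \<in> S \<Longrightarrow> (LINT t:{0..2*pi}|lborel. f (cis t *s z)) = (2 * pi) *\<^sub>R F z"
  shows "set_integrable lborel S F" "(LINT z:S|lborel. F z) = (LINT z:S|lborel. f z)"
proof -
  define g where "g = (\<lambda>z. indicator S z *\<^sub>R f z)"
  define G where "G = (\<lambda>z. indicator S z *\<^sub>R F z)"
  have g: "integrable lborel g" using f by (simp add: g_def set_integrable_def)
  then have [measurable]: "g \<in> borel_measurable borel" by auto
  have S_iff: "c *s z \<in> S \<longleftrightarrow> z \<in> S" if "cmod c = 1" for c z
  proof
    assume "c *s z \<in> S"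
    then have "inverse c *s (c *s z) \<in> S"
      by (intro circled[of "inverse c"]) (use that in \<open>simp_all add: norm_inverse\<close>)
    moreover have "c \<noteq> 0" using that by auto
    then have "inverse c *s (c *s z) = z" by (simp add: vec_eq_iff)
    ultimately show "z \<in> S" by simp
  qed (use that circled in auto)
  let ?h = "\<lambda>t z. indicator {0..2*pi} t *\<^sub>R g (cis t *s z)"
  have int: "integrable (lborel \<Otimes>\<^sub>M lborel) (\<lambda>(t, z). ?h t z)"
  proof (rule lborel_pair.Fubini_integrable)
    have "continuous_on UNIV cis"
      unfolding cis_conv_exp by (intro continuous_intros)
    then have [measurable]: "cis \<in> borel_measurable borel"
      by (rule borel_measurable_continuous_onI)
    show "(\<lambda>(t, z). ?h t z) \<in> borel_measurable (lborel \<Otimes>\<^sub>M lborel)"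
      by measurable
    have "(LINT z|lborel. norm (g (cis t *s z))) = (LINT z|lborel. norm (g z))" for t
      by (rule integral_rotation(1)) simp
    then show "integrable lborel (\<lambda>t. LINT z|lborel. norm (case (t, z) of (t, z) \<Rightarrow> ?h t z))"
      by simp
    show "AE t in lborel. integrable lborel (\<lambda>z. case (t, z) of (t, z) \<Rightarrow> ?h t z)"
      using g integral_rotation(2)[of "cis _" g] by (auto intro!: AE_I2)
  qed
  have inner: "(LINT t|lborel. ?h t z) = (2 * pi) *\<^sub>R G z" for z
  proof (cases "z \<in> S")
    case True
    then have "g (cis t *s z) = f (cis t *s z)" for t
      by (simp add: g_def S_iff)
    then show ?thesis using F[OF True] True by (simp add: set_lebesgue_integral_def G_def)
  next
    case False
    then show ?thesis by (simp add: g_def G_def S_iff)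
  qed
  have "integrable lborel (\<lambda>z. LINT t|lborel. ?h t z)"
    using lborel_pair.integrable_snd[OF int] by simp
  then have "integrable lborel (\<lambda>z. (1 / (2 * pi)) *\<^sub>R ((2 * pi) *\<^sub>R G z))"
    unfolding inner by (rule integrable_scaleR_right)
  then show "set_integrable lborel S F" by (simp add: set_integrable_def G_def)
  have "(2 * pi) *\<^sub>R (LINT z|lborel. G z) = (LINT z|lborel. LINT t|lborel. ?h t z)"
    unfolding inner by simp
  also have "\<dots> = (LINT t|lborel. LINT z|lborel. ?h t z)"
    using lborel_pair.Fubini_integral[OF int] by simp
  also have "\<dots> = (LINT t:{0..2*pi}|lborel. integral\<^sup>L lborel g)"
    using integral_rotation(1)[of "cis _" g] by (simp add: set_lebesgue_integral_def)
  also have "\<dots> = (2 * pi) *\<^sub>R integral\<^sup>L lborel g"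
    by (simp add: set_lebesgue_integral_def integral_indicator)
  finally show "(LINT z:S|lborel. F z) = (LINT z:S|lborel. f z)"
    by (simp add: set_lebesgue_integral_def G_def g_def)
qed

text \<open>The exponent is the real dimension of the space. If the integrand is not measurable,
  both integrals have the default value 0.\<close>

lemma set_integral_shrunk:
  fixes f :: "complex ^ 'n \<Rightarrow> 'b::{banach, second_countable_topology}"
  assumes r: "r > 0"
  shows "(LINT z:shrunk r S|lborel. f z) = r ^ (2 * CARD('n)) *\<^sub>R (LINT z:S|lborel. f (r *\<^sub>R z))"
    and "set_integrable lborel S (\<lambda>z. f (r *\<^sub>R z)) \<longleftrightarrow> set_integrable lborel (shrunk r S) f"
proof -
  define g where "g = (\<lambda>z. indicator (shrunk r S) z *\<^sub>R f z)"
  have ind: "g (r *\<^sub>R z) = indicator S z *\<^sub>R f (r *\<^sub>R z)" for z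
    using r by (auto simp: g_def shrunk_def indicator_def)
  have D: "DIM(complex ^ 'n) = 2 * CARD('n)" by simp
  have m: "(\<lambda>z. g (r *\<^sub>R z)) \<in> borel_measurable lborel \<longleftrightarrow> g \<in> borel_measurable lborel"
  proof
    assume "(\<lambda>z. g (r *\<^sub>R z)) \<in> borel_measurable lborel"
    then have "(\<lambda>z. g (r *\<^sub>R (inverse r *\<^sub>R z))) \<in> borel_measurable lborel"
      by (rule measurable_compose[rotated]) simp
    then show "g \<in> borel_measurable lborel" using r by simp
  qed (auto intro: measurable_compose[rotated])
  have L: "lborel = density (distr lborel borel (\<lambda>z :: complex ^ 'n. 0 + r *\<^sub>R z)) (\<lambda>_. ennreal (\<bar>r\<bar> ^ DIM(complex ^ 'n)))"
    using r lborel_affine[of r "0 :: complex ^ 'n"] by (simp add: ennreal_power)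
  have eq: "integrable lborel (\<lambda>z. g (r *\<^sub>R z)) \<longleftrightarrow> integrable lborel g"
  proof (cases "g \<in> borel_measurable lborel")
    case True
    then show ?thesis
      apply (subst (2) L)
      using r integrable_scaleR_right[of "r ^ (CARD('n) * 2)" lborel "\<lambda>z. g (r *\<^sub>R z)"]
        integrable_scaleR_right[of "inverse (r ^ (CARD('n) * 2))" lborel "\<lambda>z. r ^ (CARD('n) * 2) *\<^sub>R g (r *\<^sub>R z)"]
      by (auto simp: integrable_density integrable_distr_eq)
  qed (use m in auto)
  have "integral\<^sup>L lborel g = r ^ (2 * CARD('n)) *\<^sub>R (LINT z|lborel. g (r *\<^sub>R z))"
  proof (cases "g \<in> borel_measurable lborel")
    case True
    then show ?thesis
      apply (subst L)
      using r D by (simp add: integral_density integral_distr mult.commute[of 2])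
  next
    case False
    then have "\<not> integrable lborel g" "\<not> integrable lborel (\<lambda>z. g (r *\<^sub>R z))"
      using m by auto
    then show ?thesis by (simp add: not_integrable_integral_eq)
  qed
  then show "(LINT z:shrunk r S|lborel. f z) = r ^ (2 * CARD('n)) *\<^sub>R (LINT z:S|lborel. f (r *\<^sub>R z))"
    unfolding ind by (simp add: set_lebesgue_integral_def g_def)
  show "set_integrable lborel S (\<lambda>z. f (r *\<^sub>R z)) \<longleftrightarrow> set_integrable lborel (shrunk r S) f"
    using eq unfolding ind by (simp add: set_integrable_def g_def)
qed

subsection \<open>One complex variable\<close>

text \<open>Cauchy's estimate on discs of radius 1/4 about points of modulus at most 1/2 bounds the
  second derivative by 2 B / (1/4)^2 = 32 B. Radius 1/2 bounds the first derivative at 0 by 2 B, and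
  18 = 32/2 + 2. The explicit constants make later estimates uniform over families of
  functions.\<close>

lemma Taylor_quadratic_bound:
  assumes h: "\<phi> holomorphic_on ball 0 1" and B: "\<And>z. cmod z < 1 \<Longrightarrow> cmod (\<phi> z) < B"
    and \<mu>: "cmod \<mu> \<le> 1/2"
  shows "cmod (\<phi> \<mu> - \<phi> 0 - \<mu> * deriv \<phi> 0) \<le> 32 * B * (cmod \<mu>)\<^sup>2"
    and "cmod (\<phi> \<mu> - \<phi> 0) \<le> 18 * B * cmod \<mu>"
proof -
  have d2: "cmod ((deriv ^^ 2) \<phi> x) \<le> 32 * B" if "x \<in> cball 0 (1/2)" for x
  proof -
    have sub: "cball x (1/4) \<subseteq> ball 0 1"
    proof
      fix y assume "y \<in> cball x (1/4)"
      then have "norm (y - x) \<le> 1/4" by (simp add: dist_norm norm_minus_commute)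
      then show "y \<in> ball 0 1"
        using that norm_triangle_ineq[of "y - x" x] by simp
    qed
    have "cmod ((deriv ^^ 2) \<phi> x) \<le> fact 2 * B / (1/4)^2"
    proof (rule Cauchy_higher_deriv_bound)
      show "\<phi> holomorphic_on ball x (1/4)"
        using h sub by (meson ball_subset_cball holomorphic_on_subset order_trans)
      show "continuous_on (cball x (1/4)) \<phi>"
        using h sub by (meson holomorphic_on_imp_continuous_on continuous_on_subset)
      show "\<phi> w \<in> ball 0 B" if "w \<in> ball x (1/4)" for w
        using B[of w] sub that ball_subset_cball by force
    qed auto
    then show ?thesis by (simp add: power2_eq_square)
  qed
  define f where "f = (\<lambda>i. (deriv ^^ i) \<phi>)"
  have "cmod (f 0 \<mu> - (\<Sum>i\<le>1. f i 0 * (\<mu> - 0) ^ i / (fact i))) \<le> 32 * B * cmod (\<mu> - 0) ^ Suc 1 / fact 1"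
  proof (rule complex_Taylor)
    show "convex (cball (0::complex) (1/2))" by simp
    show "(f i has_field_derivative f (Suc i) x) (at x within cball 0 (1/2))"
      if "x \<in> cball 0 (1/2)" for i x
    proof -
      have "f i holomorphic_on ball 0 1"
        unfolding f_def using h by (rule holomorphic_higher_deriv) simp
      moreover have "x \<in> ball 0 1" using that by simp
      ultimately have "(f i has_field_derivative deriv (f i) x) (at x)"
        using holomorphic_derivI open_ball by blast
      then show ?thesis
        unfolding f_def by (simp add: has_field_derivative_at_within)
    qed
    show "cmod (f (Suc 1) x) \<le> 32 * B" if "x \<in> cball 0 (1/2)" for x
      using d2[OF that] by (simp add: f_def numeral_2_eq_2)
  qed (use \<mu> in auto)
  then show 1: "cmod (\<phi> \<mu> - \<phi> 0 - \<mu> * deriv \<phi> 0) \<le> 32 * B * (cmod \<mu>)\<^sup>2"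
    by (simp add: f_def power2_eq_square algebra_simps)
  have Bpos: "B > 0" using B[of 0] by (simp add: le_less_trans[OF norm_ge_zero])
  have d1: "cmod ((deriv ^^ 1) \<phi> 0) \<le> fact 1 * B / (1/2)^1"
  proof (rule Cauchy_higher_deriv_bound)
    show "\<phi> holomorphic_on ball 0 (1/2)" using h by (rule holomorphic_on_subset) auto
    show "continuous_on (cball 0 (1/2)) \<phi>"
      by (rule continuous_on_subset[OF holomorphic_on_imp_continuous_on[OF h]]) auto
    show "\<phi> w \<in> ball 0 B" if "w \<in> ball 0 (1/2)" for w
      using B[of w] that by simp
  qed auto
  have "cmod (\<phi> \<mu> - \<phi> 0) \<le> cmod (\<phi> \<mu> - \<phi> 0 - \<mu> * deriv \<phi> 0) + cmod (\<mu> * deriv \<phi> 0)"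
    by (metis diff_add_cancel norm_triangle_ineq)
  also have "\<dots> \<le> 32 * B * (cmod \<mu>)\<^sup>2 + cmod \<mu> * (2 * B)"
    using 1 d1 by (intro add_mono) (auto simp: norm_mult intro!: mult_left_mono)
  also have "(cmod \<mu>)\<^sup>2 \<le> (1/2) * cmod \<mu>"
    unfolding power2_eq_square using \<mu> by (intro mult_right_mono) auto
  finally show "cmod (\<phi> \<mu> - \<phi> 0) \<le> 18 * B * cmod \<mu>"
    using Bpos by (simp add: algebra_simps)
qed

lemma max_modulus_disc:
  assumes "\<phi> holomorphic_on U" "open U" "cball 0 r \<subseteq> U"
    and B: "\<And>z. cmod z = r \<Longrightarrow> cmod (\<phi> z) \<le> B" and \<mu>: "cmod \<mu> \<le> r"
  shows "cmod (\<phi> \<mu>) \<le> B"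
proof (rule maximum_modulus_frontier[of \<phi> "cball 0 r"])
  show "\<phi> holomorphic_on interior (cball 0 r)"
    using assms by (meson holomorphic_on_subset interior_subset order_trans)
  show "continuous_on (closure (cball 0 r)) \<phi>"
    using assms by (metis closed_cball closure_closed continuous_on_subset holomorphic_on_imp_continuous_on)
  show "cmod (\<phi> z) \<le> B" if "z \<in> frontier (cball 0 r)" for z
    using that B by (cases "r \<ge> 0") (auto simp: frontier_cball)
qed (use \<mu> in auto)

lemma annulus_Cauchy:
  assumes "open U" "\<phi> holomorphic_on U" "0 < s" "s \<le> s'"
    and U: "\<And>z. s \<le> cmod z \<Longrightarrow> cmod z \<le> s' \<Longrightarrow> z \<in> U"
  shows "contour_integral (circlepath 0 s) \<phi> = contour_integral (circlepath 0 s') \<phi>"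
proof (rule Cauchy_theorem_homotopic_loops)
  show "homotopic_loops U (circlepath 0 s) (circlepath 0 s')"
  proof (rule homotopic_loops_linear)
    fix t :: real
    let ?e = "exp (2 * of_real pi * \<i> * of_real t)"
    have e: "cmod ?e = 1" by simp
    show "closed_segment (circlepath 0 s t) (circlepath 0 s' t) \<subseteq> U"
    proof
      fix z assume "z \<in> closed_segment (circlepath 0 s t) (circlepath 0 s' t)"
      then obtain u where u: "0 \<le> u" "u \<le> 1"
        "z = (1 - u) *\<^sub>R circlepath 0 s t + u *\<^sub>R circlepath 0 s' t"
        by (auto simp: closed_segment_def)
      have "z = complex_of_real ((1 - u) * s + u * s') * ?e"
        using u(3) by (simp add: circlepath scaleR_conv_of_real algebra_simps)
      then have "cmod z = \<bar>(1 - u) * s + u * s'\<bar>"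
        using e by (simp add: norm_mult del: of_real_add of_real_mult)
      moreover have "s \<le> (1 - u) * s + u * s'" "(1 - u) * s + u * s' \<le> s'"
      proof -
        have "(1 - u) * s + u * s' = s + u * (s' - s)" by (simp add: algebra_simps)
        moreover have "0 \<le> u * (s' - s)" using u assms(4) by simp
        moreover have "u * (s' - s) \<le> 1 * (s' - s)" using u assms(4) by (intro mult_right_mono) auto
        ultimately show "s \<le> (1 - u) * s + u * s'" "(1 - u) * s + u * s' \<le> s'" by auto
      qed
      ultimately show "z \<in> U" using \<open>0 < s\<close> by (intro U) auto
    qed
  qed (auto intro: valid_path_imp_path)
qed (use assms in auto)

lemma circle_mean_holomorphic:
  assumes "\<phi> holomorphic_on U" "open U" "cball 0 1 \<subseteq> U"
  shows "(LINT t:{0..2*pi}|lborel. \<phi> (cis t)) = (2 * pi) *\<^sub>R \<phi> 0"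
proof -
  have c: "continuous_on {0..2*pi} (\<lambda>t. \<phi> (cis t))"
    unfolding cis_conv_exp
    by (rule continuous_on_compose2[OF holomorphic_on_imp_continuous_on[OF assms(1)]])
      (use assms(3) in \<open>auto intro!: continuous_intros\<close>)
  then have "set_integrable lborel {0..2*pi} (\<lambda>t. \<phi> (cis t))"
    unfolding set_integrable_def by (intro borel_integrable_compact) auto
  then have 1: "(LINT t:{0..2*pi}|lborel. \<phi> (cis t)) = integral {0..2*pi} (\<lambda>t. \<phi> (cis t))"
    by (rule set_borel_integral_eq_integral)
  have "contour_integral (circlepath 0 1) (\<lambda>w. \<phi> w / (w - 0)) = 2 * of_real pi * \<i> * \<phi> 0"
    by (rule contour_integral_unique, rule Cauchy_integral_circlepath)
      (use assms order_trans[OF ball_subset_cball assms(3)] in \<open>auto intro: holomorphic_on_subset[OF assms(1)]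
          continuous_on_subset[OF holomorphic_on_imp_continuous_on[OF assms(1)]]\<close>)
  then have "integral {0..2*pi} (\<lambda>t. \<phi> (cis t) / cis t * \<i> * cis t) = 2 * of_real pi * \<i> * \<phi> 0"
    unfolding circlepath_def by (simp add: contour_integral_part_circlepath_eq)
  then have "\<i> * integral {0..2*pi} (\<lambda>t. \<phi> (cis t)) = 2 * of_real pi * \<i> * \<phi> 0"
    by (simp add: mult.commute flip: integral_mult_right)
  then show ?thesis using 1 by (simp add: scaleR_conv_of_real)
qed

text \<open>Joint continuity bounds h on a compact disc times the interval, so the quadratic Taylor
  bound is uniform in t and survives integration. The derivative of the integral is thus the
  integral of the derivatives.\<close>

lemma holomorphic_param_integral:
  fixes h :: "complex \<Rightarrow> real \<Rightarrow> complex"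
  assumes S: "open S" and cont: "continuous_on (S \<times> {a..b}) (\<lambda>(x, t). h x t)"
    and hol: "\<And>t. t \<in> {a..b} \<Longrightarrow> (\<lambda>x. h x t) holomorphic_on S" and ab: "a \<le> b"
  shows "(\<lambda>x. integral {a..b} (h x)) holomorphic_on S"
proof -
  have "\<exists>D. ((\<lambda>x. integral {a..b} (h x)) has_field_derivative D) (at x0)" if x0: "x0 \<in> S" for x0
  proof -
    obtain r where r: "r > 0" "cball x0 r \<subseteq> S" using S x0 open_contains_cball by blast
    have "compact ((\<lambda>(x, t). h x t) ` (cball x0 r \<times> {a..b}))"
      by (intro compact_continuous_image continuous_on_subset[OF cont] compact_Times)
        (use r in auto)
    then obtain M where M: "\<And>x t. x \<in> cball x0 r \<Longrightarrow> t \<in> {a..b} \<Longrightarrow> cmod (h x t) \<le> M"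
      by (force dest!: compact_imp_bounded simp: bounded_iff)
    define \<phi> where "\<phi> = (\<lambda>t \<mu>. h (x0 + of_real r * \<mu>) t)"
    have inb: "x0 + of_real r * \<mu> \<in> cball x0 r" if "cmod \<mu> < 1" for \<mu>
      using that r by (simp add: dist_norm norm_mult)
    have hol\<phi>: "\<phi> t holomorphic_on ball 0 1" if "t \<in> {a..b}" for t
      unfolding \<phi>_def
      by (rule holomorphic_on_compose_gen[OF _ hol[OF that], unfolded o_def])
        (use inb r in \<open>auto intro!: holomorphic_intros\<close>)
    have bd\<phi>: "cmod (\<phi> t \<mu>) < M + 1" if "t \<in> {a..b}" "cmod \<mu> < 1" for t \<mu>
      using M[OF inb[OF that(2)] that(1)] by (simp add: \<phi>_def)
    define D where "D = (\<lambda>t. deriv (\<phi> t) 0)"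
    have T: "cmod (\<phi> t \<mu> - \<phi> t 0 - \<mu> * D t) \<le> 32 * (M + 1) * (cmod \<mu>)\<^sup>2"
      if "t \<in> {a..b}" "cmod \<mu> \<le> 1/2" for t \<mu>
      unfolding D_def using Taylor_quadratic_bound(1)[OF hol\<phi>[OF that(1)] bd\<phi>[OF that(1)] that(2)] by simp
    have cont\<phi>: "continuous_on {a..b} (\<lambda>t. \<phi> t \<mu>)" if "cmod \<mu> < 1" for \<mu>
      unfolding \<phi>_def
      by (rule continuous_on_compose2[OF cont, of _ "\<lambda>t. (x0 + of_real r * \<mu>, t)", simplified])
        (use inb[OF that] r in \<open>auto intro!: continuous_intros\<close>)
    have M0: "M + 1 > 0" using bd\<phi>[of a 0] ab by (simp add: le_less_trans[OF norm_ge_zero])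
    \<comment> \<open>\<open>D\<close> is integrable because it is continuous, being a uniform limit
      of difference quotients. The steps \<open>q n\<close> tend to 0 and never exceed 1/2, where
      the Taylor bound holds.\<close>
    have contD: "continuous_on {a..b} D"
    proof (rule uniform_limit_theorem[where F = sequentially])
      define q where "q = (\<lambda>n::nat. complex_of_real (1 / (real n + 2)))"
      have q: "cmod (q n) = 1 / (real n + 2)" for n
        unfolding q_def norm_of_real by simp
      have q0: "q n \<noteq> 0" for n
        unfolding q_def of_real_eq_0_iff by simp
      show "\<forall>\<^sub>F n in sequentially. continuous_on {a..b} (\<lambda>t. (\<phi> t (q n) - \<phi> t 0) / q n)"
        by (intro always_eventually allI continuous_intros cont\<phi>)
          (simp_all add: q q0)
      show "uniform_limit {a..b} (\<lambda>n t. (\<phi> t (q n) - \<phi> t 0) / q n) D sequentially"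
      proof (rule uniform_limitI)
        fix e :: real assume "e > 0"
        have "(\<lambda>n. 32 * (M + 1) * (1 / (real n + 2))) \<longlonglongrightarrow> 0" by real_asymp
        then have "\<forall>\<^sub>F n in sequentially. 32 * (M + 1) * (1 / (real n + 2)) < e"
          using \<open>e > 0\<close> by (rule order_tendstoD)
        then show "\<forall>\<^sub>F n in sequentially. \<forall>t\<in>{a..b}. dist ((\<phi> t (q n) - \<phi> t 0) / q n) (D t) < e"
        proof eventually_elim
          case (elim n)
          show ?case
          proof
            fix t assume t: "t \<in> {a..b}"
            have "dist ((\<phi> t (q n) - \<phi> t 0) / q n) (D t) = cmod ((\<phi> t (q n) - \<phi> t 0 - q n * D t) / q n)"
              using q0[of n] by (simp add: dist_norm diff_divide_distrib)
            also have "\<dots> = cmod (\<phi> t (q n) - \<phi> t 0 - q n * D t) / cmod (q n)"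
              by (rule norm_divide)
            also have "\<dots> \<le> 32 * (M + 1) * (cmod (q n))\<^sup>2 / cmod (q n)"
              by (intro divide_right_mono T t) (simp_all only: q, simp_all)
            also have "\<dots> = 32 * (M + 1) * (1 / (real n + 2))"
              unfolding q by (simp add: power2_eq_square)
            finally show "dist ((\<phi> t (q n) - \<phi> t 0) / q n) (D t) < e" using elim by simp
          qed
        qed
      qed
    qed simp
    define I where "I = (\<lambda>\<mu>. integral {a..b} (\<lambda>t. \<phi> t \<mu>))"
    have TI: "cmod (I \<mu> - I 0 - \<mu> * integral {a..b} D) \<le> 32 * (M + 1) * (b - a) * (cmod \<mu>)\<^sup>2"
      if \<mu>: "cmod \<mu> \<le> 1/2" for \<mu>
    proof -
      have i: "(\<lambda>t. \<phi> t \<mu>) integrable_on {a..b}" "(\<lambda>t. \<phi> t 0) integrable_on {a..b}" "D integrable_on {a..b}"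
        using cont\<phi>[of \<mu>] cont\<phi>[of 0] \<mu> contD by (auto intro: integrable_continuous_real)
      have "I \<mu> - I 0 - \<mu> * integral {a..b} D = integral {a..b} (\<lambda>t. \<phi> t \<mu> - \<phi> t 0 - \<mu> * D t)"
        unfolding I_def using i by (simp add: integral_diff integrable_diff integrable_on_mult_right)
      also have "cmod \<dots> \<le> 32 * (M + 1) * (cmod \<mu>)\<^sup>2 * (b - a)"
      proof (rule integral_bound[OF ab])
        show "continuous_on {a..b} (\<lambda>t. \<phi> t \<mu> - \<phi> t 0 - \<mu> * D t)"
          using cont\<phi>[of \<mu>] cont\<phi>[of 0] \<mu> contD by (intro continuous_intros) auto
      qed (use T \<mu> in auto)
      finally show ?thesis by (simp add: algebra_simps)
    qed
    have "(I has_field_derivative integral {a..b} D) (at 0)"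
      unfolding has_field_derivative_def has_derivative_at_alt
    proof (intro conjI allI impI)
      show "bounded_linear ((*) (integral {a..b} D))" by (rule bounded_linear_mult_right)
      fix e :: real assume e: "e > 0"
      define C where "C = 32 * (M + 1) * (b - a)"
      have C: "C \<ge> 0" using M0 ab by (simp add: C_def)
      define d where "d = min (1/2) (e / (C + 1))"
      have "norm (I y - I 0 - integral {a..b} D * (y - 0)) \<le> e * norm (y - 0)" if "norm (y - 0) < d" for y
      proof -
        have "norm (I y - I 0 - integral {a..b} D * (y - 0)) \<le> C * (cmod y)\<^sup>2"
          using TI[of y] that by (simp add: d_def C_def mult.commute)
        also have "\<dots> = (C * cmod y) * cmod y" by (simp add: power2_eq_square)
        also have "C * cmod y \<le> (C + 1) * (e / (C + 1))"
          using that C by (intro mult_mono) (auto simp: d_def)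
        also have "\<dots> = e" using C by simp
        finally show ?thesis by (simp add: mult_right_mono)
      qed
      then show "\<exists>d>0. \<forall>y. norm (y - 0) < d \<longrightarrow> norm (I y - I 0 - integral {a..b} D * (y - 0)) \<le> e * norm (y - 0)"
        using e C by (intro exI[of _ d]) (auto simp: d_def)
    qed
    then have "((\<lambda>x. I ((x - x0) / of_real r)) has_field_derivative integral {a..b} D * (1 / of_real r)) (at x0)"
      by (intro DERIV_chain2[where f = I]) (use r in \<open>auto intro!: derivative_eq_intros\<close>)
    moreover have "I ((x - x0) / of_real r) = integral {a..b} (h x)" for x
      unfolding I_def \<phi>_def using r by simp
    ultimately show ?thesis by auto
  qed
  then show ?thesis
    unfolding holomorphic_on_def field_differentiable_def
    by (meson has_field_derivative_at_within)
qed

subsection \<open>Holomorphic functions of several variables\<close>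

text \<open>Gateaux holomorphy. The base point a may lie outside S: the slice is holomorphic on the
  whole trace of S on the line. With local boundedness this gives \<open>hol_on\<close> (see
  \<open>hol_onI\<close>), so parameter integrals and limits can be treated in one variable.\<close>

definition slice_hol :: "(complex ^ 'n \<Rightarrow> complex) \<Rightarrow> (complex ^ 'n) set \<Rightarrow> bool" where
  "slice_hol F S \<longleftrightarrow> (\<forall>a v. (\<lambda>\<mu>. F (a + \<mu> *s v)) holomorphic_on {\<mu>. a + \<mu> *s v \<in> S})"

definition loc_bdd :: "('a::metric_space \<Rightarrow> 'b::real_normed_vector) \<Rightarrow> 'a set \<Rightarrow> bool" where
  "loc_bdd F S \<longleftrightarrow> (\<forall>a\<in>S. \<exists>e>0. \<exists>M. \<forall>z\<in>ball a e. norm (F z) \<le> M)"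

lemma open_slice:
  fixes S :: "(complex ^ 'n) set"
  assumes "open S" shows "open {\<mu>. a + \<mu> *s v \<in> S}"
proof -
  have "continuous_on UNIV (\<lambda>\<mu>. a + \<mu> *s v)" by (intro continuous_intros)
  from open_vimage[OF assms this] show ?thesis by (simp add: vimage_def)
qed

lemma slice_holI:
  assumes S: "open S"
    and F: "\<And>a v. a \<in> S \<Longrightarrow> \<exists>e>0. (\<lambda>\<mu>. F (a + \<mu> *s v)) holomorphic_on ball 0 e"
  shows "slice_hol F S"
  unfolding slice_hol_def
proof (intro allI)
  fix a v
  show "(\<lambda>\<mu>. F (a + \<mu> *s v)) holomorphic_on {\<mu>. a + \<mu> *s v \<in> S}"
    unfolding holomorphic_on_def
  proof (rule ballI, rule field_differentiable_at_within)
    fix \<mu>0 assume "\<mu>0 \<in> {\<mu>. a + \<mu> *s v \<in> S}"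
    then obtain e where e: "e > 0" "(\<lambda>\<mu>. F ((a + \<mu>0 *s v) + \<mu> *s v)) holomorphic_on ball 0 e"
      using F[of "a + \<mu>0 *s v" v] by auto
    have "(\<lambda>\<mu>. F ((a + \<mu>0 *s v) + (\<mu> - \<mu>0) *s v)) holomorphic_on ball \<mu>0 e"
      by (rule holomorphic_on_compose_gen[OF _ e(2), unfolded o_def])
        (auto intro!: holomorphic_intros simp: dist_norm norm_minus_commute)
    moreover have "(a + \<mu>0 *s v) + (\<mu> - \<mu>0) *s v = a + \<mu> *s v" for \<mu>
      by (simp add: vec_eq_iff algebra_simps)
    ultimately have "(\<lambda>\<mu>. F (a + \<mu> *s v)) holomorphic_on ball \<mu>0 e" by simp
    then show "(\<lambda>\<mu>. F (a + \<mu> *s v)) field_differentiable at \<mu>0"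
      using e(1) by (simp add: holomorphic_on_imp_differentiable_at)
  qed
qed

lemma hol_on_slice:
  assumes "hol_on F S" shows "slice_hol F S"
  unfolding slice_hol_def holomorphic_on_def
proof (intro allI ballI, rule field_differentiable_at_within)
  fix a v \<mu> assume "\<mu> \<in> {\<mu>. a + \<mu> *s v \<in> S}"
  then obtain D where D: "(F has_derivative D) (at (a + \<mu> *s v))" "\<And>c v. D (c *s v) = c * D v"
    using assms unfolding hol_on_def by blast
  have "((\<lambda>\<mu>. a + \<mu> *s v) has_derivative (\<lambda>h. h *s v)) (at \<mu>)"
  proof -
    have "linear (\<lambda>h. h *s v)"
      by (intro linearI) (simp_all add: vec_eq_iff algebra_simps)
    then have "((\<lambda>h. h *s v) has_derivative (\<lambda>h. h *s v)) (at \<mu>)"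
      by (intro bounded_linear_imp_has_derivative) (simp add: linear_conv_bounded_linear)
    then show ?thesis by (auto intro!: derivative_eq_intros)
  qed
  from has_derivative_compose[OF this D(1)]
  have "((\<lambda>\<mu>. F (a + \<mu> *s v)) has_derivative (\<lambda>h. D v * h)) (at \<mu>)"
    by (simp add: D(2) mult.commute)
  then show "(\<lambda>\<mu>. F (a + \<mu> *s v)) field_differentiable at \<mu>"
    unfolding field_differentiable_def has_field_derivative_def by blast
qed

lemma hol_on_continuous: "hol_on F S \<Longrightarrow> continuous_on S F"
  unfolding hol_on_def by (meson continuous_at_imp_continuous_on has_derivative_continuous)

lemma continuous_loc_bdd:
  assumes "continuous_on S F" "open S" shows "loc_bdd F S"
  unfolding loc_bdd_def
proof
  fix a assume a: "a \<in> S"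
  then have "isCont F a" using assms by (simp add: continuous_on_eq_continuous_at)
  then obtain e where "e > 0" "\<And>z. dist z a < e \<Longrightarrow> dist (F z) (F a) < 1"
    unfolding continuous_at_eps_delta by (metis zero_less_one)
  then have "\<forall>z\<in>ball a e. norm (F z) \<le> norm (F a) + 1"
    by (smt (verit) dist_commute dist_norm mem_ball norm_triangle_sub)
  then show "\<exists>e>0. \<exists>M. \<forall>z\<in>ball a e. norm (F z) \<le> M" using \<open>e > 0\<close> by blast
qed

lemma cscale_simps:
  fixes v :: "complex ^ 'n"
  shows "(a * b) *s v = a *s (b *s v)" "a *s (u + v) = a *s u + a *s v" "0 *s v = 0" "1 *s v = v"
    "a *s (0 :: complex ^ 'n) = 0" "(a + b) *s v = a *s v + b *s v"
  by (simp_all add: vec_eq_iff algebra_simps)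

text \<open>A locally bounded function that is holomorphic on complex lines is Frechet differentiable.
  Additivity of the derivative comes from a second order estimate of the
  difference \<open>F (a + t u + t v) - F (a + t u) - F (a + t v) + F a\<close>.\<close>

lemma hol_onI:
  fixes F :: "complex ^ 'n \<Rightarrow> complex"
  assumes S: "open S" and sl: "slice_hol F S" and bd: "loc_bdd F S"
  shows "hol_on F S"
  unfolding hol_on_def
proof
  fix a assume a: "a \<in> S"
  obtain e0 where e0: "e0 > 0" "ball a e0 \<subseteq> S" using S a open_contains_ball by blast
  obtain e1 M0 where e1: "e1 > 0" "\<And>z. z \<in> ball a e1 \<Longrightarrow> cmod (F z) \<le> M0"
    using bd a unfolding loc_bdd_def by blast
  \<comment> \<open>A third of the radius: a base point displaced by less than e still has room for
    a unit disc in a direction of norm below e, and so has a itself in the direction u + v.\<close>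
  define e where "e = min e0 e1 / 3"
  have e: "e > 0" using e0 e1 by (simp add: e_def)
  define M where "M = max M0 0 + 1"
  have M: "M > 0" by (simp add: M_def)
  have S': "z \<in> S" and bdM: "cmod (F z) < M" if "norm (z - a) < 3 * e" for z
    using that e0(2) e1(2)[of z] by (auto simp: e_def M_def dist_norm norm_minus_commute subset_iff)
  define D where "D = (\<lambda>v. deriv (\<lambda>\<mu>. F (a + \<mu> *s v)) 0)"
  have inb: "norm (b + \<mu> *s w - a) < 3 * e" if "norm (b - a) + norm w < 3 * e" "cmod \<mu> \<le> 1" for b w \<mu>
  proof -
    have "norm (\<mu> *s w) \<le> norm w" using that by (simp add: norm_cscale mult_left_le_one_le)
    moreover have "norm (b + \<mu> *s w - a) \<le> norm (b - a) + norm (\<mu> *s w)"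
      by (metis add.commute add_diff_eq norm_triangle_ineq)
    ultimately show ?thesis using that by linarith
  qed
  have slh: "(\<lambda>\<mu>. F (b + \<mu> *s w)) holomorphic_on ball 0 1" if "norm (b - a) + norm w < 3 * e" for b w
  proof -
    have "ball 0 1 \<subseteq> {\<mu>. b + \<mu> *s w \<in> S}" using S' inb[OF that] by auto
    then show ?thesis using sl unfolding slice_hol_def by (meson holomorphic_on_subset)
  qed
  have bdw: "cmod (F (b + \<mu> *s w)) < M" if "norm (b - a) + norm w < 3 * e" "cmod \<mu> < 1" for b w \<mu>
    using bdM[OF inb[OF that(1)]] that by simp
  have T: "cmod (F (a + \<mu> *s w) - F a - \<mu> * D w) \<le> 32 * M * (cmod \<mu>)\<^sup>2"
    if "norm w < 3 * e" "cmod \<mu> \<le> 1/2" for w \<mu>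
    using Taylor_quadratic_bound(1)[OF slh[of a w], of M \<mu>] bdw[of a w] that by (simp add: D_def)
  have L: "cmod (F (b + \<mu> *s w) - F b) \<le> 18 * M * cmod \<mu>"
    if "norm (b - a) + norm w < 3 * e" "cmod \<mu> \<le> 1/2" for b w \<mu>
    using Taylor_quadratic_bound(2)[OF slh[of b w], of M \<mu>] bdw[of b w] that by simp
  have Dscale: "D (c *s v) = c * D v" for c v
  proof -
    obtain \<epsilon> where \<epsilon>: "\<epsilon> > 0" "(\<lambda>\<mu>. F (a + \<mu> *s v)) holomorphic_on ball 0 \<epsilon>"
    proof -
      have "open {\<mu>. a + \<mu> *s v \<in> S}" "0 \<in> {\<mu>. a + \<mu> *s v \<in> S}"
        using open_slice[OF S] a by auto
      then obtain \<epsilon> where "\<epsilon> > 0" "ball 0 \<epsilon> \<subseteq> {\<mu>. a + \<mu> *s v \<in> S}" using open_contains_ball by blast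
      then show ?thesis using that sl unfolding slice_hol_def by (meson holomorphic_on_subset)
    qed
    have "((\<lambda>\<mu>. F (a + \<mu> *s v)) has_field_derivative D v) (at (c * 0))"
      using holomorphic_derivI[OF \<epsilon>(2) open_ball, of 0] \<epsilon>(1) by (simp add: D_def)
    from DERIV_chain2[where f = "\<lambda>\<mu>. F (a + \<mu> *s v)" and g = "\<lambda>x. c * x" and x = 0 and s = UNIV, OF this]
    have "((\<lambda>x. F (a + (c * x) *s v)) has_field_derivative D v * c) (at 0)"
      by (auto intro!: derivative_eq_intros)
    moreover have "(c * x) *s v = x *s (c *s v)" for x
      by (simp add: vec_eq_iff algebra_simps)
    ultimately have "((\<lambda>x. F (a + x *s (c *s v))) has_field_derivative D v * c) (at 0)" by simp
    then show ?thesis unfolding D_def by (simp add: DERIV_imp_deriv mult.commute)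
  qed
  have Dadd_small: "D (u + v) = D u + D v" if u: "norm u < e" and v: "norm v < e" for u v
  proof -
    \<comment> \<open>342 = 18 * 19 bounds the mixed second difference, by the Lipschitz estimate
      first in direction u and then in direction v. The three Taylor remainders add 3 * 32.\<close>
    have "cmod (D (u + v) - D u - D v) * t \<le> 438 * M * t\<^sup>2" if t: "0 < t" "t \<le> 1/2" for t :: real
    proof -
      let ?t = "complex_of_real t"
      have t1: "cmod ?t = t" using t by simp
      have uv: "norm (u + v) < 3 * e" using norm_triangle_ineq[of u v] u v e by linarith
      define G where "G = (\<lambda>\<mu>. F ((a + ?t *s u) + \<mu> *s v) - F (a + \<mu> *s v))"
      have tu: "norm (?t *s u) < e"
        using mult_right_mono[of t 1 "norm u"] u t by (simp add: norm_cscale)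
      have "G holomorphic_on ball 0 1"
        unfolding G_def using tu u v e by (intro holomorphic_intros slh) auto
      moreover have "cmod (G \<mu>) < 19 * M * t" if "cmod \<mu> < 1" for \<mu>
      proof -
        have mv: "norm (\<mu> *s v) < e"
          using mult_right_mono[of "cmod \<mu>" 1 "norm v"] v that by (simp add: norm_cscale)
        have "cmod (F ((a + \<mu> *s v) + ?t *s u) - F (a + \<mu> *s v)) \<le> 18 * M * cmod ?t"
          using mv u e t t1 by (intro L) auto
        then have "cmod (G \<mu>) \<le> 18 * M * t" using t1 by (simp add: G_def algebra_simps)
        also have "\<dots> < 19 * M * t" using M t by simp
        finally show ?thesis .
      qed
      ultimately have "cmod (G ?t - G 0) \<le> 18 * (19 * M * t) * cmod ?t"
        using t by (intro Taylor_quadratic_bound(2)) auto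
      then have 1: "cmod (F (a + ?t *s u + ?t *s v) - F (a + ?t *s v) - F (a + ?t *s u) + F a) \<le> 342 * M * t\<^sup>2"
        using t1 by (simp add: G_def power2_eq_square algebra_simps)
      have Tw: "cmod (F (a + ?t *s w) - F a - ?t * D w) \<le> 32 * M * t\<^sup>2" if "norm w < 3 * e" for w
        using T[OF that, of ?t] t t1 by simp
      let ?A = "F (a + ?t *s u + ?t *s v) - F (a + ?t *s v) - F (a + ?t *s u) + F a"
      let ?R = "\<lambda>w. F (a + ?t *s w) - F a - ?t * D w"
      have "?t * (D (u + v) - D u - D v) = ?A - ?R (u + v) + ?R u + ?R v"
        by (simp add: cscale_simps algebra_simps)
      then have "cmod (?t * (D (u + v) - D u - D v)) \<le> cmod ?A + cmod (?R (u + v)) + cmod (?R u) + cmod (?R v)"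
        by (smt (verit) norm_triangle_ineq norm_triangle_ineq4)
      also have "\<dots> \<le> 342 * M * t\<^sup>2 + 32 * M * t\<^sup>2 + 32 * M * t\<^sup>2 + 32 * M * t\<^sup>2"
        using u v e uv by (intro add_mono 1 Tw) auto
      finally show ?thesis using t1 by (simp add: norm_mult ac_simps)
    qed
    then have le: "cmod (D (u + v) - D u - D v) \<le> 438 * M * t" if "0 < t" "t \<le> 1/2" for t :: real
      using that by (simp add: power2_eq_square mult.assoc)
    have "cmod (D (u + v) - D u - D v) \<le> 0"
    proof (rule ccontr)
      assume "\<not> ?thesis"
      then have p: "cmod (D (u + v) - D u - D v) > 0" by simp
      define t where "t = min (1/2) (cmod (D (u + v) - D u - D v) / (876 * M))"
      have "0 < t" "t \<le> 1/2" using p M by (auto simp: t_def)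
      moreover have "438 * M * t \<le> 438 * M * (cmod (D (u + v) - D u - D v) / (876 * M))"
        using M by (intro mult_left_mono) (auto simp: t_def)
      ultimately show False using le[of t] p M by simp
    qed
    then show ?thesis by (simp add: algebra_simps)
  qed
  have Dadd: "D (u + v) = D u + D v" for u v
  proof -
    \<comment> \<open>Homogeneity reduces additivity to vectors of norm below e.\<close>
    define r where "r = e / (norm u + norm v + 1)"
    have r: "r > 0" using e by (simp add: r_def add_nonneg_pos)
    have "norm (complex_of_real r *s u) < e" "norm (complex_of_real r *s v) < e"
    proof -
      have p: "norm u + norm v + 1 > 0" by (intro add_nonneg_pos) auto
      have "r * norm u < r * (norm u + norm v + 1)" "r * norm v < r * (norm u + norm v + 1)"
        using norm_ge_zero[of u] norm_ge_zero[of v] by (intro mult_strict_left_mono r; linarith)+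
      moreover have "r * (norm u + norm v + 1) = e" using p by (simp add: r_def)
      ultimately show "norm (complex_of_real r *s u) < e" "norm (complex_of_real r *s v) < e"
        using r by (simp_all add: norm_cscale)
    qed
    from Dadd_small[OF this] have "complex_of_real r * D (u + v) = complex_of_real r * (D u + D v)"
      by (simp only: Dscale cscale_simps(2)[symmetric] distrib_left)
    then show ?thesis using r by simp
  qed
  have lin: "linear D"
    by (intro linearI Dadd) (simp add: scaleR_eq_cscale Dscale scaleR_conv_of_real)
  have "(F has_derivative D) (at a)"
    unfolding has_derivative_at_alt
  proof (intro conjI allI impI)
    show "bounded_linear D" using lin by (simp add: linear_conv_bounded_linear)
    fix \<epsilon> :: real assume \<epsilon>: "\<epsilon> > 0"
    define d where "d = min (e / 2) (\<epsilon> * e\<^sup>2 / (32 * M))"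
    have "cmod (F y - F a - D (y - a)) \<le> \<epsilon> * norm (y - a)" if y: "norm (y - a) < d" for y
    proof (cases "y = a")
      case True
      then show ?thesis using Dscale[of 0 0] by simp
    next
      case False
      define \<mu> where "\<mu> = complex_of_real (norm (y - a) / e)"
      define w where "w = complex_of_real (e / norm (y - a)) *s (y - a)"
      have m: "cmod \<mu> = norm (y - a) / e" using e by (simp add: \<mu>_def norm_divide)
      have yw: "y - a = \<mu> *s w" using False e by (simp add: \<mu>_def w_def vec_eq_iff)
      have "norm w = e" using False e unfolding w_def norm_cscale norm_of_real by simp
      then have "cmod (F (a + \<mu> *s w) - F a - \<mu> * D w) \<le> 32 * M * (cmod \<mu>)\<^sup>2"
        using e y by (intro T) (simp_all add: m d_def divide_le_eq)
      moreover have "a + \<mu> *s w = y" using yw[symmetric] by simp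
      moreover have "\<mu> * D w = D (y - a)" by (simp add: yw Dscale)
      ultimately have "cmod (F y - F a - D (y - a)) \<le> 32 * M * (norm (y - a) / e)\<^sup>2"
        by (simp add: m)
      also have "\<dots> = (32 * M / e\<^sup>2 * norm (y - a)) * norm (y - a)"
        by (simp add: power2_eq_square)
      also have "32 * M / e\<^sup>2 * norm (y - a) \<le> 32 * M / e\<^sup>2 * (\<epsilon> * e\<^sup>2 / (32 * M))"
        using y M by (intro mult_left_mono) (auto simp: d_def)
      also have "\<dots> = \<epsilon>" using M e by simp
      finally show ?thesis by (simp add: mult_right_mono)
    qed
    moreover have "d > 0" using e M \<epsilon> by (simp add: d_def)
    ultimately show "\<exists>d>0. \<forall>y. norm (y - a) < d \<longrightarrow> norm (F y - F a - D (y - a)) \<le> \<epsilon> * norm (y - a)"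
      by blast
  qed
  then show "\<exists>D. (F has_derivative D) (at a) \<and> (\<forall>c v. D (c *s v) = c * D v)"
    using Dscale by blast
qed

lemma hol_on_subset: "hol_on F S \<Longrightarrow> T \<subseteq> S \<Longrightarrow> hol_on F T"
  unfolding hol_on_def by blast

lemma hol_on_cong:
  assumes "open S" "\<And>z. z \<in> S \<Longrightarrow> F z = G z" "hol_on F S" shows "hol_on G S"
  using assms has_derivative_transform_within_open[OF _ assms(1)] unfolding hol_on_def by blast

lemma hol_on_iff:
  assumes "open S" shows "hol_on F S \<longleftrightarrow> slice_hol F S \<and> continuous_on S F"
  using assms hol_on_slice hol_on_continuous hol_onI continuous_loc_bdd by blast

lemma hol_on_const: "hol_on (\<lambda>z. c) S"
  unfolding hol_on_def by (auto intro!: exI[of _ "\<lambda>z. 0"])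

lemma hol_on_add: "hol_on F S \<Longrightarrow> hol_on G S \<Longrightarrow> hol_on (\<lambda>z. F z + G z) S"
  unfolding hol_on_def
proof (intro ballI)
  fix z assume "z \<in> S"
  assume "\<forall>z\<in>S. \<exists>D. (F has_derivative D) (at z) \<and> (\<forall>c v. D (c *s v) = c * D v)"
    "\<forall>z\<in>S. \<exists>D. (G has_derivative D) (at z) \<and> (\<forall>c v. D (c *s v) = c * D v)"
  with \<open>z \<in> S\<close> obtain D E where "(F has_derivative D) (at z)" "\<And>c v. D (c *s v) = c * D v"
    "(G has_derivative E) (at z)" "\<And>c v. E (c *s v) = c * E v"
    by meson
  then show "\<exists>D. ((\<lambda>z. F z + G z) has_derivative D) (at z) \<and> (\<forall>c v. D (c *s v) = c * D v)"
    by (intro exI[of _ "\<lambda>h. D h + E h"] conjI has_derivative_add) (auto simp: algebra_simps)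
qed

lemma hol_on_mult:
  assumes "hol_on F S" "hol_on G S" shows "hol_on (\<lambda>z. F z * G z) S"
  unfolding hol_on_def
proof
  fix z assume "z \<in> S"
  then obtain D E where "(F has_derivative D) (at z)" "\<And>c v. D (c *s v) = c * D v"
    "(G has_derivative E) (at z)" "\<And>c v. E (c *s v) = c * E v"
    using assms unfolding hol_on_def by meson
  then show "\<exists>D. ((\<lambda>z. F z * G z) has_derivative D) (at z) \<and> (\<forall>c v. D (c *s v) = c * D v)"
    by (intro exI[of _ "\<lambda>h. F z * E h + D h * G z"] conjI has_derivative_mult)
      (auto simp: algebra_simps)
qed

lemma hol_on_cmult: "hol_on F S \<Longrightarrow> hol_on (\<lambda>z. c * F z) S"
  by (intro hol_on_mult hol_on_const)

lemma hol_on_diff: "hol_on F S \<Longrightarrow> hol_on G S \<Longrightarrow> hol_on (\<lambda>z. F z - G z) S"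
  using hol_on_add[of F S "\<lambda>z. (-1) * G z"] hol_on_cmult[of G S "-1"] by simp

lemma hol_on_sum: "(\<And>i. i \<in> I \<Longrightarrow> hol_on (F i) S) \<Longrightarrow> hol_on (\<lambda>z. \<Sum>i\<in>I. F i z) S"
  by (induction I rule: infinite_finite_induct) (auto intro: hol_on_const hol_on_add)

lemma hol_on_nth: "hol_on (\<lambda>z. z $ i) S"
  unfolding hol_on_def
  by (auto intro!: exI[of _ "\<lambda>z. z $ i"] bounded_linear_imp_has_derivative bounded_linear_vec_nth)

lemma hol_on_power: "hol_on F S \<Longrightarrow> hol_on (\<lambda>z. F z ^ k) S"
  by (induction k) (auto intro: hol_on_const hol_on_mult)

lemma hol_on_line:
  assumes "hol_on F S"
  shows "(\<lambda>\<mu>. F (\<mu> *s z)) holomorphic_on {\<mu>. \<mu> *s z \<in> S}"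
  using hol_on_slice[OF assms, unfolded slice_hol_def, rule_format, of 0 z] by simp

lemma open_line:
  fixes S :: "(complex ^ 'n) set"
  assumes "open S" shows "open {\<mu>. \<mu> *s z \<in> S}"
  using open_slice[OF assms, of 0 z] by simp

lemma hol_on_local:
  assumes "\<And>z. z \<in> S \<Longrightarrow> \<exists>T. open T \<and> z \<in> T \<and> hol_on F T" shows "hol_on F S"
  using assms unfolding hol_on_def by meson

subsection \<open>Hartogs' extension theorem across a circular compact set\<close>

lemma complete_circular_mono:
  assumes "complete_circular S" "cmod c \<le> cmod d" "d *s z \<in> S"
  shows "c *s z \<in> S"
proof (cases "d = 0")
  case False
  then have "cmod (c / d) \<le> 1" using assms(2) by (simp add: norm_divide divide_le_eq)
  then have "(c / d) *s (d *s z) \<in> S"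
    using assms(1,3) unfolding complete_circular_def by blast
  then show ?thesis using False by (simp add: cscale_simps(1)[symmetric])
qed (use assms in auto)

lemma dist_scaleR_same: "r > 0 \<Longrightarrow> dist (r *\<^sub>R v) (r *\<^sub>R w) = r * dist v w"
  for v :: "'a::real_normed_vector"
  unfolding dist_norm scaleR_diff_right[symmetric] norm_scaleR by simp

lemma norm_axis_complex: "norm (axis i c :: complex ^ 'n) = cmod c"
proof -
  have "(\<Sum>j\<in>UNIV. (cmod (if j = i then c else 0))\<^sup>2) = (\<Sum>j\<in>UNIV. if j = i then (cmod c)\<^sup>2 else 0)"
    by (intro sum.cong) auto
  then show ?thesis by (simp add: norm_vec_def L2_set_def axis_def)
qed

text \<open>Dimension at least two lets nearby points be joined by complex lines that avoid the
  origin. Lipschitz bounds along such lines yield a value at 0 and continuity there. On lines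
  through 0 the singularity is then removable in one variable.\<close>

lemma hol_removable_origin:
  fixes F0 :: "complex ^ 'n \<Rightarrow> complex"
  assumes card: "CARD('n) \<ge> 2" and S: "open S" "0 \<in> S" and F0: "hol_on F0 (S - {0})"
    and bd: "\<eta> > 0" "\<And>z. norm z < \<eta> \<Longrightarrow> z \<noteq> 0 \<Longrightarrow> cmod (F0 z) \<le> M"
  obtains F where "hol_on F S" "\<And>z. z \<noteq> 0 \<Longrightarrow> F z = F0 z"
proof -
  obtain i j :: 'n where ij: "i \<noteq> j"
    using card by (metis (full_types) One_nat_def card_le_Suc0_iff_eq finite not_less_eq_eq numeral_2_eq_2 UNIV_I)
  obtain \<eta>1 where \<eta>1: "\<eta>1 > 0" "ball 0 \<eta>1 \<subseteq> S" using S open_contains_ball by blast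
  define r where "r = min \<eta> \<eta>1 / 2"
  have r: "r > 0" using bd \<eta>1 by (simp add: r_def)
  have rS: "z \<in> S" "norm z < \<eta>" if "norm z < 2 * r" for z
    using that \<eta>1 by (auto simp: r_def subset_iff)
  have sl: "slice_hol F0 (S - {0})" using F0 by (rule hol_on_slice)
  define K where "K = 18 * (M + 1) / r"
  \<comment> \<open>A complex line through a nonzero point with vanishing j-th coordinate and a
    point with nonvanishing one cannot pass through 0. On it \<open>F0\<close> is holomorphic and
    bounded, so the one-variable Lipschitz estimate applies.\<close>
  have lip: "cmod (F0 w - F0 z) \<le> K * norm (w - z)"
    if z: "z $ j \<noteq> 0" "norm z < r" and w: "norm w < r" "w \<noteq> 0" "w $ j = 0" "norm (w - z) \<le> r / 2" for z w
  proof -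
    define d where "d = norm (w - z)"
    have d: "d > 0" using z w by (auto simp: d_def)
    define u where "u = complex_of_real (r / d) *s (w - z)"
    have nu: "norm u = r" using d r unfolding u_def norm_cscale norm_of_real by (simp add: d_def)
    have in1: "norm (z + \<mu> *s u) < 2 * r" if "cmod \<mu> < 1" for \<mu>
    proof -
      have "norm (z + \<mu> *s u) \<le> norm z + norm (\<mu> *s u)" by (rule norm_triangle_ineq)
      also have "norm (\<mu> *s u) \<le> 1 * norm u" unfolding norm_cscale using that by (intro mult_right_mono) auto
      finally show ?thesis using z nu by simp
    qed
    have ne: "z + \<mu> *s u \<noteq> 0" for \<mu>
    proof
      assume 0: "z + \<mu> *s u = 0"
      define c where "c = \<mu> * complex_of_real (r / d)"
      have e: "z + c *s (w - z) = 0"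
        using 0 by (simp only: c_def u_def cscale_simps(1))
      then have "(z + c *s (w - z)) $ j = 0" by simp
      then have "z $ j * (1 - c) = 0" using w by (simp add: algebra_simps)
      then have "c = 1" using z by simp
      then show False using e w by simp
    qed
    have "ball 0 1 \<subseteq> {\<mu>. z + \<mu> *s u \<in> S - {0}}" using in1 ne rS(1) by auto
    then have hol: "(\<lambda>\<mu>. F0 (z + \<mu> *s u)) holomorphic_on ball 0 1"
      by (rule holomorphic_on_subset[OF sl[unfolded slice_hol_def, rule_format]])
    have bdM: "cmod (F0 (z + \<mu> *s u)) < M + 1" if "cmod \<mu> < 1" for \<mu>
      using bd(2)[OF rS(2)[OF in1[OF that]] ne] by simp
    let ?\<mu> = "complex_of_real (d / r)"
    have "cmod (F0 (z + ?\<mu> *s u) - F0 (z + 0 *s u)) \<le> 18 * (M + 1) * cmod ?\<mu>"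
      using w r d by (intro Taylor_quadratic_bound(2)[OF hol bdM]) (auto simp: d_def norm_divide divide_le_eq)
    moreover have "?\<mu> *s u = w - z" using r d by (simp add: u_def cscale_simps(1)[symmetric])
    ultimately show ?thesis using r d by (simp add: K_def d_def norm_divide)
  qed
  \<comment> \<open>Points of the i-th axis, so that \<open>lip\<close> compares each of them with
    any z whose j-th coordinate is nonzero. A limit point of the values of \<open>F0\<close> along
    them is the value at 0.\<close>
  define q where "q = (\<lambda>n. axis i (complex_of_real (r / (4 * (real n + 1)))) :: complex ^ 'n)"
  have q: "norm (q n) = r / (4 * (real n + 1))" "q n $ j = 0" "q n \<noteq> 0" for n
  proof -
    show nq: "norm (q n) = r / (4 * (real n + 1))"
      unfolding q_def norm_axis_complex norm_of_real using r by simp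
    show "q n $ j = 0" using ij by (simp add: q_def axis_def)
    have "norm (q n) > 0" unfolding nq using r by simp
    then show "q n \<noteq> 0" by simp
  qed
  have qle: "norm (q n) \<le> r / 4" for n
    unfolding q using r by (intro divide_left_mono) auto
  have qlim: "q \<longlonglongrightarrow> 0"
  proof (rule tendsto_norm_zero_cancel)
    have "(\<lambda>n. r / (4 * (real n + 1))) \<longlonglongrightarrow> 0" by real_asymp
    then show "(\<lambda>n. norm (q n)) \<longlonglongrightarrow> 0" by (simp add: q)
  qed
  have "bounded (range (\<lambda>n. F0 (q n)))"
  proof (rule boundedI[of _ M])
    fix x assume "x \<in> range (\<lambda>n. F0 (q n))"
    then obtain n where "x = F0 (q n)" by blast
    moreover have "norm (q n) < 2 * r" using qle[of n] r by linarith
    ultimately show "norm x \<le> M" using bd(2)[of "q n"] rS(2)[of "q n"] q(3)[of n] by simp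
  qed
  then obtain l p where p: "strict_mono p" "((\<lambda>n. F0 (q n)) \<circ> p) \<longlonglongrightarrow> l"
    using bounded_imp_convergent_subsequence by blast
  have ql: "(\<lambda>n. q (p n)) \<longlonglongrightarrow> 0"
    using LIMSEQ_subseq_LIMSEQ[OF qlim p(1)] by (simp add: o_def)
  have near_ind: "cmod (l - F0 z) \<le> K * norm z" if z: "z $ j \<noteq> 0" "norm z < r / 4" for z
  proof (rule LIMSEQ_le)
    show "(\<lambda>n. cmod (F0 (q (p n)) - F0 z)) \<longlonglongrightarrow> cmod (l - F0 z)"
      using p(2) by (intro tendsto_intros) (simp add: o_def)
    have "(\<lambda>n. K * norm (q (p n) - z)) \<longlonglongrightarrow> K * norm (0 - z)"
      by (intro tendsto_intros ql)
    then show "(\<lambda>n. K * norm (q (p n) - z)) \<longlonglongrightarrow> K * norm z" by simp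
    have "cmod (F0 (q (p n)) - F0 z) \<le> K * norm (q (p n) - z)" for n
    proof (rule lip)
      show "norm (q (p n) - z) \<le> r / 2"
        using norm_triangle_ineq4[of "q (p n)" z] qle[of "p n"] z by linarith
      show "norm z < r" "norm (q (p n)) < r" using z r qle[of "p n"] by auto
    qed (use z q in auto)
    then show "\<exists>N. \<forall>n\<ge>N. cmod (F0 (q (p n)) - F0 z) \<le> K * norm (q (p n) - z)" by blast
  qed
  have near: "cmod (l - F0 z) \<le> K * norm z" if z: "z \<noteq> 0" "norm z < r / 4" for z
  proof (cases "z $ j = 0")
    case True
    \<comment> \<open>Points with \<open>z $ j = 0\<close> are approached by perturbing the j-th
      coordinate, using continuity of \<open>F0\<close> at z.\<close>
    define y where "y = (\<lambda>n::nat. z + axis j (complex_of_real (1 / (real n + 1))))"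
    have ylim: "y \<longlonglongrightarrow> z"
    proof -
      have "(\<lambda>n. norm (y n - z)) \<longlonglongrightarrow> 0"
      proof -
        have "norm (y n - z) = 1 / (real n + 1)" for n
          unfolding y_def add_diff_cancel_left' norm_axis_complex norm_of_real by simp
        moreover have "(\<lambda>n. 1 / (real n + 1)) \<longlonglongrightarrow> 0" by real_asymp
        ultimately show ?thesis by simp
      qed
      then show ?thesis by (rule LIM_zero_cancel[OF tendsto_norm_zero_cancel])
    qed
    have "z \<in> S" using rS(1)[of z] z r by simp
    then have "isCont F0 z"
      using F0 z(1) unfolding hol_on_def by (meson Diff_iff has_derivative_continuous singletonD)
    then have c: "(\<lambda>n. F0 (y n)) \<longlonglongrightarrow> F0 z" using ylim by (simp add: continuous_at_sequentially o_def)
    show ?thesis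
    proof (rule LIMSEQ_le)
      show "(\<lambda>n. cmod (l - F0 (y n))) \<longlonglongrightarrow> cmod (l - F0 z)" by (intro tendsto_intros c)
      show "(\<lambda>n. K * norm (y n)) \<longlonglongrightarrow> K * norm z" by (intro tendsto_intros ylim)
      have "\<forall>\<^sub>F n in sequentially. norm (y n) < r / 4"
        using tendsto_norm[OF ylim] z(2) by (rule order_tendstoD(2))
      then obtain N where "\<And>n. n \<ge> N \<Longrightarrow> norm (y n) < r / 4" unfolding eventually_sequentially by blast
      moreover have "y n $ j \<noteq> 0" for n
      proof -
        have "y n $ j = complex_of_real (1 / (real n + 1))" using True by (simp add: y_def axis_def)
        then show ?thesis by (simp only: of_real_eq_0_iff) simp
      qed
      ultimately show "\<exists>N. \<forall>n\<ge>N. cmod (l - F0 (y n)) \<le> K * norm (y n)" using near_ind by blast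
    qed
  qed (use near_ind z in auto)
  define F where "F = (\<lambda>z. if z = 0 then l else F0 z)"
  have F: "F z = F0 z" if "z \<noteq> 0" for z using that by (simp add: F_def)
  have op: "open (S - {0})" using S by (simp add: open_delete)
  have holF: "hol_on F (S - {0})" by (rule hol_on_cong[OF op _ F0]) (simp add: F)
  have "K \<ge> 0" 
  proof -
    have "norm (q 0) < 2 * r" using qle[of 0] r by linarith
    then have "0 \<le> M" using bd(2)[of "q 0"] rS(2)[of "q 0"] q(3)[of 0] by (meson norm_ge_zero order_trans)
    then show ?thesis using r by (simp add: K_def)
  qed
  have cont0: "isCont F 0"
    unfolding continuous_at_eps_delta
  proof (intro allI impI)
    fix e :: real assume e: "e > 0"
    define d where "d = min (r / 4) (e / (K + 1))"
    have "dist (F z) (F 0) < e" if "dist z 0 < d" for z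
    proof (cases "z = 0")
      case False
      have "dist (F z) (F 0) = cmod (l - F0 z)" using False by (simp add: F_def dist_norm norm_minus_commute)
      also have "\<dots> \<le> K * norm z" using near[OF False] that by (simp add: d_def)
      also have "\<dots> \<le> K * (e / (K + 1))" using that \<open>K \<ge> 0\<close> by (intro mult_left_mono) (auto simp: d_def)
      also have "\<dots> < e" using e \<open>K \<ge> 0\<close> by (simp add: field_simps)
      finally show ?thesis .
    qed (use e in auto)
    moreover have "d > 0" using r e \<open>K \<ge> 0\<close> by (simp add: d_def)
    ultimately show "\<exists>d>0. \<forall>z. dist z 0 < d \<longrightarrow> dist (F z) (F 0) < e" by blast
  qed
  have cont: "continuous_on S F"
  proof (rule continuous_at_imp_continuous_on, rule)
    fix z assume "z \<in> S"
    show "isCont F z"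
      using cont0 hol_on_continuous[OF holF] op \<open>z \<in> S\<close>
      by (cases "z = 0") (auto simp: continuous_on_eq_continuous_at)
  qed
  have "slice_hol F S"
    unfolding slice_hol_def
  proof (intro allI)
    fix a v
    let ?T = "{\<mu>. a + \<mu> *s v \<in> S}"
    show "(\<lambda>\<mu>. F (a + \<mu> *s v)) holomorphic_on ?T"
    proof (cases "v = 0")
      case False
      obtain k where k: "v $ k \<noteq> 0" using False by (auto simp: vec_eq_iff)
      have fin: "finite {\<mu>. a + \<mu> *s v = 0}"
      proof (rule finite_subset)
        show "{\<mu>. a + \<mu> *s v = 0} \<subseteq> {- a $ k / v $ k}"
        proof
          fix \<mu> assume "\<mu> \<in> {\<mu>. a + \<mu> *s v = 0}"
          then have "(a + \<mu> *s v) $ k = 0" by simp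
          then have "a $ k + \<mu> * v $ k = 0" by simp
          then show "\<mu> \<in> {- a $ k / v $ k}" using k by (simp add: field_simps eq_neg_iff_add_eq_0 add.commute)
        qed
      qed simp
      show ?thesis
      proof (rule no_isolated_singularity[OF _ _ open_slice[OF S(1)] fin])
        show "continuous_on ?T (\<lambda>\<mu>. F (a + \<mu> *s v))"
          by (rule continuous_on_compose2[OF cont]) (auto intro!: continuous_intros)
        show "(\<lambda>\<mu>. F (a + \<mu> *s v)) holomorphic_on ?T - {\<mu>. a + \<mu> *s v = 0}"
          by (rule holomorphic_on_subset[OF hol_on_slice[OF holF, unfolded slice_hol_def, rule_format]]) auto
      qed
    qed simp
  qed
  then have "hol_on F S" using cont S by (simp add: hol_on_iff)
  then show thesis using that F by blast
qed

lemma contour_integral_circlepath0: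
  "contour_integral (circlepath 0 s) g =
     2 * of_real pi * \<i> * integral {0..1} (\<lambda>t. g (circlepath 0 s t) * circlepath 0 s t)"
proof -
  have "contour_integral (circlepath 0 s) g =
    integral {0..1} (\<lambda>t. 2 * of_real pi * \<i> * (g (circlepath 0 s t) * circlepath 0 s t))"
    unfolding contour_integral_integral vector_derivative_circlepath
    by (intro integral_cong) (simp add: circlepath ac_simps)
  then show ?thesis by (simp only: integral_mult_right)
qed

section \<open>Geometry of a shell along rays and complex lines through the origin\<close>

locale shell =
  fixes \<Omega> L :: "(complex ^ 'n) set"
  assumes card: "CARD('n) \<ge> 2"
    and open_\<Omega>: "open \<Omega>" and bounded_\<Omega>: "bounded \<Omega>" and circ_\<Omega>: "complete_circular \<Omega>"
    and compact_L: "compact L" and circ_L: "complete_circular L" and L_sub: "L \<subseteq> \<Omega>" and zero_L: "0 \<in> L"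
begin

abbreviation A :: "(complex ^ 'n) set" where "A \<equiv> \<Omega> - L"

lemma open_A: "open A"
  using open_\<Omega> compact_L by (simp add: compact_imp_closed open_Diff)

lemma zero_\<Omega>: "0 \<in> \<Omega>" using zero_L L_sub by blast

lemma rot_\<Omega>: "cmod c = 1 \<Longrightarrow> c *s z \<in> \<Omega> \<longleftrightarrow> z \<in> \<Omega>"
  using complete_circular_mono[OF circ_\<Omega>, of c 1 z] complete_circular_mono[OF circ_\<Omega>, of 1 c z] by auto

lemma rot_L: "cmod c = 1 \<Longrightarrow> c *s z \<in> L \<longleftrightarrow> z \<in> L"
  using complete_circular_mono[OF circ_L, of c 1 z] complete_circular_mono[OF circ_L, of 1 c z] by auto

lemma rot_A: "cmod c = 1 \<Longrightarrow> c *s z \<in> A \<longleftrightarrow> z \<in> A"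
  by (simp add: rot_\<Omega> rot_L)

lemma circle_A:
  assumes "s > 0" "cmod \<xi> = s"
  shows "\<xi> *s z \<in> A \<longleftrightarrow> s *\<^sub>R z \<in> A"
proof -
  have "\<xi> *s z = (\<xi> / of_real s) *s (s *\<^sub>R z)"
    using assms by (simp add: scaleR_eq_cscale cscale_simps(1)[symmetric])
  then show ?thesis using rot_A[of "\<xi> / of_real s" "s *\<^sub>R z"] assms by (simp add: norm_divide)
qed

lemma between_A:
  assumes "s *\<^sub>R z \<in> A" "s' *\<^sub>R z \<in> A" "0 < s" "s \<le> cmod \<xi>" "cmod \<xi> \<le> s'"
  shows "\<xi> *s z \<in> A"
proof -
  have "\<xi> *s z \<in> \<Omega>"
    using complete_circular_mono[OF circ_\<Omega>, of \<xi> "of_real s'" z] assms by (simp add: scaleR_eq_cscale)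
  moreover have "\<xi> *s z \<notin> L"
    using complete_circular_mono[OF circ_L, of "of_real s" \<xi> z] assms by (auto simp: scaleR_eq_cscale)
  ultimately show ?thesis by simp
qed

text \<open>\<open>L\<close> is compact, so a ray has a last parameter in it. Just beyond, the ray
  is still in the open set \<open>\<Omega>\<close> but has left \<open>L\<close>; shell points on
  rays are chosen in this way.\<close>

lemma ray_exit:
  assumes "z \<noteq> 0"
  obtains s where "s \<ge> 0" "s *\<^sub>R z \<in> L" "\<And>s'. s' > s \<Longrightarrow> s' *\<^sub>R z \<notin> L"
proof -
  define T where "T = {0..} \<inter> (\<lambda>s. s *\<^sub>R z) -` L"
  have "closed T"
    unfolding T_def using compact_L
    by (intro closed_Int closed_vimage) (auto simp: compact_imp_closed intro!: continuous_intros)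
  moreover have "bounded T"
  proof -
    obtain R where R: "\<And>w. w \<in> L \<Longrightarrow> norm w \<le> R" using compact_L compact_imp_bounded bounded_iff by metis
    have "norm s \<le> R / norm z" if "s \<in> T" for s
      using R[of "s *\<^sub>R z"] that assms by (simp add: T_def field_simps)
    then show ?thesis by (rule boundedI)
  qed
  ultimately have "compact T" by (simp add: compact_eq_bounded_closed)
  moreover have "0 \<in> T" using zero_L by (simp add: T_def)
  ultimately obtain s where s: "s \<in> T" "\<And>t. t \<in> T \<Longrightarrow> t \<le> s"
    using compact_attains_sup[of T] by blast
  have "s' *\<^sub>R z \<notin> L" if "s' > s" for s'
    using s(1) s(2)[of s'] that by (auto simp: T_def)
  then show thesis using that s by (auto simp: T_def)
qed

lemma ray_open:
  assumes "s0 *\<^sub>R y \<in> \<Omega>"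
  obtains e where "e > 0" "\<And>s. \<bar>s - s0\<bar> < e \<Longrightarrow> s *\<^sub>R y \<in> \<Omega>"
proof -
  have "open ((\<lambda>s. s *\<^sub>R y) -` \<Omega>)"
    using open_\<Omega> by (intro open_vimage continuous_intros)
  moreover have "s0 \<in> (\<lambda>s. s *\<^sub>R y) -` \<Omega>" using assms by simp
  ultimately obtain e where "e > 0" "ball s0 e \<subseteq> (\<lambda>s. s *\<^sub>R y) -` \<Omega>" by (metis open_contains_ball)
  then show thesis by (intro that[of e]) (auto simp: subset_iff dist_real_def abs_minus_commute)
qed

lemma ray_into_A_out:
  assumes "z \<in> \<Omega>" "z \<noteq> 0" obtains s where "s > 1" "s *\<^sub>R z \<in> A"
proof -
  obtain s1 where s1: "s1 \<ge> 0" "s1 *\<^sub>R z \<in> L" "\<And>s'. s' > s1 \<Longrightarrow> s' *\<^sub>R z \<notin> L"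
    using ray_exit[OF assms(2)] by blast
  have "max 1 s1 *\<^sub>R z \<in> \<Omega>" using s1 assms L_sub by (auto simp: max_def)
  then obtain e where e: "e > 0" "\<And>s. \<bar>s - max 1 s1\<bar> < e \<Longrightarrow> s *\<^sub>R z \<in> \<Omega>" using ray_open by blast
  show thesis
    using e s1(3)[of "max 1 s1 + e / 2"] by (intro that[of "max 1 s1 + e / 2"]) auto
qed

lemma ray_into_A_in:
  assumes "z \<notin> L" obtains s where "0 < s" "s < 1" "s *\<^sub>R z \<in> A"
proof -
  have "z \<noteq> 0" using assms zero_L by auto
  then obtain s1 where s1: "s1 \<ge> 0" "s1 *\<^sub>R z \<in> L" "\<And>s'. s' > s1 \<Longrightarrow> s' *\<^sub>R z \<notin> L"
    using ray_exit by blast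
  have "s1 < 1"
  proof (rule ccontr)
    assume "\<not> s1 < 1"
    then have "1 *s z \<in> L"
      using complete_circular_mono[OF circ_L, of 1 "of_real s1" z] s1(2) by (simp add: scaleR_eq_cscale)
    then show False using assms by simp
  qed
  obtain e where e: "e > 0" "\<And>s. \<bar>s - s1\<bar> < e \<Longrightarrow> s *\<^sub>R z \<in> \<Omega>"
    using ray_open s1(2) L_sub by blast
  define s where "s = min (s1 + e / 2) ((s1 + 1) / 2)"
  have "s > s1" "s < 1" "\<bar>s - s1\<bar> < e" using e(1) \<open>s1 < 1\<close> unfolding s_def by (auto simp: min_def field_simps)
  then show thesis using e(2)[of s] s1 by (intro that[of s]) auto
qed

lemma ray_into_A:
  assumes "z \<noteq> 0" obtains s where "0 < s" "s *\<^sub>R z \<in> A"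
proof -
  obtain s1 where s1: "s1 \<ge> 0" "s1 *\<^sub>R z \<in> L" "\<And>s'. s' > s1 \<Longrightarrow> s' *\<^sub>R z \<notin> L"
    using ray_exit[OF assms] by blast
  then have "(s1 + 1) *\<^sub>R z \<notin> L" by auto
  then obtain s where "0 < s" "s *\<^sub>R ((s1 + 1) *\<^sub>R z) \<in> A" by (rule ray_into_A_in)
  then show thesis using s1 by (intro that[of "s * (s1 + 1)"]) auto
qed

text \<open>The points at distance at least \<delta> from the complement of the shell: a compact
  set, invariant under rotations, staying at distance \<delta> from 0. Continuous functions on the
  shell are bounded there, and the balls of radius \<delta> serve for mean value estimates.\<close>

definition core :: "real \<Rightarrow> (complex ^ 'n) set" where
  "core \<delta> = {w. ball w \<delta> \<subseteq> A}"

lemma core_iff: "w \<in> core \<delta> \<longleftrightarrow> (\<forall>y. y \<notin> A \<longrightarrow> \<delta> \<le> dist w y)"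
  unfolding core_def mem_Collect_eq subset_iff mem_ball by (metis not_less)

lemma core_sub: "\<delta> > 0 \<Longrightarrow> core \<delta> \<subseteq> A"
  by (auto simp: core_def subset_iff)

lemma compact_core:
  assumes "\<delta> > 0" shows "compact (core \<delta>)"
proof -
  have "core \<delta> = (\<Inter>y\<in>-A. {w. \<delta> \<le> dist w y})"
    unfolding set_eq_iff core_iff by blast
  then have "closed (core \<delta>)" by (auto intro!: closed_INT closed_Collect_le continuous_intros)
  moreover have "bounded (core \<delta>)"
    using core_sub[OF assms] bounded_\<Omega> by (meson Diff_subset bounded_subset order_trans)
  ultimately show ?thesis by (simp add: compact_eq_bounded_closed)
qed

lemma rot_core:
  assumes "cmod c = 1" "w \<in> core \<delta>" shows "c *s w \<in> core \<delta>"
  unfolding core_iff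
proof (intro allI impI)
  fix y assume y: "y \<notin> A"
  have c: "c \<noteq> 0" using assms by auto
  have yc: "y = c *s (inverse c *s y)" using c by (simp add: cscale_simps(1)[symmetric])
  have "inverse c *s y \<notin> A" using y rot_A[of "inverse c" y] assms by (simp add: norm_inverse)
  then have "\<delta> \<le> dist w (inverse c *s y)" using assms by (simp add: core_iff)
  also have "dist w (inverse c *s y) = norm (c *s (w - inverse c *s y))"
    using assms by (simp only: norm_cscale dist_norm mult_1)
  also have "c *s (w - inverse c *s y) = c *s w - y"
    using c by (simp add: vec_eq_iff right_diff_distrib)
  finally show "\<delta> \<le> dist (c *s w) y" by (simp add: dist_norm)
qed

lemma circle_core:
  assumes "s > 0" "cmod \<xi> = s" "s *\<^sub>R z \<in> core \<delta>"
  shows "\<xi> *s z \<in> core \<delta>"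
proof -
  have "\<xi> *s z = (\<xi> / of_real s) *s (s *\<^sub>R z)"
    using assms by (simp add: scaleR_eq_cscale cscale_simps(1)[symmetric])
  then show ?thesis using rot_core[of "\<xi> / of_real s" "s *\<^sub>R z"] assms by (simp add: norm_divide)
qed

lemma core_norm: "w \<in> core \<delta> \<Longrightarrow> \<delta> \<le> norm w"
  using zero_L by (auto simp: core_iff dest: spec[of _ 0])

lemma core_ball:
  assumes "ball a (2 * \<delta>) \<subseteq> A" "dist a w < \<delta>" shows "w \<in> core \<delta>"
proof -
  have "y \<in> ball a (2 * \<delta>)" if "dist w y < \<delta>" for y
    using dist_triangle[of a y w] that assms(2) by simp
  then have "ball w \<delta> \<subseteq> ball a (2 * \<delta>)" by auto
  then show ?thesis using assms(1) by (simp add: core_def)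
qed

text \<open>Compactness of the unit sphere of directions gives a single \<delta> for all
  rays.\<close>

lemma rays_hit_core:
  obtains \<delta> where "\<delta> > 0" "\<And>z. z \<noteq> 0 \<Longrightarrow> \<exists>r>0. r *\<^sub>R z \<in> core \<delta>"
proof -
  \<comment> \<open>The slack \<eta> > \<delta> makes \<open>W \<delta>\<close> open, as the
    covering argument requires.\<close>
  define W where "W = (\<lambda>\<delta>. {v. \<exists>r>0. \<exists>\<eta>>\<delta>. ball (r *\<^sub>R v) \<eta> \<subseteq> A})"
  have W_open: "open (W \<delta>)" for \<delta>
    unfolding open_dist
  proof
    fix v assume "v \<in> W \<delta>"
    then obtain r \<eta> where r: "r > 0" "\<eta> > \<delta>" "ball (r *\<^sub>R v) \<eta> \<subseteq> A" by (auto simp: W_def)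
    have "v' \<in> W \<delta>" if "dist v' v < (\<eta> - \<delta>) / (2 * r)" for v'
    proof -
      have "ball (r *\<^sub>R v') ((\<eta> + \<delta>) / 2) \<subseteq> ball (r *\<^sub>R v) \<eta>"
      proof
        fix y assume "y \<in> ball (r *\<^sub>R v') ((\<eta> + \<delta>) / 2)"
        moreover have "dist (r *\<^sub>R v) (r *\<^sub>R v') < (\<eta> - \<delta>) / 2"
          using that r unfolding dist_scaleR_same[OF r(1)] by (simp add: dist_commute field_simps)
        ultimately show "y \<in> ball (r *\<^sub>R v) \<eta>"
          using dist_triangle[of "r *\<^sub>R v" y "r *\<^sub>R v'"] by (simp add: field_simps)
      qed
      then show ?thesis
        unfolding W_def mem_Collect_eq using r
        by (intro exI[of _ r] conjI exI[of _ "(\<eta> + \<delta>) / 2"]) auto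
    qed
    then show "\<exists>e>0. \<forall>y. dist y v < e \<longrightarrow> y \<in> W \<delta>"
      using r by (intro exI[of _ "(\<eta> - \<delta>) / (2 * r)"]) auto
  qed
  have cover: "sphere 0 1 \<subseteq> (\<Union>k::nat. W (1 / real (Suc k)))"
  proof
    fix v :: "complex ^ 'n" assume "v \<in> sphere 0 1"
    then have "v \<noteq> 0" by auto
    then obtain r where r: "r > 0" "r *\<^sub>R v \<in> A" by (rule ray_into_A)
    then obtain \<eta> where "\<eta> > 0" "ball (r *\<^sub>R v) \<eta> \<subseteq> A" using open_A open_contains_ball by blast
    moreover then obtain k where "1 / real (Suc k) < \<eta>" using nat_approx_posE by blast
    ultimately show "v \<in> (\<Union>k::nat. W (1 / real (Suc k)))" using r by (auto simp: W_def)
  qed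
  obtain I :: "nat set" where I: "finite I" "sphere 0 1 \<subseteq> (\<Union>k\<in>I. W (1 / real (Suc k)))"
    by (rule compactE_image[OF compact_sphere W_open cover])
  define \<delta> where "\<delta> = 1 / real (Suc (Max (insert 0 I)))"
  have "\<exists>r>0. r *\<^sub>R z \<in> core \<delta>" if z: "z \<noteq> 0" for z
  proof -
    have "(1 / norm z) *\<^sub>R z \<in> sphere 0 1" using z by simp
    then obtain k where k: "k \<in> I" "(1 / norm z) *\<^sub>R z \<in> W (1 / real (Suc k))" using I by blast
    then obtain r \<eta> where r: "r > 0" "\<eta> > 1 / real (Suc k)" "ball (r *\<^sub>R (1 / norm z) *\<^sub>R z) \<eta> \<subseteq> A"
      by (auto simp: W_def)
    have "k \<le> Max (insert 0 I)" using k I by simp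
    then have "\<delta> \<le> 1 / real (Suc k)" unfolding \<delta>_def by (intro divide_left_mono) auto
    then have "(r / norm z) *\<^sub>R z \<in> core \<delta>" using r by (auto simp: core_def subset_iff)
    then show ?thesis using r z by (intro exI[of _ "r / norm z"]) auto
  qed
  then show thesis using that[of \<delta>] by (simp add: \<delta>_def)
qed

text \<open>Near an arbitrary point of \<open>\<Omega>\<close>, holomorphic functions are controlled by the maximum principle
  on complex lines through the origin from their values on a compact part of the shell.\<close>

lemma local_core:
  assumes "z0 \<in> \<Omega>"
  obtains e \<delta> where "e > 0" "\<delta> > 0" "ball z0 e \<subseteq> \<Omega>"
    "\<And>z. z \<in> ball z0 e \<Longrightarrow> z \<noteq> 0 \<Longrightarrow> \<exists>r\<ge>1. r *\<^sub>R z \<in> core \<delta>"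
proof -
  obtain e1 where e1: "e1 > 0" "ball z0 e1 \<subseteq> \<Omega>" using assms open_\<Omega> open_contains_ball by blast
  show thesis
  proof (cases "z0 = 0")
    case True
    obtain \<delta> where \<delta>: "\<delta> > 0" "\<And>z. z \<noteq> 0 \<Longrightarrow> \<exists>r>0. r *\<^sub>R z \<in> core \<delta>" using rays_hit_core by blast
    \<comment> \<open>Near 0 the scale factor exceeds 1 by itself: core points have norm at least
      \<delta>, while z has norm below \<delta>.\<close>
    have "\<exists>r\<ge>1. r *\<^sub>R z \<in> core \<delta>" if "z \<in> ball z0 (min e1 \<delta>)" "z \<noteq> 0" for z
    proof -
      from \<delta>(2)[OF that(2)] obtain r where r: "r > 0" "r *\<^sub>R z \<in> core \<delta>" by blast
      have "\<delta> \<le> r * norm z" using core_norm[OF r(2)] r by simp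
      moreover have "norm z < \<delta>" using that True by simp
      ultimately have "r * \<delta> > 1 * \<delta>" using mult_strict_left_mono[of "norm z" \<delta> r] r(1) by linarith
      then show ?thesis using r \<delta>(1) by (intro exI[of _ r]) (auto simp: mult_less_cancel_right)
    qed
    then show thesis using e1 \<delta> by (intro that[of "min e1 \<delta>" \<delta>]) auto
  next
    case False
    obtain s where s: "s > 1" "s *\<^sub>R z0 \<in> A" using ray_into_A_out[OF assms False] by blast
    then obtain \<eta> where \<eta>: "\<eta> > 0" "ball (s *\<^sub>R z0) \<eta> \<subseteq> A" using open_A open_contains_ball by blast
    have "s *\<^sub>R z \<in> core (\<eta> / 2)" if "z \<in> ball z0 (min e1 (\<eta> / (2 * s)))" for z
    proof (rule core_ball)
      show "dist (s *\<^sub>R z0) (s *\<^sub>R z) < \<eta> / 2"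
        using that s by (simp add: dist_scaleR_same field_simps)
    qed (use \<eta> in auto)
    then show thesis using e1 s \<eta> by (intro that[of "min e1 (\<eta> / (2 * s))" "\<eta> / 2"]) (auto intro!: exI[of _ s])
  qed
qed

lemma max_principle_ray:
  assumes h: "hol_on h \<Omega>" and r: "r \<ge> 1" "r *\<^sub>R z \<in> \<Omega>"
    and B: "\<And>\<xi>. cmod \<xi> = r \<Longrightarrow> cmod (h (\<xi> *s z)) \<le> B" and \<mu>: "cmod \<mu> \<le> r"
  shows "cmod (h (\<mu> *s z)) \<le> B"
proof (rule max_modulus_disc[OF hol_on_line[OF h] open_line[OF open_\<Omega>] _ B \<mu>])
  show "cball 0 r \<subseteq> {\<mu>. \<mu> *s z \<in> \<Omega>}"
  proof
    fix \<mu> :: complex assume "\<mu> \<in> cball 0 r"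
    then show "\<mu> \<in> {\<mu>. \<mu> *s z \<in> \<Omega>}"
      using complete_circular_mono[OF circ_\<Omega>, of \<mu> "of_real r" z] r by (simp add: scaleR_eq_cscale)
  qed
qed

lemma ex_nonzero:
  assumes "open V" "0 \<in> V" obtains z :: "complex ^ 'n" where "z \<in> V" "z \<noteq> 0"
proof -
  have "\<not> open {0 :: complex ^ 'n}"
    using not_open_singleton by blast
  then have "V \<noteq> {0}" using assms by auto
  then have "\<exists>z\<in>V. z \<noteq> 0" using assms by auto
  then show thesis using that by blast
qed

text \<open>The identity theorem by the maximum principle: on the line through 0 and w, some circle
  of parameter radius above 1 lies in the shell, where g vanishes.\<close>

lemma hol_unique:
  assumes g: "hol_on g \<Omega>" and 0: "\<And>z. z \<in> A \<Longrightarrow> g z = 0" and z: "z \<in> \<Omega>"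
  shows "g z = 0"
proof -
  have line: "g (\<mu> *s w) = 0" if w: "w \<in> \<Omega>" "w \<noteq> 0" and \<mu>: "cmod \<mu> \<le> 1" for w \<mu>
  proof -
    obtain s where s: "s > 1" "s *\<^sub>R w \<in> A" using ray_into_A_out[OF w] by blast
    have "cmod (g (\<mu> *s w)) \<le> 0"
    proof (rule max_principle_ray[OF g, of s])
      show "cmod (g (\<xi> *s w)) \<le> 0" if "cmod \<xi> = s" for \<xi>
        using circle_A[of s \<xi> w] s that 0 by simp
    qed (use s \<mu> in auto)
    then show ?thesis by simp
  qed
  show ?thesis
  proof (cases "z = 0")
    case True
    obtain w where "w \<in> \<Omega>" "w \<noteq> 0" using ex_nonzero[OF open_\<Omega> zero_\<Omega>] .
    then show ?thesis using line[of w 0] True by simp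
  next
    case False
    then show ?thesis using line[of z 1] z by simp
  qed
qed

text \<open>The Cauchy integral, over the circle of radius s in the line through 0 and z, of the
  function w -> f (w z), evaluated at w = 1, that is, at the point z (see
  \<open>cauchy_ray_eq_contour\<close>). Written over a fixed real interval it can be differentiated
  in z. Whether s is above or below 1 decides whether the pole is inside.\<close>

definition cauchy_ray :: "(complex ^ 'n \<Rightarrow> complex) \<Rightarrow> real \<Rightarrow> complex ^ 'n \<Rightarrow> complex" where
  "cauchy_ray f s z = integral {0..1}
     (\<lambda>t. f (circlepath 0 s t *s z) * (circlepath 0 s t / (circlepath 0 s t - 1)))"

lemma cmod_circlepath0: "s \<ge> 0 \<Longrightarrow> cmod (circlepath 0 s t) = s"
  by (simp add: circlepath norm_mult)

lemma continuous_circlepath0: "continuous_on X (circlepath 0 s)"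
  unfolding circlepath by (intro continuous_intros)

lemma circlepath0_ne_1: "s \<ge> 0 \<Longrightarrow> s \<noteq> 1 \<Longrightarrow> circlepath 0 s t \<noteq> 1"
  using cmod_circlepath0[of s t] by auto

lemma cauchy_ray_eq_contour:
  "2 * of_real pi * \<i> * cauchy_ray f s z = contour_integral (circlepath 0 s) (\<lambda>w. f (w *s z) / (w - 1))"
  unfolding contour_integral_circlepath0 cauchy_ray_def by simp

lemma scaleR_open: "open {z. s *\<^sub>R z \<in> A}"
proof -
  have "open ((\<lambda>z. s *\<^sub>R z) -` A)" by (intro open_vimage open_A continuous_intros)
  then show ?thesis by (simp add: vimage_def)
qed

lemma cauchy_ray_continuous:
  assumes f: "continuous_on A f" and s: "s > 0" "s \<noteq> 1"
    and g: "continuous_on X g" "\<And>x. x \<in> X \<Longrightarrow> s *\<^sub>R g x \<in> A"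
  shows "continuous_on (X \<times> {0..1}) (\<lambda>(x, t). f (circlepath 0 s t *s g x) * (circlepath 0 s t / (circlepath 0 s t - 1)))"
  unfolding case_prod_unfold
proof (intro continuous_intros)
  have c: "continuous_on (X \<times> {0..1}) (\<lambda>p. circlepath 0 s (snd p))"
    by (rule continuous_on_compose2[OF continuous_circlepath0[of UNIV]]) (auto intro: continuous_intros)
  then show "continuous_on (X \<times> {0..1}) (\<lambda>p. circlepath 0 s (snd p))" .
  show "continuous_on (X \<times> {0..1}) (\<lambda>p. circlepath 0 s (snd p))" by fact
  have "continuous_on (X \<times> {0..1}) (\<lambda>p. g (fst p))"
    by (rule continuous_on_compose2[OF g(1)]) (auto intro: continuous_intros)
  then show "continuous_on (X \<times> {0..1}) (\<lambda>p. f (circlepath 0 s (snd p) *s g (fst p)))"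
  proof (intro continuous_on_compose2[OF f] continuous_on_cscale c)
    have "circlepath 0 s t *s g x \<in> A" if "x \<in> X" for x t
      using circle_A[of s "circlepath 0 s t" "g x"] s g(2)[OF that] cmod_circlepath0[of s t] by simp
    then show "(\<lambda>p. circlepath 0 s (snd p) *s g (fst p)) ` (X \<times> {0..1}) \<subseteq> A" by auto
  qed
  show "\<forall>p\<in>X \<times> {0..1}. circlepath 0 s (snd p) - 1 \<noteq> 0"
    using s circlepath0_ne_1[of s] by auto
qed

lemma cauchy_ray_bound:
  assumes f: "continuous_on A f" and s: "s > 0" "s \<noteq> 1" "s *\<^sub>R z \<in> A"
    and M: "\<And>\<xi>. cmod \<xi> = s \<Longrightarrow> cmod (f (\<xi> *s z)) \<le> M"
  shows "cmod (cauchy_ray f s z) \<le> M * s / \<bar>s - 1\<bar>"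
proof -
  have "continuous_on ({z} \<times> {0..1}) (\<lambda>(x, t). f (circlepath 0 s t *s x) * (circlepath 0 s t / (circlepath 0 s t - 1)))"
    using s by (intro cauchy_ray_continuous[OF f]) auto
  moreover have "continuous_on {0..1} (\<lambda>t::real. (z, t))" by (intro continuous_intros)
  ultimately have "continuous_on {0..1} (\<lambda>t. case (z, t) of (x, t) \<Rightarrow>
      f (circlepath 0 s t *s x) * (circlepath 0 s t / (circlepath 0 s t - 1)))"
    by (rule continuous_on_compose2) auto
  then have c: "continuous_on {0..1} (\<lambda>t. f (circlepath 0 s t *s z) * (circlepath 0 s t / (circlepath 0 s t - 1)))"
    by simp
  have "cmod (cauchy_ray f s z) \<le> (M * (s / \<bar>s - 1\<bar>)) * (1 - 0)"
    unfolding cauchy_ray_def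
  proof (rule integral_bound[OF _ c])
    fix t :: real
    let ?p = "circlepath 0 s t"
    have p: "cmod ?p = s" using s by (simp add: cmod_circlepath0)
    have "\<bar>s - 1\<bar> \<le> cmod (?p - 1)" using norm_triangle_ineq3[of ?p 1] p by simp
    moreover have "0 < \<bar>s - 1\<bar>" using s by simp
    ultimately have "s / cmod (?p - 1) \<le> s / \<bar>s - 1\<bar>"
      using s by (intro divide_left_mono mult_pos_pos) linarith+
    then have "cmod (f (?p *s z)) * (s / cmod (?p - 1)) \<le> M * (s / \<bar>s - 1\<bar>)"
      using M[OF p] s by (intro mult_mono) (auto intro: order_trans[OF norm_ge_zero])
    then show "cmod (f (?p *s z) * (?p / (?p - 1))) \<le> M * (s / \<bar>s - 1\<bar>)"
      by (simp add: norm_mult norm_divide p)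
  qed auto
  then show ?thesis by simp
qed

text \<open>For fixed s the contour does not move with z, so slices are parameter integrals. The
  values of f involved come from a compact part of the shell, which gives the local bound.\<close>

lemma cauchy_ray_hol:
  assumes f: "hol_on f A" and s: "s > 0" "s \<noteq> 1"
  shows "hol_on (cauchy_ray f s) {z. s *\<^sub>R z \<in> A}"
proof (rule hol_onI[OF scaleR_open])
  note cf = hol_on_continuous[OF f]
  show "slice_hol (cauchy_ray f s) {z. s *\<^sub>R z \<in> A}"
  proof (rule slice_holI[OF scaleR_open])
    fix a v assume a: "a \<in> {z. s *\<^sub>R z \<in> A}"
    then have "open {\<mu>. a + \<mu> *s v \<in> {z. s *\<^sub>R z \<in> A}}" "0 \<in> {\<mu>. a + \<mu> *s v \<in> {z. s *\<^sub>R z \<in> A}}"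
      using open_slice[OF scaleR_open] by auto
    then obtain e where e: "e > 0" "ball 0 e \<subseteq> {\<mu>. a + \<mu> *s v \<in> {z. s *\<^sub>R z \<in> A}}"
      using open_contains_ball by blast
    have "(\<lambda>\<mu>. cauchy_ray f s (a + \<mu> *s v)) holomorphic_on ball 0 e"
      unfolding cauchy_ray_def
    proof (rule holomorphic_param_integral)
      show "continuous_on (ball 0 e \<times> {0..1})
        (\<lambda>(\<mu>, t). f (circlepath 0 s t *s (a + \<mu> *s v)) * (circlepath 0 s t / (circlepath 0 s t - 1)))"
        using e s by (intro cauchy_ray_continuous[OF cf]) (auto intro!: continuous_intros)
      fix t :: real
      let ?p = "circlepath 0 s t"
      have "(\<lambda>\<mu>. f (?p *s a + \<mu> *s (?p *s v))) holomorphic_on ball 0 e"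
      proof (rule holomorphic_on_subset[OF hol_on_slice[OF f, unfolded slice_hol_def, rule_format]], rule)
        fix \<mu> :: complex assume "\<mu> \<in> ball 0 e"
        then have "s *\<^sub>R (a + \<mu> *s v) \<in> A" using e by blast
        then have m: "?p *s (a + \<mu> *s v) \<in> A" using circle_A[of s ?p "a + \<mu> *s v"] s cmod_circlepath0[of s t] by simp
        have "?p *s (a + \<mu> *s v) = ?p *s a + \<mu> *s (?p *s v)" by (simp add: vec_eq_iff algebra_simps)
        from m[unfolded this] show "\<mu> \<in> {\<mu>. ?p *s a + \<mu> *s (?p *s v) \<in> A}" by (simp only: mem_Collect_eq)
      qed
      moreover have e: "?p *s (a + \<mu> *s v) = ?p *s a + \<mu> *s (?p *s v)" for \<mu>
        by (simp add: vec_eq_iff algebra_simps)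
      ultimately show "(\<lambda>\<mu>. f (?p *s (a + \<mu> *s v)) * (?p / (?p - 1))) holomorphic_on ball 0 e"
        unfolding e by (intro holomorphic_on_mult holomorphic_on_const)
    qed auto
    then show "\<exists>e>0. (\<lambda>\<mu>. cauchy_ray f s (a + \<mu> *s v)) holomorphic_on ball 0 e" using e(1) by blast
  qed
  show "loc_bdd (cauchy_ray f s) {z. s *\<^sub>R z \<in> A}"
    unfolding loc_bdd_def
  proof
    fix a assume "a \<in> {z. s *\<^sub>R z \<in> A}"
    then obtain e where e: "e > 0" "cball a e \<subseteq> {z. s *\<^sub>R z \<in> A}"
      using scaleR_open open_contains_cball by blast
    define Q where "Q = (\<lambda>p. fst p *s snd p) ` (sphere 0 s \<times> cball a e)"
    have "compact Q"
      unfolding Q_def by (intro compact_continuous_image continuous_intros compact_Times) auto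
    moreover have "Q \<subseteq> A"
    proof -
      have "c *s z \<in> A" if "cmod c = s" "z \<in> cball a e" for c z
      proof -
        have "s *\<^sub>R z \<in> A" using e(2) that(2) by blast
        then show ?thesis using circle_A[OF s(1) that(1)] by blast
      qed
      then show ?thesis by (auto simp: Q_def)
    qed
    ultimately have "compact (f ` Q)"
      using cf by (meson compact_continuous_image continuous_on_subset)
    then obtain M where M: "\<And>w. w \<in> Q \<Longrightarrow> cmod (f w) \<le> M"
      using compact_imp_bounded bounded_iff by (metis imageI)
    have "cmod (cauchy_ray f s z) \<le> M * s / \<bar>s - 1\<bar>" if "z \<in> ball a e" for z
    proof (rule cauchy_ray_bound[OF cf s])
      have "z \<in> cball a e" using that by simp
      then show "s *\<^sub>R z \<in> A" using e(2) by blast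
      fix \<xi> assume "cmod \<xi> = s"
      then have "\<xi> *s z \<in> Q" using that by (force simp: Q_def)
      then show "cmod (f (\<xi> *s z)) \<le> M" by (rule M)
    qed
    then show "\<exists>e>0. \<exists>M. \<forall>z\<in>ball a e. cmod (cauchy_ray f s z) \<le> M" using e(1) by blast
  qed
qed

text \<open>The closed annulus between the circles lies in the shell and misses the pole w = 1, so
  Cauchy's theorem applies.\<close>

lemma cauchy_ray_indep_le:
  assumes f: "hol_on f A" and s: "0 < s" "s \<le> s'" "s *\<^sub>R z \<in> A" "s' *\<^sub>R z \<in> A" and side: "s' < 1 \<or> 1 < s"
  shows "cauchy_ray f s z = cauchy_ray f s' z"
proof -
  have "contour_integral (circlepath 0 s) (\<lambda>w. f (w *s z) / (w - 1)) =
        contour_integral (circlepath 0 s') (\<lambda>w. f (w *s z) / (w - 1))"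
  proof (rule annulus_Cauchy[of "{\<mu>. \<mu> *s z \<in> A} - {1}"])
    show "open ({\<mu>. \<mu> *s z \<in> A} - {1})" by (intro open_delete open_line open_A)
    show "(\<lambda>w. f (w *s z) / (w - 1)) holomorphic_on {\<mu>. \<mu> *s z \<in> A} - {1}"
      by (intro holomorphic_on_divide holomorphic_intros holomorphic_on_subset[OF hol_on_line[OF f]]) auto
    show "w \<in> {\<mu>. \<mu> *s z \<in> A} - {1}" if "s \<le> cmod w" "cmod w \<le> s'" for w
      using between_A[OF s(3,4,1) that] that side by auto
  qed (use s in auto)
  then have "2 * of_real pi * \<i> * cauchy_ray f s z = 2 * of_real pi * \<i> * cauchy_ray f s' z"
    by (simp only: cauchy_ray_eq_contour)
  then show ?thesis by simp
qed

lemma cauchy_ray_indep: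
  assumes "hol_on f A" "0 < s" "0 < s'" "s *\<^sub>R z \<in> A" "s' *\<^sub>R z \<in> A" "s < 1 \<and> s' < 1 \<or> 1 < s \<and> 1 < s'"
  shows "cauchy_ray f s z = cauchy_ray f s' z"
proof (cases "s \<le> s'")
  case True
  then show ?thesis using cauchy_ray_indep_le[OF assms(1,2) _ assms(4,5)] assms(6) by blast
next
  case False
  then have "s' \<le> s" by simp
  then show ?thesis using cauchy_ray_indep_le[OF assms(1,3) _ assms(5,4)] assms(6) by metis
qed

text \<open>Cauchy's integral formula on an annulus that contains the pole w = 1. The difference
  quotient \<open>\<psi>\<close> is holomorphic across 1, so its two integrals agree; what remains
  is f z times the integrals of 1 / (w - 1), which are 2 pi i outside and 0 inside.\<close>

lemma cauchy_ray_jump: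
  assumes f: "hol_on f A" and s: "0 < s" "s < 1" "1 < s'" "s *\<^sub>R z \<in> A" "s' *\<^sub>R z \<in> A"
  shows "cauchy_ray f s' z - cauchy_ray f s z = f z"
proof -
  let ?U = "{\<mu>. \<mu> *s z \<in> A}"
  define \<phi> where "\<phi> = (\<lambda>w. f (w *s z))"
  have z: "z \<in> A" using between_A[OF s(4,5,1), of 1] s by simp
  have hol\<phi>: "\<phi> holomorphic_on ?U" unfolding \<phi>_def by (rule hol_on_line[OF f])
  have opU: "open ?U" by (intro open_line open_A)
  have inU: "w \<in> ?U" if "s \<le> cmod w" "cmod w \<le> s'" for w using between_A[OF s(4,5,1) that] by simp
  define \<psi> where "\<psi> = (\<lambda>w. if w = 1 then deriv \<phi> 1 else (\<phi> w - \<phi> 1) / (w - 1))"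
  have hol\<psi>: "\<psi> holomorphic_on ?U"
    unfolding \<psi>_def by (rule pole_lemma[OF hol\<phi>]) (use z opU in \<open>simp add: interior_open\<close>)
  have eq: "contour_integral (circlepath 0 s) \<psi> = contour_integral (circlepath 0 s') \<psi>"
    by (rule annulus_Cauchy[OF opU hol\<psi>]) (use s inU in auto)
  have int1: "(\<lambda>w. \<phi> w / (w - 1)) contour_integrable_on circlepath 0 r" if "r \<in> {s, s'}" for r
  proof (rule contour_integrable_continuous_circlepath)
    have "path_image (circlepath 0 r) \<subseteq> ?U - {1}" using that s inU by auto
    then show "continuous_on (path_image (circlepath 0 r)) (\<lambda>w. \<phi> w / (w - 1))"
      using continuous_on_subset[OF holomorphic_on_imp_continuous_on[OF hol\<phi>]]
      by (intro continuous_intros) auto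
  qed
  have int2: "(\<lambda>w. 1 / (w - 1)) contour_integrable_on circlepath 0 r" if "r \<in> {s, s'}" for r
    by (rule contour_integrable_continuous_circlepath) (use that s in \<open>auto intro!: continuous_intros\<close>)
  have split: "contour_integral (circlepath 0 r) \<psi> =
      contour_integral (circlepath 0 r) (\<lambda>w. \<phi> w / (w - 1)) - \<phi> 1 * contour_integral (circlepath 0 r) (\<lambda>w. 1 / (w - 1))"
    if r: "r \<in> {s, s'}" for r
  proof -
    have "contour_integral (circlepath 0 r) \<psi> = contour_integral (circlepath 0 r) (\<lambda>w. \<phi> w / (w - 1) - \<phi> 1 * (1 / (w - 1)))"
      by (rule contour_integral_eq) (use r s in \<open>auto simp: \<psi>_def diff_divide_distrib\<close>)
    then show ?thesis
      using int1[OF r] contour_integrable_lmul[OF int2[OF r], of "\<phi> 1"] int2[OF r]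
      by (simp only: contour_integral_diff contour_integral_lmul)
  qed
  have out: "contour_integral (circlepath 0 s') (\<lambda>w. 1 / (w - 1)) = 2 * of_real pi * \<i>"
    using Cauchy_integral_circlepath[of 0 s' "\<lambda>_. 1" 1] s by (intro contour_integral_unique) auto
  have "((\<lambda>w. 1 / (w - 1)) has_contour_integral 0) (circlepath 0 s)"
    by (rule Cauchy_theorem_convex_simple[of _ "ball 0 1"])
      (use s in \<open>auto intro!: holomorphic_intros\<close>)
  then have inn: "contour_integral (circlepath 0 s) (\<lambda>w. 1 / (w - 1)) = 0"
    by (rule contour_integral_unique)
  have "2 * of_real pi * \<i> * (cauchy_ray f s' z - cauchy_ray f s z) = 2 * of_real pi * \<i> * f z"
  proof -
    have "contour_integral (circlepath 0 s') (\<lambda>w. \<phi> w / (w - 1)) - contour_integral (circlepath 0 s) (\<lambda>w. \<phi> w / (w - 1))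
        = \<phi> 1 * (2 * of_real pi * \<i>)"
      using split[of s, simplified inn] split[of s', simplified out] eq by (simp add: algebra_simps)
    then show ?thesis
      unfolding right_diff_distrib cauchy_ray_eq_contour by (simp add: \<phi>_def ac_simps)
  qed
  then show ?thesis by simp
qed

lemma core_bdd:
  assumes "continuous_on A f" "\<delta> > 0"
  obtains M where "M \<ge> 0" "\<And>w. w \<in> core \<delta> \<Longrightarrow> cmod (f w) \<le> M"
proof -
  have "compact (f ` core \<delta>)"
    using assms core_sub compact_core by (meson compact_continuous_image continuous_on_subset)
  then obtain M where "\<And>w. w \<in> core \<delta> \<Longrightarrow> cmod (f w) \<le> M"
    using compact_imp_bounded bounded_iff by (metis imageI)
  then show thesis by (intro that[of "max M 0"]) (auto simp: le_max_iff_disj)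
qed

text \<open>The inner Cauchy integral extends to an entire function on every complex line missing \<open>L\<close>, and
  vanishes at infinity; such lines exist because the dimension is at least two.\<close>

lemma inner_cauchy_ray_zero:
  assumes f: "hol_on f A" and s: "0 < s" "s < 1" "s *\<^sub>R z \<in> A"
  shows "cauchy_ray f s z = 0"
proof -
  \<comment> \<open>All admissible s < 1 give the same value, so the pointwise choice glues the
    local functions to a holomorphic function on the complement of \<open>L\<close>.\<close>
  define G where "G = (\<lambda>z. cauchy_ray f (SOME s. 0 < s \<and> s < 1 \<and> s *\<^sub>R z \<in> A) z)"
  have G: "G z = cauchy_ray f s z" if "0 < s" "s < 1" "s *\<^sub>R z \<in> A" for z s
  proof -
    have "\<exists>s. 0 < s \<and> s < 1 \<and> s *\<^sub>R z \<in> A" using that by blast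
    from someI_ex[OF this] show ?thesis
      unfolding G_def using that by (intro cauchy_ray_indep[OF f]) auto
  qed
  have holG: "hol_on G (- L)"
  proof (rule hol_on_local)
    fix a assume "a \<in> - L"
    then obtain s where s: "0 < s" "s < 1" "s *\<^sub>R a \<in> A" using ray_into_A_in by blast
    have "hol_on G {z. s *\<^sub>R z \<in> A}"
      by (rule hol_on_cong[OF scaleR_open _ cauchy_ray_hol[OF f]]) (use s G in auto)
    then show "\<exists>T. open T \<and> a \<in> T \<and> hol_on G T"
      using scaleR_open s by (intro exI[of _ "{z. s *\<^sub>R z \<in> A}"]) auto
  qed
  obtain R where R: "R > 0" "\<And>w. w \<in> \<Omega> \<Longrightarrow> norm w \<le> R"
    using bounded_\<Omega> bounded_pos by blast
  obtain \<delta> where \<delta>: "\<delta> > 0" "\<And>z. z \<noteq> 0 \<Longrightarrow> \<exists>r>0. r *\<^sub>R z \<in> core \<delta>" using rays_hit_core by blast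
  obtain M where M: "M \<ge> 0" "\<And>w. w \<in> core \<delta> \<Longrightarrow> cmod (f w) \<le> M"
    using core_bdd[OF hol_on_continuous[OF f] \<delta>(1)] by blast
  \<comment> \<open>For large z the core provides a radius r of size at most R / norm z, because r z
    stays in the bounded set \<open>\<Omega>\<close>. The bound for the Cauchy integral contains r
    as a factor.\<close>
  have decay: "cmod (G z) \<le> 2 * M * R / norm z" if z: "norm z \<ge> 2 * R" for z
  proof -
    have nz: "norm z > 0" using z R by linarith
    then have "z \<noteq> 0" by auto
    from \<delta>(2)[OF this] obtain r where r: "r > 0" "r *\<^sub>R z \<in> core \<delta>" by blast
    have rA: "r *\<^sub>R z \<in> A" using r core_sub \<delta> by blast
    have "r * norm z \<le> R" using R(2)[of "r *\<^sub>R z"] rA r by simp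
    then have rle: "r \<le> R / norm z" using nz by (simp add: field_simps)
    also have "R / norm z \<le> 1 / 2" using z nz by (simp add: field_simps)
    finally have r2: "r \<le> 1 / 2" .
    have "cmod (G z) = cmod (cauchy_ray f r z)" using G[of r z] r r2 rA by simp
    also have "\<dots> \<le> M * r / \<bar>r - 1\<bar>"
      using r r2 rA M circle_core[OF r(1) _ r(2)]
      by (intro cauchy_ray_bound[OF hol_on_continuous[OF f]]) auto
    also have "\<dots> \<le> M * r / (1 / 2)"
      using r r2 M by (intro divide_left_mono) auto
    also have "\<dots> \<le> M * (R / norm z) / (1 / 2)"
      using rle M by (intro divide_right_mono mult_left_mono) auto
    finally show ?thesis by (simp add: ac_simps)
  qed
  \<comment> \<open>Moving along the j-th axis does not change the large coordinate
    \<open>w $ i\<close>, so the whole line stays outside \<open>\<Omega>\<close>. G is entire on it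
    and tends to 0, hence vanishes by Liouville's theorem.\<close>
  have far: "G w = 0" if w: "cmod (w $ i) > R" for w :: "complex ^ 'n" and i
  proof -
    obtain j where j: "j \<noteq> i"
      using card by (metis (full_types) One_nat_def card_le_Suc0_iff_eq finite not_less_eq_eq numeral_2_eq_2 UNIV_I)
    define v where "v = (axis j 1 :: complex ^ 'n)"
    have nv: "norm v = 1" by (simp add: v_def norm_axis_complex)
    have "w + \<mu> *s v \<in> - L" for \<mu>
    proof -
      have wi: "(w + \<mu> *s v) $ i = w $ i" using j by (simp add: v_def axis_def)
      then have "norm (w + \<mu> *s v) > R" using w Finite_Cartesian_Product.norm_nth_le[of "w + \<mu> *s v" i] unfolding wi by linarith
      then show ?thesis using R(2)[of "w + \<mu> *s v"] L_sub by auto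
    qed
    then have "{\<mu>. w + \<mu> *s v \<in> - L} = UNIV" by auto
    then have ent: "(\<lambda>\<mu>. G (w + \<mu> *s v)) holomorphic_on UNIV"
      using hol_on_slice[OF holG, unfolded slice_hol_def, rule_format, of w v] by simp
    have lim: "((\<lambda>\<mu>. G (w + \<mu> *s v)) \<longlongrightarrow> 0) at_infinity"
    proof (rule Lim_null_comparison)
      show "\<forall>\<^sub>F \<mu> in at_infinity. cmod (G (w + \<mu> *s v)) \<le> 2 * M * R / (cmod \<mu> - norm w)"
        unfolding eventually_at_infinity
      proof (intro exI allI impI)
        fix \<mu> :: complex assume \<mu>: "2 * R + norm w \<le> cmod \<mu>"
        have n: "cmod \<mu> - norm w \<le> norm (w + \<mu> *s v)"
          using norm_triangle_ineq4[of "w + \<mu> *s v" w] nv by (simp add: norm_cscale)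
        have "cmod (G (w + \<mu> *s v)) \<le> 2 * M * R / norm (w + \<mu> *s v)"
          using n \<mu> by (intro decay) auto
        also have "\<dots> \<le> 2 * M * R / (cmod \<mu> - norm w)"
        proof (rule divide_left_mono[OF n])
          show "0 \<le> 2 * M * R" using M R by simp
          have "0 < cmod \<mu> - norm w" using \<mu> R by linarith
          then show "0 < norm (w + \<mu> *s v) * (cmod \<mu> - norm w)" using n by (intro mult_pos_pos) auto
        qed
        finally show "cmod (G (w + \<mu> *s v)) \<le> 2 * M * R / (cmod \<mu> - norm w)" .
      qed
      have "filterlim (\<lambda>\<mu>::complex. - norm w + cmod \<mu>) at_top at_infinity"
        by (intro filterlim_tendsto_add_at_top[OF tendsto_const] filterlim_norm_at_top)
      then show "((\<lambda>\<mu>. 2 * M * R / (cmod \<mu> - norm w)) \<longlongrightarrow> 0) at_infinity"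
        by (intro real_tendsto_divide_at_top[OF tendsto_const]) (simp add: add.commute)
    qed
    show ?thesis using Liouville_weak_0[OF ent lim, of 0] by simp
  qed
  have zL: "z \<notin> L"
    using complete_circular_mono[OF circ_L, of "of_real s" 1 z] s by (auto simp: scaleR_eq_cscale)
  have z0: "z \<noteq> 0" using zL zero_L by auto
  obtain i where i: "z $ i \<noteq> 0" using z0 by (auto simp: vec_eq_iff)
  obtain s1 where s1: "s1 \<ge> 0" "s1 *\<^sub>R z \<in> L" "\<And>s'. s' > s1 \<Longrightarrow> s' *\<^sub>R z \<notin> L"
    using ray_exit[OF z0] by blast
  have s11: "s1 < 1"
    using complete_circular_mono[OF circ_L, of 1 "of_real s1" z] s1 zL
    by (force simp: scaleR_eq_cscale not_less)
  \<comment> \<open>The vanishing is carried from far away to z on the line through 0 and z. The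
    half-plane is connected, maps outside \<open>L\<close> since |\<mu>| > s1, and contains 1
    because s1 < 1.\<close>
  let ?H = "{\<mu>::complex. Re \<mu> > s1}"
  define N where "N = max s1 (R / cmod (z $ i))"
  have sub: "?H \<subseteq> {\<mu>. \<mu> *s z \<in> - L}"
  proof
    fix \<mu> assume "\<mu> \<in> ?H"
    then have "cmod \<mu> > s1" using complex_Re_le_cmod[of \<mu>] by simp
    then have "cmod \<mu> *\<^sub>R z \<notin> L" by (rule s1(3))
    then show "\<mu> \<in> {\<mu>. \<mu> *s z \<in> - L}"
      using complete_circular_mono[OF circ_L, of "of_real (cmod \<mu>)" \<mu> z] by (auto simp: scaleR_eq_cscale)
  qed
  have holz: "(\<lambda>\<mu>. G (\<mu> *s z)) holomorphic_on ?H"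
    by (rule holomorphic_on_subset[OF hol_on_line[OF holG] sub])
  have "(\<lambda>\<mu>. G (\<mu> *s z)) 1 = (\<lambda>\<mu>. 0) 1"
  proof (rule analytic_continuation_open[of "{\<mu>. Re \<mu> > N}" ?H "\<lambda>\<mu>. G (\<mu> *s z)" "\<lambda>\<mu>. 0"])
    show "open {\<mu>. Re \<mu> > N}" "open ?H" by (auto intro: open_halfspace_Re_gt)
    show "connected ?H" by (intro convex_connected convex_halfspace_Re_gt)
    have "complex_of_real (N + 1) \<in> {\<mu>. Re \<mu> > N}" by simp
    then show "{\<mu>. Re \<mu> > N} \<noteq> {}" by blast
    show "{\<mu>. Re \<mu> > N} \<subseteq> ?H" by (auto simp: N_def)
    fix \<mu> :: complex assume "\<mu> \<in> {\<mu>. Re \<mu> > N}"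
    then have "cmod \<mu> > R / cmod (z $ i)" using complex_Re_le_cmod[of \<mu>] by (simp add: N_def)
    then have "cmod ((\<mu> *s z) $ i) > R" using i by (simp add: norm_mult field_simps)
    then show "G (\<mu> *s z) = 0" by (rule far)
  qed (use holz s11 in auto)
  then show ?thesis using G[OF s] by simp
qed

text \<open>The outer Cauchy integrals are the extension: they are available at every nonzero point
  of \<open>\<Omega>\<close>, and on the shell the jump formula compares them with f, the inner
  integral being 0. At 0 no multiple of the point lies in the shell, so 0 is added by
  \<open>hol_removable_origin\<close>.\<close>

theorem hartogs_extension:
  assumes f: "hol_on f A"
  obtains F where "hol_on F \<Omega>" "\<And>z. z \<in> A \<Longrightarrow> F z = f z"
proof -
  define F0 where "F0 = (\<lambda>z. cauchy_ray f (SOME s. 1 < s \<and> s *\<^sub>R z \<in> A) z)"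
  have F0: "F0 z = cauchy_ray f s z" if "1 < s" "s *\<^sub>R z \<in> A" for z s
  proof -
    have "\<exists>s. 1 < s \<and> s *\<^sub>R z \<in> A" using that by blast
    from someI_ex[OF this] show ?thesis
      unfolding F0_def using that by (intro cauchy_ray_indep[OF f]) auto
  qed
  have hol: "hol_on F0 (\<Omega> - {0})"
  proof (rule hol_on_local)
    fix a assume "a \<in> \<Omega> - {0}"
    then obtain s where s: "1 < s" "s *\<^sub>R a \<in> A" using ray_into_A_out[of a] by blast
    have "hol_on F0 {z. s *\<^sub>R z \<in> A}"
      by (rule hol_on_cong[OF scaleR_open _ cauchy_ray_hol[OF f]]) (use s F0 in auto)
    then show "\<exists>T. open T \<and> a \<in> T \<and> hol_on F0 T"
      using scaleR_open s by (intro exI[of _ "{z. s *\<^sub>R z \<in> A}"]) auto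
  qed
  obtain \<delta> where \<delta>: "\<delta> > 0" "\<And>z. z \<noteq> 0 \<Longrightarrow> \<exists>r>0. r *\<^sub>R z \<in> core \<delta>" using rays_hit_core by blast
  obtain M where M: "M \<ge> 0" "\<And>w. w \<in> core \<delta> \<Longrightarrow> cmod (f w) \<le> M"
    using core_bdd[OF hol_on_continuous[OF f] \<delta>(1)] by blast
  \<comment> \<open>For norm z < \<delta> / 2 a core point on the ray has r > 2, so r / (r - 1) is
    at most 2.\<close>
  have bd: "cmod (F0 z) \<le> 2 * M" if z: "norm z < \<delta> / 2" "z \<noteq> 0" for z
  proof -
    from \<delta>(2)[OF z(2)] obtain r where r: "r > 0" "r *\<^sub>R z \<in> core \<delta>" by blast
    have rA: "r *\<^sub>R z \<in> A" using r core_sub \<delta> by blast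
    have "\<delta> \<le> r * norm z" using core_norm[OF r(2)] r by simp
    also have "\<dots> < r * (\<delta> / 2)" using z r by (intro mult_strict_left_mono) auto
    finally have r2: "r > 2" using \<delta>(1) by (simp add: field_simps)
    have "cmod (F0 z) = cmod (cauchy_ray f r z)" using F0[of r z] r r2 rA by simp
    also have "\<dots> \<le> M * r / \<bar>r - 1\<bar>"
      using r r2 rA M circle_core[OF r(1) _ r(2)]
      by (intro cauchy_ray_bound[OF hol_on_continuous[OF f]]) auto
    also have "\<dots> = M * (r / (r - 1))" using r2 by simp
    also have "\<dots> \<le> M * 2" using r2 M by (intro mult_left_mono) (auto simp: field_simps)
    finally show ?thesis by simp
  qed
  obtain F where F: "hol_on F \<Omega>" "\<And>z. z \<noteq> 0 \<Longrightarrow> F z = F0 z"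
    using hol_removable_origin[OF card open_\<Omega> zero_\<Omega> hol _ bd] \<delta>(1) by (metis half_gt_zero)
  have "F z = f z" if z: "z \<in> A" for z
  proof -
    have z0: "z \<noteq> 0" using z zero_L by auto
    have "z \<in> \<Omega>" "z \<notin> L" using z by auto
    obtain s where s: "0 < s" "s < 1" "s *\<^sub>R z \<in> A" using ray_into_A_in[OF \<open>z \<notin> L\<close>] by blast
    obtain s' where s': "1 < s'" "s' *\<^sub>R z \<in> A" using ray_into_A_out[OF \<open>z \<in> \<Omega>\<close> z0] by blast
    have "F z = cauchy_ray f s' z" using F(2)[OF z0] F0[OF s'] by simp
    also have "\<dots> = f z" using cauchy_ray_jump[OF f s(1,2) s'(1) s(3) s'(2)] inner_cauchy_ray_zero[OF f s] by simp
    finally show ?thesis .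
  qed
  then show thesis using that F(1) by blast
qed

end

subsection \<open>Bergman spaces\<close>

definition sqn :: "(complex ^ 'n) set \<Rightarrow> (complex ^ 'n \<Rightarrow> complex) \<Rightarrow> real" where
  "sqn S f = (LINT z:S|lborel. (cmod (f z))\<^sup>2)"

lemma set_borel_measurable_cont:
  fixes f :: "'a::euclidean_space \<Rightarrow> 'b::euclidean_space"
  assumes "S \<in> sets borel" "continuous_on S f"
  shows "set_borel_measurable lborel S f"
  using borel_measurable_continuous_on_indicator[OF assms] by (simp add: set_borel_measurable_def)

lemma bergman_inner_integrable:
  assumes S: "open S" and f: "f \<in> bergman_space S" and g: "g \<in> bergman_space S"
  shows "set_integrable lborel S (\<lambda>z. f z * cnj (g z))"
proof (rule set_integrable_bound)
  show "set_integrable lborel S (\<lambda>z. (cmod (f z))\<^sup>2 + (cmod (g z))\<^sup>2)"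
    using f g by (simp add: bergman_space_def)
  have "continuous_on S f" "continuous_on S g"
    using f g by (auto simp: bergman_space_def intro: hol_on_continuous)
  then show "set_borel_measurable lborel S (\<lambda>z. f z * cnj (g z))"
    using S by (intro set_borel_measurable_cont continuous_intros) auto
  have "cmod (f z * cnj (g z)) \<le> (cmod (f z))\<^sup>2 + (cmod (g z))\<^sup>2" for z
  proof -
    have "2 * (cmod (f z) * cmod (g z)) \<le> (cmod (f z))\<^sup>2 + (cmod (g z))\<^sup>2"
      using sum_squares_bound[of "cmod (f z)" "cmod (g z)"] by simp
    moreover have "0 \<le> cmod (f z) * cmod (g z)" by simp
    ultimately show ?thesis unfolding norm_mult complex_mod_cnj by linarith
  qed
  then show "AE z in lborel. z \<in> S \<longrightarrow> norm (f z * cnj (g z)) \<le> norm ((cmod (f z))\<^sup>2 + (cmod (g z))\<^sup>2)"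
    by (auto intro!: AE_I2 simp: abs_of_nonneg)
qed

lemma bergman_space_cmult: "f \<in> bergman_space S \<Longrightarrow> (\<lambda>z. c * f z) \<in> bergman_space S"
  by (auto simp: bergman_space_def hol_on_cmult norm_mult power_mult_distrib)

lemma bergman_space_add:
  assumes S: "open S" and f: "f \<in> bergman_space S" and g: "g \<in> bergman_space S"
  shows "(\<lambda>z. f z + g z) \<in> bergman_space S"
  unfolding bergman_space_def mem_Collect_eq
proof
  show hol: "hol_on (\<lambda>z. f z + g z) S" using f g by (auto simp: bergman_space_def intro: hol_on_add)
  show "set_integrable lborel S (\<lambda>z. (cmod (f z + g z))\<^sup>2)"
  proof (rule set_integrable_bound)
    show "set_integrable lborel S (\<lambda>z. 2 * (cmod (f z))\<^sup>2 + 2 * (cmod (g z))\<^sup>2)"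
      using f g by (simp add: bergman_space_def)
    show "set_borel_measurable lborel S (\<lambda>z. (cmod (f z + g z))\<^sup>2)"
      using S hol_on_continuous[OF hol]
      by (intro set_borel_measurable_cont continuous_on_power continuous_on_norm) auto
    have "(cmod (f z + g z))\<^sup>2 \<le> 2 * (cmod (f z))\<^sup>2 + 2 * (cmod (g z))\<^sup>2" for z
    proof -
      have "(cmod (f z + g z))\<^sup>2 \<le> (cmod (f z) + cmod (g z))\<^sup>2"
        by (intro power_mono norm_triangle_ineq) simp
      also have "\<dots> \<le> 2 * (cmod (f z))\<^sup>2 + 2 * (cmod (g z))\<^sup>2"
        using sum_squares_bound[of "cmod (f z)" "cmod (g z)"] by (simp add: power2_sum)
      finally show ?thesis .
    qed
    then show "AE z in lborel. z \<in> S \<longrightarrow> norm ((cmod (f z + g z))\<^sup>2) \<le> norm (2 * (cmod (f z))\<^sup>2 + 2 * (cmod (g z))\<^sup>2)"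
      by (auto intro!: AE_I2 simp: abs_of_nonneg)
  qed
qed

lemma bergman_space_zero: "(\<lambda>z. 0) \<in> bergman_space S"
  by (simp add: bergman_space_def hol_on_const set_integrable_def)

lemma bergman_space_diff:
  assumes "open S" "f \<in> bergman_space S" "g \<in> bergman_space S"
  shows "(\<lambda>z. f z - g z) \<in> bergman_space S"
  using bergman_space_add[OF assms(1,2) bergman_space_cmult[OF assms(3), of "-1"]] by simp

lemma bergman_space_sum:
  assumes "open S" "\<And>i. i \<in> I \<Longrightarrow> f i \<in> bergman_space S"
  shows "(\<lambda>z. \<Sum>i\<in>I. f i z) \<in> bergman_space S"
  using assms by (induction I rule: infinite_finite_induct) (auto intro: bergman_space_zero bergman_space_add)

lemma bergman_inner_cnj: "bergman_inner S g f = cnj (bergman_inner S f g)"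
proof -
  have "cnj (bergman_inner S f g) = (LINT z|lborel. cnj (indicator S z *\<^sub>R (f z * cnj (g z))))"
    unfolding bergman_inner_def set_lebesgue_integral_def by (rule Bochner_Integration.integral_cnj[symmetric])
  then show ?thesis
    by (simp add: bergman_inner_def set_lebesgue_integral_def scaleR_conv_of_real ac_simps)
qed

lemma bergman_inner_cmult_left: "bergman_inner S (\<lambda>z. c * f z) g = c * bergman_inner S f g"
  by (simp add: bergman_inner_def mult.assoc)

lemma bergman_inner_add_left:
  assumes "open S" "f \<in> bergman_space S" "g \<in> bergman_space S" "h \<in> bergman_space S"
  shows "bergman_inner S (\<lambda>z. f z + g z) h = bergman_inner S f h + bergman_inner S g h"
  using bergman_inner_integrable[OF assms(1,2,4)] bergman_inner_integrable[OF assms(1,3,4)]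
  by (simp add: bergman_inner_def distrib_right)

lemma bergman_inner_diff_left:
  assumes "open S" "f \<in> bergman_space S" "g \<in> bergman_space S" "h \<in> bergman_space S"
  shows "bergman_inner S (\<lambda>z. f z - g z) h = bergman_inner S f h - bergman_inner S g h"
  using bergman_inner_integrable[OF assms(1,2,4)] bergman_inner_integrable[OF assms(1,3,4)]
  by (simp add: bergman_inner_def left_diff_distrib)

lemma bergman_inner_sum_left:
  assumes S: "open S" and f: "\<And>i. i \<in> I \<Longrightarrow> f i \<in> bergman_space S" and h: "h \<in> bergman_space S"
  shows "bergman_inner S (\<lambda>z. \<Sum>i\<in>I. c i * f i z) h = (\<Sum>i\<in>I. c i * bergman_inner S (f i) h)"
  using f
proof (induction I rule: infinite_finite_induct)
  case (insert x F)
  have "bergman_inner S (\<lambda>z. c x * f x z + (\<Sum>i\<in>F. c i * f i z)) h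
      = bergman_inner S (\<lambda>z. c x * f x z) h + bergman_inner S (\<lambda>z. \<Sum>i\<in>F. c i * f i z) h"
    using insert.prems
    by (intro bergman_inner_add_left S h bergman_space_sum bergman_space_cmult) auto
  then show ?case using insert by (simp add: bergman_inner_cmult_left)
qed (simp_all add: bergman_inner_def set_lebesgue_integral_def)

lemma bergman_inner_self: "bergman_inner S f f = of_real (sqn S f)"
proof -
  have "f z * cnj (f z) = of_real ((cmod (f z))\<^sup>2)" for z by (rule complex_norm_square[symmetric])
  then show ?thesis
    unfolding bergman_inner_def sqn_def by (simp only: set_integral_complex_of_real)
qed

lemma bergman_inner_cong:
  assumes "S \<in> sets borel" "\<And>z. z \<in> S \<Longrightarrow> f z = f' z" "\<And>z. z \<in> S \<Longrightarrow> g z = g' z"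
  shows "bergman_inner S f g = bergman_inner S f' g'"
  unfolding bergman_inner_def by (rule set_lebesgue_integral_cong) (use assms in auto)

lemma sqn_nonneg: "sqn S f \<ge> 0"
  unfolding sqn_def set_lebesgue_integral_def by (intro integral_nonneg_AE) (auto simp: indicator_def)

lemma sqn_cmult: "sqn S (\<lambda>z. c * f z) = (cmod c)\<^sup>2 * sqn S f"
  by (simp add: sqn_def norm_mult power_mult_distrib)

lemma sqn_add_cmult:
  assumes S: "open S" and f: "f \<in> bergman_space S" and g: "g \<in> bergman_space S"
  shows "sqn S (\<lambda>z. f z + c * g z) = sqn S f + 2 * Re (cnj c * bergman_inner S f g) + (cmod c)\<^sup>2 * sqn S g"
proof -
  have cg: "(\<lambda>z. c * g z) \<in> bergman_space S" by (rule bergman_space_cmult[OF g])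
  note fcg = bergman_space_add[OF S f cg]
  have r: "bergman_inner S h (\<lambda>z. f z + c * g z) = bergman_inner S h f + cnj c * bergman_inner S h g"
    if h: "h \<in> bergman_space S" for h
    unfolding bergman_inner_cnj[of S h]
    by (simp add: bergman_inner_add_left[OF S f cg h] bergman_inner_cmult_left bergman_inner_cnj[of S _ h])
  have "complex_of_real (sqn S (\<lambda>z. f z + c * g z)) =
      bergman_inner S f (\<lambda>z. f z + c * g z) + c * bergman_inner S g (\<lambda>z. f z + c * g z)"
    unfolding bergman_inner_self[symmetric]
    by (simp add: bergman_inner_add_left[OF S f cg fcg] bergman_inner_cmult_left)
  also have "\<dots> = of_real (sqn S f) + (cnj c * bergman_inner S f g + cnj (cnj c * bergman_inner S f g))
      + c * cnj c * of_real (sqn S g)"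
    using r[OF f] r[OF g]
    by (simp add: bergman_inner_self bergman_inner_cnj[of S g f] algebra_simps)
  also have "\<dots> = of_real (sqn S f + 2 * Re (cnj c * bergman_inner S f g) + (cmod c)\<^sup>2 * sqn S g)"
    unfolding complex_add_cnj complex_norm_square[symmetric] by simp
  finally show ?thesis using of_real_eq_iff by blast
qed

lemma bergman_Cauchy_Schwarz:
  assumes S: "open S" and f: "f \<in> bergman_space S" and g: "g \<in> bergman_space S"
  shows "(cmod (bergman_inner S f g))\<^sup>2 \<le> sqn S f * sqn S g"
proof -
  define i where "i = bergman_inner S f g"
  have le: "0 \<le> sqn S f - 2 * s * (cmod i)\<^sup>2 + s\<^sup>2 * (cmod i)\<^sup>2 * sqn S g" for s :: real
  proof -
    have "cnj (- of_real s * i) * i = of_real (- s * (cmod i)\<^sup>2)"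
      using complex_norm_square[of i] by (simp add: ac_simps)
    then have "Re (cnj (- of_real s * i) * i) = - s * (cmod i)\<^sup>2" by (metis Re_complex_of_real)
    then show ?thesis
      using sqn_nonneg[of S "\<lambda>z. f z + (- of_real s * i) * g z"] sqn_add_cmult[OF S f g, of "- of_real s * i"]
      by (simp add: i_def norm_mult power_mult_distrib)
  qed
  show ?thesis
  proof (cases "sqn S g = 0")
    case True
    have "(cmod i)\<^sup>2 = 0"
    proof (rule ccontr)
      assume n: "(cmod i)\<^sup>2 \<noteq> 0"
      have "0 \<le> sqn S f - 2 * ((sqn S f + 1) / (cmod i)\<^sup>2) * (cmod i)\<^sup>2"
        using le[of "(sqn S f + 1) / (cmod i)\<^sup>2"] True by simp
      then have "0 \<le> sqn S f - 2 * (sqn S f + 1)" using n by simp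
      then show False using sqn_nonneg[of S f] by simp
    qed
    then show ?thesis using True by (simp add: i_def)
  next
    case False
    then have p: "sqn S g > 0" using sqn_nonneg[of S g] by simp
    then have "0 \<le> sqn S f - (cmod i)\<^sup>2 / sqn S g"
      using le[of "1 / sqn S g"] by (simp add: power2_eq_square)
    then show ?thesis using p by (simp add: i_def field_simps)
  qed
qed

lemma sqn_orthonormal_sum:
  assumes S: "open S" and J: "finite J" and e: "\<And>i. i \<in> J \<Longrightarrow> e i \<in> bergman_space S"
    and orth: "\<And>i j. i \<in> J \<Longrightarrow> j \<in> J \<Longrightarrow> bergman_inner S (e i) (e j) = (if i = j then 1 else 0)"
  shows "sqn S (\<lambda>z. \<Sum>j\<in>J. c j * e j z) = (\<Sum>j\<in>J. (cmod (c j))\<^sup>2)"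
proof -
  let ?s = "\<lambda>z. \<Sum>j\<in>J. c j * e j z"
  have s: "?s \<in> bergman_space S" using S e by (intro bergman_space_sum bergman_space_cmult)
  have "bergman_inner S (e i) ?s = cnj (c i)" if "i \<in> J" for i
  proof -
    have "bergman_inner S ?s (e i) = (\<Sum>j\<in>J. c j * (if j = i then 1 else 0))"
      using that S e by (simp add: bergman_inner_sum_left orth cong: sum.cong)
    also have "\<dots> = c i" using J that by (simp add: if_distrib[of "\<lambda>x. _ * x"] cong: if_cong)
    finally show ?thesis using bergman_inner_cnj[of S "e i" ?s] by simp
  qed
  then have "of_real (sqn S ?s) = (\<Sum>j\<in>J. c j * cnj (c j))"
    unfolding bergman_inner_self[symmetric] using bergman_inner_sum_left[OF S e s, where I = J and c = c] by simp
  also have "\<dots> = of_real (\<Sum>j\<in>J. (cmod (c j))\<^sup>2)"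
    by (simp only: complex_norm_square[symmetric] of_real_sum)
  finally show ?thesis using of_real_eq_iff by blast
qed

lemma Bessel:
  assumes S: "open S" and J: "finite J" and e: "\<And>i. i \<in> J \<Longrightarrow> e i \<in> bergman_space S"
    and orth: "\<And>i j. i \<in> J \<Longrightarrow> j \<in> J \<Longrightarrow> bergman_inner S (e i) (e j) = (if i = j then 1 else 0)"
    and h: "h \<in> bergman_space S"
  shows "(\<Sum>j\<in>J. (cmod (bergman_inner S h (e j)))\<^sup>2) \<le> sqn S h"
proof -
  let ?c = "\<lambda>j. bergman_inner S h (e j)"
  let ?s = "\<lambda>z. \<Sum>j\<in>J. ?c j * e j z"
  have s: "?s \<in> bergman_space S" using S e by (intro bergman_space_sum bergman_space_cmult)
  have "bergman_inner S ?s h = (\<Sum>j\<in>J. ?c j * cnj (?c j))"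
    using bergman_inner_sum_left[OF S e h, where I = J and c = ?c] bergman_inner_cnj[of S _ h] by simp
  also have "\<dots> = of_real (\<Sum>j\<in>J. (cmod (?c j))\<^sup>2)"
    by (simp only: complex_norm_square[symmetric] of_real_sum)
  finally have i: "bergman_inner S h ?s = of_real (\<Sum>j\<in>J. (cmod (?c j))\<^sup>2)"
    using bergman_inner_cnj[of S h ?s] by simp
  have ss: "sqn S ?s = (\<Sum>j\<in>J. (cmod (?c j))\<^sup>2)"
    by (rule sqn_orthonormal_sum[OF S J e orth])
  have "0 \<le> sqn S (\<lambda>z. h z + (- 1) * ?s z)" by (rule sqn_nonneg)
  also have "\<dots> = sqn S h - (\<Sum>j\<in>J. (cmod (?c j))\<^sup>2)"
    unfolding sqn_add_cmult[OF S h s] i ss by simp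
  finally show ?thesis by simp
qed

lemma set_integral_subset_mono:
  fixes f :: "'a \<Rightarrow> real"
  assumes "set_integrable M T f" "S \<in> sets M" "S \<subseteq> T" "\<And>x. x \<in> T \<Longrightarrow> 0 \<le> f x"
  shows "(LINT x:S|M. f x) \<le> (LINT x:T|M. f x)"
  unfolding set_lebesgue_integral_def
proof (rule integral_mono)
  show "integrable M (\<lambda>x. indicator S x *\<^sub>R f x)" "integrable M (\<lambda>x. indicator T x *\<^sub>R f x)"
    using assms(1) set_integrable_subset[OF assms(1-3)] by (auto simp: set_integrable_def)
qed (use assms in \<open>auto simp: indicator_def\<close>)

text \<open>The circle mean is applied to the square of h, which is again holomorphic: its mean
  value identity expresses the squared value at w, times the volume, as an integral over the ball,
  and absolute values finish.\<close>

lemma bergman_ball_eval: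
  fixes h :: "complex ^ 'n \<Rightarrow> complex"
  assumes S: "open S" and h: "h \<in> bergman_space S" and \<delta>: "\<delta> > 0" "ball w \<delta> \<subseteq> S"
  shows "(cmod (h w))\<^sup>2 * measure lborel (ball (0 :: complex ^ 'n) \<delta>) \<le> sqn S h"
proof -
  let ?B = "ball (0 :: complex ^ 'n) \<delta>"
  have hol: "hol_on h S" and int: "set_integrable lborel S (\<lambda>z. (cmod (h z))\<^sup>2)"
    using h by (auto simp: bergman_space_def)
  have cont: "continuous_on S h" using hol by (rule hol_on_continuous)
  have intw: "set_integrable lborel (ball w \<delta>) (\<lambda>z. (h z)\<^sup>2)"
  proof (rule set_integrable_bound)
    show "set_integrable lborel (ball w \<delta>) (\<lambda>z. (cmod (h z))\<^sup>2)"
      using int \<delta> by (rule_tac set_integrable_subset) auto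
    show "set_borel_measurable lborel (ball w \<delta>) (\<lambda>z. (h z)\<^sup>2)"
      using continuous_on_subset[OF cont \<delta>(2)] by (intro set_borel_measurable_cont continuous_intros) auto
  qed (auto simp: norm_power)
  have sh: "indicator (ball w \<delta>) (w + u) = (indicator ?B u :: real)" for u
    by (simp add: indicator_def dist_norm)
  have int0: "set_integrable lborel ?B (\<lambda>u. (h (w + u))\<^sup>2)"
    and eq0: "(LINT u:?B|lborel. (cmod (h (w + u)))\<^sup>2) = (LINT z:ball w \<delta>|lborel. (cmod (h z))\<^sup>2)"
  proof -
    let ?f = "\<lambda>z. indicator (ball w \<delta>) z *\<^sub>R (h z)\<^sup>2"
    have f: "integrable lborel ?f" using intw by (simp add: set_integrable_def)
    have "integrable (distr lborel borel ((+) w)) ?f" using f by (simp add: lborel_distr_plus)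
    then have "integrable lborel (\<lambda>u. ?f (w + u))"
      using f by (subst (asm) integrable_distr_eq) auto
    then show "set_integrable lborel ?B (\<lambda>u. (h (w + u))\<^sup>2)" by (simp add: set_integrable_def sh)
    have "(LINT z|lborel. norm (?f z)) = (LINT z|distr lborel borel ((+) w). norm (?f z))"
      by (simp add: lborel_distr_plus)
    also have "\<dots> = (LINT u|lborel. norm (?f (w + u)))"
      using borel_measurable_integrable[OF integrable_norm[OF f]] by (intro integral_distr) simp_all
    finally show "(LINT u:?B|lborel. (cmod (h (w + u)))\<^sup>2) = (LINT z:ball w \<delta>|lborel. (cmod (h z))\<^sup>2)"
      by (simp add: set_lebesgue_integral_def sh norm_power abs_of_nonneg)
  qed
  have "(LINT z:?B|lborel. (h w)\<^sup>2) = (LINT u:?B|lborel. (h (w + u))\<^sup>2)"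
  proof (rule set_integral_circle_mean(2)[OF _ _ int0])
    fix u assume u: "u \<in> ?B"
    have "(\<lambda>\<mu>. (h (w + \<mu> *s u))\<^sup>2) holomorphic_on {\<mu>. w + \<mu> *s u \<in> S}"
      using hol_on_slice[OF hol] unfolding slice_hol_def by (intro holomorphic_intros) auto
    moreover have "cball 0 1 \<subseteq> {\<mu>. w + \<mu> *s u \<in> S}"
    proof
      fix \<mu> :: complex assume "\<mu> \<in> cball 0 1"
      then have "norm (\<mu> *s u) \<le> 1 * norm u" unfolding norm_cscale by (intro mult_right_mono) auto
      then have "w + \<mu> *s u \<in> ball w \<delta>" using u by (simp add: dist_norm)
      then show "\<mu> \<in> {\<mu>. w + \<mu> *s u \<in> S}" using \<delta> by blast
    qed
    ultimately show "(LINT t:{0..2*pi}|lborel. (h (w + cis t *s u))\<^sup>2) = (2 * pi) *\<^sub>R (h w)\<^sup>2"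
      using circle_mean_holomorphic[OF _ open_slice[OF S], of "\<lambda>\<mu>. (h (w + \<mu> *s u))\<^sup>2" w u] by simp
  qed (auto simp: norm_cscale)
  moreover have "(LINT z:?B|lborel. (h w)\<^sup>2) = of_real (measure lborel (ball (0 :: complex ^ 'n) \<delta>)) * (h w)\<^sup>2"
    by (subst set_integral_const) (use emeasure_lborel_ball_finite[of "0 :: complex ^ 'n" \<delta>] in \<open>auto simp: scaleR_conv_of_real\<close>)
  ultimately have "measure lborel (ball (0 :: complex ^ 'n) \<delta>) * (cmod (h w))\<^sup>2 = cmod (LINT u:?B|lborel. (h (w + u))\<^sup>2)"
    by (metis abs_of_nonneg measure_nonneg norm_mult norm_of_real norm_power)
  also have "\<dots> \<le> (LINT u:?B|lborel. cmod ((h (w + u))\<^sup>2))"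
    by (rule set_integral_norm_bound[OF int0])
  also have "\<dots> = (LINT z:ball w \<delta>|lborel. (cmod (h z))\<^sup>2)" using eq0 by (simp add: norm_power)
  also have "\<dots> \<le> sqn S h"
    unfolding sqn_def using int \<delta> by (intro set_integral_subset_mono) auto
  finally show ?thesis by (simp add: mult.commute)
qed

subsection \<open>The reproducing kernel of a shell\<close>

context shell
begin

text \<open>The Bergman space of the shell with every function replaced by its extension to
  \<open>\<Omega>\<close>. Integrability is still over the shell, and \<open>sqn A\<close> remains
  the squared norm.\<close>

definition hspace :: "(complex ^ 'n \<Rightarrow> complex) set" where
  "hspace = {h. hol_on h \<Omega> \<and> set_integrable lborel A (\<lambda>z. (cmod (h z))\<^sup>2)}"

lemma hspaceD: "h \<in> hspace \<Longrightarrow> hol_on h \<Omega>" "h \<in> hspace \<Longrightarrow> h \<in> bergman_space A"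
  by (auto simp: hspace_def bergman_space_def intro: hol_on_subset)

lemma hspaceI: "hol_on h \<Omega> \<Longrightarrow> h \<in> bergman_space A \<Longrightarrow> h \<in> hspace"
  by (auto simp: hspace_def bergman_space_def)

lemma hspace_cmult: "f \<in> hspace \<Longrightarrow> (\<lambda>z. c * f z) \<in> hspace"
  by (rule hspaceI) (auto intro!: hol_on_cmult bergman_space_cmult open_A dest: hspaceD)

lemma hspace_add: "f \<in> hspace \<Longrightarrow> g \<in> hspace \<Longrightarrow> (\<lambda>z. f z + g z) \<in> hspace"
  by (rule hspaceI) (auto intro!: hol_on_add bergman_space_add open_A dest: hspaceD)

lemma hspace_diff: "f \<in> hspace \<Longrightarrow> g \<in> hspace \<Longrightarrow> (\<lambda>z. f z - g z) \<in> hspace"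
  by (rule hspaceI) (auto intro!: hol_on_diff bergman_space_diff open_A dest: hspaceD)

lemma hspace_sum: "(\<And>i. i \<in> I \<Longrightarrow> f i \<in> hspace) \<Longrightarrow> (\<lambda>z. \<Sum>i\<in>I. f i z) \<in> hspace"
  by (rule hspaceI) (auto intro!: hol_on_sum bergman_space_sum open_A dest: hspaceD)

lemma A_borel: "A \<in> sets borel" using open_A by simp

text \<open>Evaluation is bounded by the norm over the shell even at points of the hole: the maximum
  principle on the line through 0 passes to core points, around which a ball of radius \<delta> lies
  in the shell. The constant is the reciprocal volume of that ball.\<close>

lemma hspace_eval:
  assumes "z0 \<in> \<Omega>"
  obtains e M where "e > 0" "M \<ge> 0" "ball z0 e \<subseteq> \<Omega>"
    "\<And>h z. h \<in> hspace \<Longrightarrow> z \<in> ball z0 e \<Longrightarrow> (cmod (h z))\<^sup>2 \<le> M * sqn A h"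
proof -
  obtain e \<delta> where e: "e > 0" "\<delta> > 0" "ball z0 e \<subseteq> \<Omega>"
    "\<And>z. z \<in> ball z0 e \<Longrightarrow> z \<noteq> 0 \<Longrightarrow> \<exists>r\<ge>1. r *\<^sub>R z \<in> core \<delta>"
    using local_core[OF assms] by blast
  define v where "v = measure lborel (ball (0 :: complex ^ 'n) \<delta>)"
  have v: "v > 0" unfolding v_def by (rule content_ball_pos[OF e(2)])
  have core_eval: "cmod (h w) \<le> sqrt (sqn A h / v)" if h: "h \<in> hspace" and w: "w \<in> core \<delta>" for h w
  proof -
    have "(cmod (h w))\<^sup>2 * v \<le> sqn A h"
      unfolding v_def using w e(2) by (intro bergman_ball_eval open_A hspaceD(2)[OF h]) (auto simp: core_def)
    then show ?thesis using v by (intro real_le_rsqrt) (simp add: field_simps)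
  qed
  have line: "cmod (h (\<mu> *s z)) \<le> sqrt (sqn A h / v)"
    if h: "h \<in> hspace" and z: "z \<in> ball z0 e" "z \<noteq> 0" and \<mu>: "cmod \<mu> \<le> 1" for h z \<mu>
  proof -
    from e(4)[OF z] obtain r where r: "r \<ge> 1" "r *\<^sub>R z \<in> core \<delta>" by blast
    show ?thesis
    proof (rule max_principle_ray[OF hspaceD(1)[OF h] r(1)])
      show "r *\<^sub>R z \<in> \<Omega>" using r(2) core_sub e(2) by blast
      show "cmod (h (\<xi> *s z)) \<le> sqrt (sqn A h / v)" if "cmod \<xi> = r" for \<xi>
        using r that by (intro core_eval h circle_core[of r]) auto
    qed (use \<mu> r in auto)
  qed
  have "(cmod (h z))\<^sup>2 \<le> (1 / v) * sqn A h" if h: "h \<in> hspace" and z: "z \<in> ball z0 e" for h z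
  proof -
    have "cmod (h z) \<le> sqrt (sqn A h / v)"
    proof (cases "z = 0")
      case True
      obtain w where w: "w \<in> ball z0 e" "w \<noteq> 0" using ex_nonzero[of "ball z0 e"] z True by auto
      show ?thesis using line[OF h w, of 0] True by simp
    next
      case False
      show ?thesis using line[OF h z False, of 1] by simp
    qed
    then have "(cmod (h z))\<^sup>2 \<le> (sqrt (sqn A h / v))\<^sup>2" by (intro power_mono) auto
    then show ?thesis using v sqn_nonneg[of A h] by simp
  qed
  then show thesis using e v by (intro that[of e "1 / v"]) auto
qed

text \<open>Riesz--Fischer: locally uniform convergence follows from the boundedness of point evaluations,
  and square integrability of the limit from Fatou's lemma.\<close>

lemma riesz_fischer:
  fixes e :: "nat \<Rightarrow> complex ^ 'n \<Rightarrow> complex"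
  assumes e: "\<And>j. e j \<in> hspace"
    and orth: "\<And>i j. bergman_inner A (e i) (e j) = (if i = j then 1 else 0)"
    and c: "summable (\<lambda>j. (cmod (c j))\<^sup>2)"
  obtains g where "g \<in> hspace" "\<And>z. z \<in> \<Omega> \<Longrightarrow> (\<lambda>j. c j * e j z) sums g z"
    "\<And>h. h \<in> hspace \<Longrightarrow> (\<lambda>j. c j * bergman_inner A (e j) h) sums bergman_inner A g h"
proof -
  define s where "s = (\<lambda>n z. \<Sum>j<n. c j * e j z)"
  \<comment> \<open>Tail sums, which by orthonormality bound the squared norms of differences of
    partial sums.\<close>
  define T where "T = (\<lambda>n. \<Sum>j. (cmod (c (j + n)))\<^sup>2)"
  have sH: "s n \<in> hspace" for n unfolding s_def by (intro hspace_sum hspace_cmult e)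
  have eB: "e j \<in> bergman_space A" for j by (rule hspaceD(2)[OF e])
  have T0: "T \<longlonglongrightarrow> 0" unfolding T_def by (rule suminf_exist_split2[OF c])
  have cn: "summable (\<lambda>j. (cmod (c (j + n)))\<^sup>2)" for n by (rule summable_ignore_initial_segment[OF c])
  have T_nonneg: "T n \<ge> 0" for n unfolding T_def by (intro suminf_nonneg cn) auto
  have diff: "s m z - s n z = (\<Sum>j\<in>{n..<m}. c j * e j z)" if "n \<le> m" for m n z
    unfolding s_def using that
    by (metis (no_types, lifting) atLeast0LessThan sum_diff_nat_ivl zero_le)
  have sqn_diff: "sqn A (\<lambda>z. s m z - s n z) \<le> T n" if "n \<le> m" for m n
  proof -
    have "sqn A (\<lambda>z. s m z - s n z) = (\<Sum>j\<in>{n..<m}. (cmod (c j))\<^sup>2)"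
      unfolding diff[OF that] by (rule sqn_orthonormal_sum) (auto simp: orth intro: open_A eB)
    also have "\<dots> = (\<Sum>j<m - n. (cmod (c (j + n)))\<^sup>2)"
      using that sum.shift_bounds_nat_ivl[of "\<lambda>j. (cmod (c j))\<^sup>2" 0 n "m - n"]
      by (simp add: atLeast0LessThan)
    also have "\<dots> \<le> T n" unfolding T_def by (rule sum_le_suminf[OF cn]) auto
    finally show ?thesis .
  qed
  define g where "g = (\<lambda>z. lim (\<lambda>n. s n z))"
  have loc: "\<exists>r>0. \<exists>M\<ge>0. ball z0 r \<subseteq> \<Omega> \<and> (\<forall>z\<in>ball z0 r. (\<lambda>n. s n z) \<longlonglongrightarrow> g z
      \<and> (\<forall>n. cmod (g z - s n z) \<le> sqrt (M * T n)))" if "z0 \<in> \<Omega>" for z0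
  proof -
    from hspace_eval[OF that] obtain r M where r: "r > 0" "M \<ge> 0" "ball z0 r \<subseteq> \<Omega>"
      "\<And>h z. h \<in> hspace \<Longrightarrow> z \<in> ball z0 r \<Longrightarrow> (cmod (h z))\<^sup>2 \<le> M * sqn A h" by metis
    have mn: "cmod (s m z - s n z) \<le> sqrt (M * T n)" if z: "z \<in> ball z0 r" and "n \<le> m" for z m n
    proof -
      have "(cmod (s m z - s n z))\<^sup>2 \<le> M * sqn A (\<lambda>z. s m z - s n z)"
        using r(4)[OF hspace_diff[OF sH sH] z] .
      also have "\<dots> \<le> M * T n" using r(2) sqn_diff[OF \<open>n \<le> m\<close>] by (intro mult_left_mono)
      finally show ?thesis by (rule real_le_rsqrt)
    qed
    have lim0: "(\<lambda>n. sqrt (M * T n)) \<longlonglongrightarrow> 0"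
      using tendsto_real_sqrt[OF tendsto_mult[OF tendsto_const T0, of M]] by simp
    have conv: "(\<lambda>n. s n z) \<longlonglongrightarrow> g z" if z: "z \<in> ball z0 r" for z
    proof -
      have "Cauchy (\<lambda>n. s n z)"
      proof (rule CauchyI)
        fix \<epsilon> :: real assume "\<epsilon> > 0"
        then have "\<forall>\<^sub>F n in sequentially. sqrt (M * T n) < \<epsilon>" using lim0 by (rule order_tendstoD(2)[rotated])
        then obtain N where N: "\<And>n. n \<ge> N \<Longrightarrow> sqrt (M * T n) < \<epsilon>" by (auto simp: eventually_sequentially)
        have "cmod (s m z - s n z) < \<epsilon>" if "m \<ge> N" "n \<ge> N" for m n
        proof (cases "n \<le> m")
          case True
          then show ?thesis using mn[OF z True] N[OF that(2)] by simp
        next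
          case False
          then have "m \<le> n" by simp
          then show ?thesis using mn[OF z \<open>m \<le> n\<close>] N[OF that(1)] norm_minus_commute[of "s m z" "s n z"] by simp
        qed
        then show "\<exists>M. \<forall>m\<ge>M. \<forall>n\<ge>M. cmod (s m z - s n z) < \<epsilon>" by blast
      qed
      then show ?thesis unfolding g_def using Cauchy_convergent_iff convergent_LIMSEQ_iff by blast
    qed
    have "cmod (g z - s n z) \<le> sqrt (M * T n)" if z: "z \<in> ball z0 r" for z n
    proof (rule LIMSEQ_le_const2)
      show "(\<lambda>m. cmod (s m z - s n z)) \<longlonglongrightarrow> cmod (g z - s n z)"
        by (intro tendsto_intros conv z)
      show "\<exists>N. \<forall>m\<ge>N. cmod (s m z - s n z) \<le> sqrt (M * T n)" using mn[OF z] by blast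
    qed
    then show ?thesis using r conv by blast
  qed
  have conv: "(\<lambda>n. s n z) \<longlonglongrightarrow> g z" if "z \<in> \<Omega>" for z
    using loc[OF that] by (metis centre_in_ball)
  have holg: "hol_on g \<Omega>"
  proof (rule hol_onI[OF open_\<Omega>])
    show "loc_bdd g \<Omega>"
      unfolding loc_bdd_def
    proof
      fix a assume "a \<in> \<Omega>"
      from loc[OF this] obtain r M where r: "r > 0" "\<And>z n. z \<in> ball a r \<Longrightarrow> cmod (g z - s n z) \<le> sqrt (M * T n)"
        by metis
      have "cmod (g z) \<le> sqrt (M * T 0)" if "z \<in> ball a r" for z
        using r(2)[OF that, of 0] by (simp add: s_def)
      then show "\<exists>e>0. \<exists>M. \<forall>z\<in>ball a e. cmod (g z) \<le> M" using r(1) by blast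
    qed
    show "slice_hol g \<Omega>"
    proof (rule slice_holI[OF open_\<Omega>])
      fix a v :: "complex ^ 'n" assume "a \<in> \<Omega>"
      from loc[OF this] obtain r M where r: "r > 0" "ball a r \<subseteq> \<Omega>"
        "\<And>z n. z \<in> ball a r \<Longrightarrow> cmod (g z - s n z) \<le> sqrt (M * T n)" by metis
      have lim0: "(\<lambda>n. sqrt (M * T n)) \<longlonglongrightarrow> 0"
        using tendsto_real_sqrt[OF tendsto_mult[OF tendsto_const T0, of M]] by simp
      define d where "d = r / (2 * (norm v + 1))"
      have d: "d > 0" using r(1) by (simp add: d_def add_nonneg_pos)
      have inb: "a + \<mu> *s v \<in> ball a r" if "\<mu> \<in> cball 0 d" for \<mu>
      proof -
        have "norm (\<mu> *s v) \<le> d * norm v" unfolding norm_cscale using that by (intro mult_right_mono) auto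
        also have "\<dots> < d * (2 * (norm v + 1))" using d by (intro mult_strict_left_mono) (simp_all add: add_pos_nonneg add.commute add_strict_increasing)
        also have "\<dots> = r" by (simp add: d_def add_nonneg_pos add_nonneg_eq_0_iff)
        finally show ?thesis by (simp add: dist_norm)
      qed
      have "uniform_limit (cball 0 d) (\<lambda>n \<mu>. s n (a + \<mu> *s v)) (\<lambda>\<mu>. g (a + \<mu> *s v)) sequentially"
      proof (rule uniform_limitI)
        fix \<epsilon> :: real assume "\<epsilon> > 0"
        then have "\<forall>\<^sub>F n in sequentially. sqrt (M * T n) < \<epsilon>" using lim0 by (rule order_tendstoD(2)[rotated])
        then show "\<forall>\<^sub>F n in sequentially. \<forall>\<mu>\<in>cball 0 d. dist (s n (a + \<mu> *s v)) (g (a + \<mu> *s v)) < \<epsilon>"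
        proof eventually_elim
          case (elim n)
          have "dist (s n (a + \<mu> *s v)) (g (a + \<mu> *s v)) < \<epsilon>" if "\<mu> \<in> cball 0 d" for \<mu>
            using r(3)[OF inb[OF that], of n] elim by (simp add: dist_norm norm_minus_commute)
          then show ?case by blast
        qed
      qed
      moreover have "\<forall>\<^sub>F n in sequentially. continuous_on (cball 0 d) (\<lambda>\<mu>. s n (a + \<mu> *s v)) \<and>
          (\<lambda>\<mu>. s n (a + \<mu> *s v)) holomorphic_on ball 0 d"
      proof (intro always_eventually allI)
        fix n
        have "cball 0 d \<subseteq> {\<mu>. a + \<mu> *s v \<in> \<Omega>}" using inb r(2) by blast
        then have "(\<lambda>\<mu>. s n (a + \<mu> *s v)) holomorphic_on cball 0 d"
          using hol_on_slice[OF hspaceD(1)[OF sH], unfolded slice_hol_def, rule_format]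
          by (rule holomorphic_on_subset[rotated])
        then show "continuous_on (cball 0 d) (\<lambda>\<mu>. s n (a + \<mu> *s v)) \<and>
          (\<lambda>\<mu>. s n (a + \<mu> *s v)) holomorphic_on ball 0 d"
          using holomorphic_on_imp_continuous_on ball_subset_cball holomorphic_on_subset by blast
      qed
      ultimately have "(\<lambda>\<mu>. g (a + \<mu> *s v)) holomorphic_on ball 0 d"
        by (rule_tac holomorphic_uniform_limit[of 0 d "\<lambda>n \<mu>. s n (a + \<mu> *s v)"]) auto
      then show "\<exists>e>0. (\<lambda>\<mu>. g (a + \<mu> *s v)) holomorphic_on ball 0 e" using d by blast
    qed
  qed
  \<comment> \<open>The index m tends to infinity for fixed n. The case n = 0, where
    \<open>s 0\<close> is zero, gives square integrability of g itself.\<close>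
  have fatou: "set_integrable lborel A (\<lambda>z. (cmod (g z - s n z))\<^sup>2) \<and> sqn A (\<lambda>z. g z - s n z) \<le> T n" for n
  proof -
    let ?u = "\<lambda>m z. indicator A z * (cmod (s m z - s n z))\<^sup>2"
    let ?v = "\<lambda>z. indicator A z * (cmod (g z - s n z))\<^sup>2"
    have cont: "continuous_on A (\<lambda>z. s m z - s n z)" "continuous_on A (\<lambda>z. g z - s n z)" for m
      by (rule hol_on_continuous[OF hol_on_subset[OF hol_on_diff[OF hspaceD(1)[OF sH] hspaceD(1)[OF sH]] Diff_subset]],
        rule hol_on_continuous[OF hol_on_subset[OF hol_on_diff[OF holg hspaceD(1)[OF sH]] Diff_subset]])
    have mu: "?u m \<in> borel_measurable lborel" for m
      using set_borel_measurable_cont[OF A_borel continuous_on_power[OF continuous_on_norm[OF cont(1)]], of m 2]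
      by (simp add: set_borel_measurable_def)
    have mv: "?v \<in> borel_measurable lborel"
      using set_borel_measurable_cont[OF A_borel continuous_on_power[OF continuous_on_norm[OF cont(2)]], of 2]
      by (simp add: set_borel_measurable_def)
    have lim: "liminf (\<lambda>m. ennreal (?u m z)) = ennreal (?v z)" for z
    proof (rule lim_imp_Liminf)
      show "(\<lambda>m. ennreal (?u m z)) \<longlonglongrightarrow> ennreal (?v z)"
        using conv[of z] by (cases "z \<in> A") (auto intro!: tendsto_intros tendsto_ennrealI)
    qed simp
    have le: "(\<integral>\<^sup>+z. ennreal (?u m z) \<partial>lborel) \<le> ennreal (T n)" if "m \<ge> n" for m
    proof -
      have "integrable lborel (?u m)"
        using hspaceD(2)[OF hspace_diff[OF sH sH]] by (simp add: bergman_space_def set_integrable_def)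
      then have "(\<integral>\<^sup>+z. ennreal (?u m z) \<partial>lborel) = ennreal (sqn A (\<lambda>z. s m z - s n z))"
        by (subst nn_integral_eq_integral) (auto simp: sqn_def set_lebesgue_integral_def)
      then show ?thesis using sqn_diff[OF that] by (simp add: ennreal_leI)
    qed
    have "(\<integral>\<^sup>+z. ennreal (?v z) \<partial>lborel) = (\<integral>\<^sup>+z. liminf (\<lambda>m. ennreal (?u m z)) \<partial>lborel)"
      by (simp only: lim)
    also have "\<dots> \<le> liminf (\<lambda>m. \<integral>\<^sup>+z. ennreal (?u m z) \<partial>lborel)"
      by (intro nn_integral_liminf measurable_compose[OF mu] measurable_ennreal)
    also have "\<dots> \<le> limsup (\<lambda>m. \<integral>\<^sup>+z. ennreal (?u m z) \<partial>lborel)"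
      by (rule Liminf_le_Limsup) simp
    also have "\<dots> \<le> ennreal (T n)"
      by (rule Limsup_bounded) (use le in \<open>auto simp: eventually_sequentially\<close>)
    finally have fin: "(\<integral>\<^sup>+z. ennreal (?v z) \<partial>lborel) \<le> ennreal (T n)" .
    have "integrable lborel ?v"
    proof (rule integrableI_bounded[OF mv])
      have "(\<integral>\<^sup>+z. ennreal (norm (?v z)) \<partial>lborel) = (\<integral>\<^sup>+z. ennreal (?v z) \<partial>lborel)"
        by (intro nn_integral_cong) simp
      also have "\<dots> < \<infinity>" using fin by (simp add: le_less_trans[OF _ ennreal_less_top])
      finally show "(\<integral>\<^sup>+z. ennreal (norm (?v z)) \<partial>lborel) < \<infinity>" .
    qed
    moreover have "sqn A (\<lambda>z. g z - s n z) \<le> T n"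
      using integral_real_bounded[OF T_nonneg fin] by (simp add: sqn_def set_lebesgue_integral_def)
    ultimately show ?thesis by (simp add: set_integrable_def)
  qed
  have gH: "g \<in> hspace"
    using fatou[of 0] holg by (simp add: hspace_def s_def)
  have weak: "(\<lambda>j. c j * bergman_inner A (e j) h) sums bergman_inner A g h" if h: "h \<in> hspace" for h
  proof -
    have sn: "bergman_inner A (s n) h = (\<Sum>j<n. c j * bergman_inner A (e j) h)" for n
      unfolding s_def by (rule bergman_inner_sum_left[OF open_A eB hspaceD(2)[OF h]])
    have bound: "cmod (bergman_inner A g h - bergman_inner A (s n) h) \<le> sqrt (T n * sqn A h)" for n
    proof -
      have "(cmod (bergman_inner A g h - bergman_inner A (s n) h))\<^sup>2
          = (cmod (bergman_inner A (\<lambda>z. g z - s n z) h))\<^sup>2"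
        using bergman_inner_diff_left[OF open_A hspaceD(2)[OF gH] hspaceD(2)[OF sH] hspaceD(2)[OF h]] by simp
      also have "\<dots> \<le> sqn A (\<lambda>z. g z - s n z) * sqn A h"
        by (intro bergman_Cauchy_Schwarz open_A hspaceD(2) hspace_diff gH sH h)
      also have "\<dots> \<le> T n * sqn A h" using fatou[of n] sqn_nonneg by (intro mult_right_mono) auto
      finally show ?thesis by (rule real_le_rsqrt)
    qed
    have "(\<lambda>n. sqrt (T n * sqn A h)) \<longlonglongrightarrow> 0"
      using tendsto_real_sqrt[OF tendsto_mult[OF T0 tendsto_const, of "sqn A h"]] by simp
    then have "(\<lambda>n. bergman_inner A g h - bergman_inner A (s n) h) \<longlonglongrightarrow> 0"
      by (rule Lim_null_comparison[rotated]) (use bound in auto)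
    then have "(\<lambda>n. bergman_inner A g h - (bergman_inner A g h - bergman_inner A (s n) h)) \<longlonglongrightarrow> bergman_inner A g h - 0"
      by (intro tendsto_diff tendsto_const)
    then show ?thesis by (simp add: sums_def sn)
  qed
  show thesis
    by (rule that[OF gH _ weak]) (use conv in \<open>auto simp: sums_def s_def\<close>)
qed

lemma hol_extension:
  assumes "f \<in> bergman_space A"
  shows "hol_extension A \<Omega> f \<in> hspace" "\<And>z. z \<in> A \<Longrightarrow> hol_extension A \<Omega> f z = f z"
proof -
  have f: "hol_on f A" "set_integrable lborel A (\<lambda>z. (cmod (f z))\<^sup>2)"
    using assms by (auto simp: bergman_space_def)
  from hartogs_extension[OF f(1)] have "\<exists>g. hol_on g \<Omega> \<and> (\<forall>z\<in>A. g z = f z)" by metis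
  from someI_ex[OF this] have E: "hol_on (hol_extension A \<Omega> f) \<Omega>" "\<forall>z\<in>A. hol_extension A \<Omega> f z = f z"
    unfolding hol_extension_def by auto
  then show "\<And>z. z \<in> A \<Longrightarrow> hol_extension A \<Omega> f z = f z" by blast
  have "set_integrable lborel A (\<lambda>z. (cmod (hol_extension A \<Omega> f z))\<^sup>2) =
      set_integrable lborel A (\<lambda>z. (cmod (f z))\<^sup>2)"
    using E(2) by (intro set_integrable_cong) auto
  then show "hol_extension A \<Omega> f \<in> hspace" using E(1) f(2) by (simp add: hspace_def)
qed

text \<open>k is the kernel with second argument z, as a function of the first. Then k z is its
  squared norm, which is the diagonal value.\<close>

definition reproducing :: "complex ^ 'n \<Rightarrow> (complex ^ 'n \<Rightarrow> complex) \<Rightarrow> bool" where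
  "reproducing z k \<longleftrightarrow> k \<in> hspace \<and> (\<forall>h\<in>hspace. bergman_inner A h k = h z)"

lemma reproducing_sqn: "reproducing z k \<Longrightarrow> k z = of_real (sqn A k)"
  unfolding reproducing_def by (metis bergman_inner_self)

lemma reproducing_unique:
  assumes "reproducing z k" "reproducing z k'" shows "sqn A k = sqn A k'"
proof -
  have "bergman_inner A k k' = k z" "bergman_inner A k' k = k' z"
    using assms by (auto simp: reproducing_def)
  then have "k z = cnj (k' z)" using bergman_inner_cnj[of A k k'] by simp
  then have "complex_of_real (sqn A k) = of_real (sqn A k')"
    unfolding reproducing_sqn[OF assms(1)] reproducing_sqn[OF assms(2)] by simp
  then show ?thesis using of_real_eq_iff by blast
qed

text \<open>k is the sum of cnj (E j z) times E j, convergent because evaluation at z is bounded.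
  Completeness identifies h with its Fourier series on the shell, \<open>hol_unique\<close> carries
  this to z, and so k reproduces. Hence the sum of squares does not depend on the basis.\<close>

lemma onb_reproducing:
  assumes onb: "complete_onb A e" and z: "z \<in> \<Omega>"
  obtains k where "reproducing z k" "(\<lambda>j. (cmod (hol_extension A \<Omega> (e j) z))\<^sup>2) sums sqn A k"
proof -
  define E where "E = (\<lambda>j. hol_extension A \<Omega> (e j))"
  have eB: "e j \<in> bergman_space A" for j using onb by (simp add: complete_onb_def)
  have EH: "E j \<in> hspace" and Ee: "\<And>z. z \<in> A \<Longrightarrow> E j z = e j z" for j
    using hol_extension[OF eB] by (auto simp: E_def)
  have EB: "E j \<in> bergman_space A" for j by (rule hspaceD(2)[OF EH])
  have orth: "bergman_inner A (E i) (E j) = (if i = j then 1 else 0)" for i j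
  proof -
    have "bergman_inner A (E i) (E j) = bergman_inner A (e i) (e j)"
      by (rule bergman_inner_cong[OF A_borel Ee Ee])
    then show ?thesis using onb by (simp add: complete_onb_def)
  qed
  obtain M where M0: "M \<ge> 0" and M: "\<And>h. h \<in> hspace \<Longrightarrow> (cmod (h z))\<^sup>2 \<le> M * sqn A h"
    using hspace_eval[OF z] by (metis centre_in_ball)
  \<comment> \<open>The evaluation bound is tested on the partial sum itself: its value at z and its
    squared norm are both t, so t^2 <= M t.\<close>
  have part: "(\<Sum>j<n. (cmod (E j z))\<^sup>2) \<le> M" for n
  proof -
    let ?t = "\<Sum>j<n. (cmod (E j z))\<^sup>2"
    let ?h = "\<lambda>w. \<Sum>j<n. cnj (E j z) * E j w"
    have "?h z = of_real ?t"
      by (simp only: complex_norm_square of_real_sum mult.commute[of "cnj _"])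
    moreover have "sqn A ?h = (\<Sum>j<n. (cmod (cnj (E j z)))\<^sup>2)"
      by (rule sqn_orthonormal_sum[OF open_A _ EB orth]) auto
    then have "sqn A ?h = ?t" by simp
    moreover have "?h \<in> hspace" by (intro hspace_sum hspace_cmult EH)
    ultimately have "(cmod (of_real ?t))\<^sup>2 \<le> M * ?t" using M[of ?h] by (simp only:)
    then have "?t\<^sup>2 \<le> M * ?t" unfolding norm_of_real by simp
    moreover have "?t \<ge> 0" by (intro sum_nonneg) auto
    ultimately show "?t \<le> M" using M0 by (cases "?t = 0") (auto simp: power2_eq_square)
  qed
  have sm: "summable (\<lambda>j. (cmod (E j z))\<^sup>2)"
    by (rule summableI_nonneg_bounded[of _ M]) (use part in auto)
  then have smc: "summable (\<lambda>j. (cmod (cnj (E j z)))\<^sup>2)" by simp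
  obtain k where k: "k \<in> hspace"
    "\<And>w. w \<in> \<Omega> \<Longrightarrow> (\<lambda>j. cnj (E j z) * E j w) sums k w"
    "\<And>h. h \<in> hspace \<Longrightarrow> (\<lambda>j. cnj (E j z) * bergman_inner A (E j) h) sums bergman_inner A k h"
    by (rule riesz_fischer[of E "\<lambda>j. cnj (E j z)", OF EH orth smc]) (rule that)
  have rep: "bergman_inner A h k = h z" if h: "h \<in> hspace" for h
  proof -
    define a where "a = (\<lambda>j. bergman_inner A h (E j))"
    have hB: "h \<in> bergman_space A" by (rule hspaceD(2)[OF h])
    have sma: "summable (\<lambda>j. (cmod (a j))\<^sup>2)"
    proof (rule summableI_nonneg_bounded[of _ "sqn A h"])
      show "(\<Sum>j<n. (cmod (a j))\<^sup>2) \<le> sqn A h" for n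
        unfolding a_def by (rule Bessel[OF open_A _ EB orth hB]) auto
    qed auto
    obtain g where g: "g \<in> hspace"
      "\<And>w. w \<in> \<Omega> \<Longrightarrow> (\<lambda>j. a j * E j w) sums g w"
      "\<And>h. h \<in> hspace \<Longrightarrow> (\<lambda>j. a j * bergman_inner A (E j) h) sums bergman_inner A g h"
      by (rule riesz_fischer[of E a, OF EH orth sma]) (rule that)
    have gi: "bergman_inner A g (E i) = a i" for i
    proof -
      have "(\<lambda>j. a j * bergman_inner A (E j) (E i)) sums a i"
        using sums_If_finite_set[of "{i}" a] unfolding orth
        by (simp add: if_distrib[of "\<lambda>x. _ * x"] cong: if_cong)
      then show ?thesis using g(3)[OF EH] sums_unique2 by blast
    qed
    have "bergman_inner A (\<lambda>w. h w - g w) (e j) = 0" for j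
    proof -
      have "bergman_inner A (\<lambda>w. h w - g w) (e j) = bergman_inner A (\<lambda>w. h w - g w) (E j)"
        using Ee by (intro bergman_inner_cong A_borel) auto
      also have "\<dots> = 0"
        using bergman_inner_diff_left[OF open_A hB hspaceD(2)[OF g(1)] EB] gi by (simp add: a_def)
      finally show ?thesis .
    qed
    then have "h w - g w = 0" if "w \<in> A" for w
      using onb hspaceD(2)[OF hspace_diff[OF h g(1)]] that unfolding complete_onb_def by blast
    then have "h z - g z = 0" by (rule hol_unique[OF hspaceD(1)[OF hspace_diff[OF h g(1)]]]) (use z in auto)
    then have "(\<lambda>j. a j * E j z) sums h z" using g(2)[OF z] by simp
    then have s: "(\<lambda>j. cnj (a j * E j z)) sums cnj (h z)" by (rule sums_cnj[THEN iffD2])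
    have eq: "cnj (a j * E j z) = cnj (E j z) * bergman_inner A (E j) h" for j
      using bergman_inner_cnj[of A "E j" h] by (simp add: a_def)
    have "bergman_inner A k h = cnj (h z)" by (rule sums_unique2[OF k(3)[OF h] s[unfolded eq]])
    then show ?thesis using bergman_inner_cnj[of A h k] by simp
  qed
  have repk: "reproducing z k" using k(1) rep by (simp add: reproducing_def)
  have "(\<lambda>j. of_real ((cmod (E j z))\<^sup>2)) sums k z"
    using k(2)[OF z] by (simp only: complex_norm_square mult.commute[of "cnj _"])
  then have "(\<lambda>j. (cmod (E j z))\<^sup>2) sums sqn A k"
    unfolding reproducing_sqn[OF repk] by (simp only: sums_of_real_iff)
  then show thesis using that repk by (simp add: E_def)
qed

section \<open>Existence of a complete orthonormal basis, and the extremal property of the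
  kernel\<close>

lemma finite_measure_A: "emeasure lborel A < \<infinity>"
  using bounded_\<Omega> by (intro emeasure_bounded_finite) (meson Diff_subset bounded_subset)

lemma hspace_bounded:
  assumes h: "hol_on h \<Omega>" and B: "\<And>z. z \<in> \<Omega> \<Longrightarrow> cmod (h z) \<le> B"
  shows "h \<in> hspace"
  unfolding hspace_def mem_Collect_eq
proof
  show "set_integrable lborel A (\<lambda>z. (cmod (h z))\<^sup>2)"
  proof (rule set_integrable_bound)
    show "set_integrable lborel A (\<lambda>z. B\<^sup>2)"
      unfolding set_integrable_def using finite_measure_A A_borel
      by (intro integrable_scaleR_left integrable_real_indicator) auto
    have "continuous_on A h" by (rule hol_on_continuous[OF hol_on_subset[OF h Diff_subset]])
    then show "set_borel_measurable lborel A (\<lambda>z. (cmod (h z))\<^sup>2)"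
      by (intro set_borel_measurable_cont A_borel continuous_on_power continuous_on_norm)
    have "(cmod (h z))\<^sup>2 \<le> B\<^sup>2" if "z \<in> A" for z
      using B[of z] that by (intro power_mono) auto
    then show "AE z in lborel. z \<in> A \<longrightarrow> norm ((cmod (h z))\<^sup>2) \<le> norm (B\<^sup>2)"
      by (intro AE_I2) simp
  qed
qed (rule h)

lemma sqn_one: "sqn A (\<lambda>z. 1) = measure lborel A"
  unfolding sqn_def using A_borel finite_measure_A by (simp add: set_integral_const)

lemma bergman_eval_A:
  assumes "w \<in> A"
  obtains M where "M > 0" "\<And>h. h \<in> bergman_space A \<Longrightarrow> (cmod (h w))\<^sup>2 \<le> M * sqn A h"
proof -
  obtain \<delta> where \<delta>: "\<delta> > 0" "ball w \<delta> \<subseteq> A" using assms open_A open_contains_ball by blast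
  define v where "v = measure lborel (ball (0 :: complex ^ 'n) \<delta>)"
  have v: "v > 0" unfolding v_def by (rule content_ball_pos[OF \<delta>(1)])
  have "(cmod (h w))\<^sup>2 \<le> (1 / v) * sqn A h" if "h \<in> bergman_space A" for h
    using bergman_ball_eval[OF open_A that \<delta>] v by (simp add: v_def field_simps)
  then show thesis using v by (intro that[of "1 / v"]) auto
qed

lemma sqn_eq_0:
  assumes "h \<in> bergman_space A" "sqn A h = 0" "w \<in> A" shows "h w = 0"
proof -
  obtain M where "(cmod (h w))\<^sup>2 \<le> M * sqn A h" using bergman_eval_A[OF assms(3)] assms(1) by metis
  then show ?thesis using assms(2) by simp
qed

text \<open>At a fixed point w the evaluation bound limits the sums of |f w|^2 over finite subsets,
  so only countably many members are nonzero at w. Every member is nonzero on a nonempty open set,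
  hence at some point of a countable dense set.\<close>

lemma orthonormal_countable:
  assumes SB: "S \<subseteq> bergman_space A"
    and orth: "\<And>f g. f \<in> S \<Longrightarrow> g \<in> S \<Longrightarrow> bergman_inner A f g = (if f = g then 1 else 0)"
  shows "countable S"
proof -
  have cw: "countable {f \<in> S. f w \<noteq> 0}" if w: "w \<in> A" for w
  proof -
    obtain M where M: "M > 0" "\<And>h. h \<in> bergman_space A \<Longrightarrow> (cmod (h w))\<^sup>2 \<le> M * sqn A h"
      using bergman_eval_A[OF w] by metis
    have part: "(\<Sum>f\<in>F. (cmod (f w))\<^sup>2) \<le> M" if F: "F \<subseteq> S" "finite F" for F
    proof -
      let ?t = "\<Sum>f\<in>F. (cmod (f w))\<^sup>2"
      let ?h = "\<lambda>v. \<Sum>f\<in>F. cnj (f w) * f v"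
      have "?h w = of_real ?t"
        by (simp only: complex_norm_square of_real_sum mult.commute[of "cnj _"])
      moreover have "sqn A ?h = (\<Sum>f\<in>F. (cmod (cnj (f w)))\<^sup>2)"
        using F SB by (intro sqn_orthonormal_sum[OF open_A F(2)] orth) auto
      then have "sqn A ?h = ?t" by simp
      moreover have "?h \<in> bergman_space A"
        using F SB by (intro bergman_space_sum bergman_space_cmult open_A) auto
      ultimately have "(cmod (of_real ?t))\<^sup>2 \<le> M * ?t" using M(2)[of ?h] by (simp only:)
      then have "?t\<^sup>2 \<le> M * ?t" unfolding norm_of_real by simp
      moreover have "?t \<ge> 0" by (intro sum_nonneg) auto
      ultimately show "?t \<le> M" using M(1) by (cases "?t = 0") (auto simp: power2_eq_square)
    qed
    have "finite {f \<in> S. (cmod (f w))\<^sup>2 > 1 / real (Suc n)}" (is "finite ?X") for n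
    proof (rule ccontr)
      assume inf: "infinite ?X"
      obtain m where m: "real m > M * real (Suc n)" using reals_Archimedean2 by blast
      obtain F where F: "F \<subseteq> ?X" "finite F" "card F = m" using infinite_arbitrarily_large[OF inf] by blast
      have "real m * (1 / real (Suc n)) = (\<Sum>f\<in>F. 1 / real (Suc n))" using F by simp
      also have "\<dots> \<le> (\<Sum>f\<in>F. (cmod (f w))\<^sup>2)" using F by (intro sum_mono) auto
      also have "\<dots> \<le> M" using F by (intro part) auto
      finally have "real m \<le> M * real (Suc n)" by (simp add: field_simps)
      then show False using m by simp
    qed
    then have "countable (\<Union>n. {f \<in> S. (cmod (f w))\<^sup>2 > 1 / real (Suc n)})"
      by (intro countable_UN) (auto intro: countable_finite)
    moreover have "{f \<in> S. f w \<noteq> 0} \<subseteq> (\<Union>n. {f \<in> S. (cmod (f w))\<^sup>2 > 1 / real (Suc n)})"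
    proof
      fix f assume f: "f \<in> {f \<in> S. f w \<noteq> 0}"
      then obtain n where "1 / real (Suc n) < (cmod (f w))\<^sup>2" using nat_approx_posE[of "(cmod (f w))\<^sup>2"] by auto
      then show "f \<in> (\<Union>n. {f \<in> S. (cmod (f w))\<^sup>2 > 1 / real (Suc n)})" using f by blast
    qed
    ultimately show ?thesis using countable_subset by blast
  qed
  obtain D :: "(complex ^ 'n) set" where D: "countable D" "\<And>X. open X \<Longrightarrow> X \<noteq> {} \<Longrightarrow> \<exists>d\<in>D. d \<in> X"
    using countable_dense_setE by blast
  have "S \<subseteq> (\<Union>d\<in>D \<inter> A. {f \<in> S. f d \<noteq> 0})"
  proof
    fix f assume f: "f \<in> S"
    then have fB: "f \<in> bergman_space A" using SB by blast
    have "\<exists>w\<in>A. f w \<noteq> 0"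
    proof (rule ccontr)
      assume "\<not> ?thesis"
      then have "bergman_inner A f f = bergman_inner A (\<lambda>_. 0) f" by (intro bergman_inner_cong A_borel) auto
      also have "\<dots> = 0" by (simp add: bergman_inner_def)
      finally show False using orth[OF f f] by simp
    qed
    moreover have "open {w \<in> A. f w \<noteq> 0}"
    proof -
      have "continuous_on A f" using fB by (auto simp: bergman_space_def intro: hol_on_continuous)
      then have "open (A \<inter> f -` (- {0}))" using open_A by (intro continuous_open_preimage) auto
      moreover have "A \<inter> f -` (- {0}) = {w \<in> A. f w \<noteq> 0}" by auto
      ultimately show ?thesis by simp
    qed
    ultimately obtain d where "d \<in> D" "d \<in> {w \<in> A. f w \<noteq> 0}" using D(2)[of "{w \<in> A. f w \<noteq> 0}"] by blast
    then show "f \<in> (\<Union>d\<in>D \<inter> A. {f \<in> S. f d \<noteq> 0})" using f by blast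
  qed
  moreover have "countable (\<Union>d\<in>D \<inter> A. {f \<in> S. f d \<noteq> 0})"
    using D(1) cw by (intro countable_UN) auto
  ultimately show ?thesis using countable_subset by blast
qed

text \<open>Rotation by the angle pi / (k - l) multiplies the integrand by -1 and preserves the
  integral.\<close>

lemma monomials_orthogonal:
  assumes "k \<noteq> l"
  shows "bergman_inner A (\<lambda>z. (z $ i) ^ k) (\<lambda>z. (z $ i) ^ l) = 0"
proof -
  define g where "g = (\<lambda>z. indicator A z *\<^sub>R ((z $ i) ^ k * cnj ((z $ i) ^ l)))"
  define t where "t = pi / (real k - real l)"
  have "(real k - real l) * t = pi" using assms by (simp add: t_def)
  have c: "cis t ^ k * cnj (cis t ^ l) = -1"
  proof -
    have "cis t ^ k * cnj (cis t ^ l) = cis (real k * t) * cis (- (real l * t))"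
      by (simp only: Complex.DeMoivre cis_cnj)
    also have "\<dots> = cis ((real k - real l) * t)" by (simp add: cis_mult algebra_simps)
    also have "\<dots> = -1" unfolding \<open>(real k - real l) * t = pi\<close> by simp
    finally show ?thesis .
  qed
  have "g (cis t *s z) = (cis t ^ k * cnj (cis t ^ l)) * g z" for z
  proof -
    have "indicator A (cis t *s z) = (indicator A z :: real)" using rot_A[of "cis t" z] by (simp add: indicator_def)
    then show ?thesis
      unfolding g_def by (simp only: vector_smult_component power_mult_distrib complex_cnj_mult scaleR_conv_of_real)
        (simp add: ac_simps)
  qed
  then have "integral\<^sup>L lborel g = (LINT z|lborel. (- 1) * g z)"
    using integral_rotation(1)[of "cis t" g] unfolding c by simp
  then have "integral\<^sup>L lborel g = 0" by (simp add: equal_neg_zero)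
  then show ?thesis by (simp add: g_def bergman_inner_def set_lebesgue_integral_def)
qed

text \<open>Maximality excludes a unit vector orthogonal to S, so a function orthogonal to S has
  norm 0 and vanishes on the shell. S is infinite so that it can be enumerated injectively by all
  natural numbers.\<close>

lemma complete_onb_of_maximal:
  assumes SB: "S \<subseteq> bergman_space A"
    and orth: "\<And>f g. f \<in> S \<Longrightarrow> g \<in> S \<Longrightarrow> bergman_inner A f g = (if f = g then 1 else 0)"
    and iS: "infinite S"
    and max: "\<And>u. u \<in> bergman_space A \<Longrightarrow> (\<And>g. g \<in> S \<Longrightarrow> bergman_inner A u g = 0) \<Longrightarrow> bergman_inner A u u \<noteq> 1"
  shows "complete_onb A (from_nat_into S)"
proof -
  have cS: "countable S" by (rule orthonormal_countable[OF SB orth])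
  have bij: "bij_betw (from_nat_into S) UNIV S" by (rule bij_betw_from_nat_into[OF cS iS])
  have eS: "from_nat_into S j \<in> S" for j using bij by (auto simp: bij_betw_def)
  have orth': "bergman_inner A (from_nat_into S i) (from_nat_into S j) = (if i = j then 1 else 0)" for i j
    using orth[OF eS eS, of i j] bij by (auto simp: bij_betw_def inj_def)
  have compl: "f z = 0"
    if f: "f \<in> bergman_space A" and 0: "\<And>j. bergman_inner A f (from_nat_into S j) = 0" and z: "z \<in> A" for f z
  proof (rule ccontr)
    assume "f z \<noteq> 0"
    then have p: "sqn A f > 0" using sqn_eq_0[OF f _ z] sqn_nonneg[of A f] by (metis less_eq_real_def)
    define u where "u = (\<lambda>z. of_real (1 / sqrt (sqn A f)) * f z)"
    have "u \<in> bergman_space A" unfolding u_def by (rule bergman_space_cmult[OF f])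
    moreover have "bergman_inner A u u = 1"
      using p unfolding bergman_inner_self u_def sqn_cmult norm_of_real by (simp add: power_divide)
    moreover have "bergman_inner A u g = 0" if "g \<in> S" for g
    proof -
      obtain j where "g = from_nat_into S j" using bij \<open>g \<in> S\<close> by (auto simp: bij_betw_def)
      then show ?thesis unfolding u_def bergman_inner_cmult_left using 0 by simp
    qed
    ultimately show False using max by blast
  qed
  show ?thesis
    unfolding complete_onb_def using eS SB orth' compl by blast
qed

text \<open>The kernel is the number that works for every complete orthonormal basis, so it is
  determined only once a basis exists. Normalised powers of one coordinate form an infinite
  orthonormal system, and Zorn's lemma enlarges it to a maximal one.\<close>

lemma complete_onb_exists: "\<exists>e. complete_onb A e"
proof -
  define i :: 'n where "i = undefined"
  define mon where "mon = (\<lambda>k z. (z $ i) ^ k :: complex)"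
  obtain R where R: "\<And>w. w \<in> \<Omega> \<Longrightarrow> norm w \<le> R"
    using bounded_\<Omega> bounded_iff by metis
  have monH: "mon k \<in> hspace" for k
  proof (rule hspace_bounded)
    show "hol_on (mon k) \<Omega>" unfolding mon_def by (intro hol_on_power hol_on_nth)
    show "cmod (mon k z) \<le> R ^ k" if "z \<in> \<Omega>" for z
      unfolding mon_def norm_power
      using R[OF that] Finite_Cartesian_Product.norm_nth_le[of z i] by (intro power_mono) auto
  qed
  have monB: "mon k \<in> bergman_space A" for k by (rule hspaceD(2)[OF monH])
  have pos: "sqn A (mon k) > 0" for k
  proof (rule ccontr)
    assume "\<not> ?thesis"
    then have 0: "sqn A (mon k) = 0" using sqn_nonneg[of A "mon k"] by simp
    have "axis i (1::complex) \<noteq> 0" by simp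
    then obtain s where s: "s > 0" "s *\<^sub>R axis i (1::complex) \<in> A" by (rule ray_into_A)
    have "mon k (s *\<^sub>R axis i 1) = 0" by (rule sqn_eq_0[OF monB 0 s(2)])
    then show False using s(1) by (simp add: mon_def axis_def)
  qed
  define m where "m = (\<lambda>k z. of_real (1 / sqrt (sqn A (mon k))) * mon k z)"
  have mB: "m k \<in> bergman_space A" for k unfolding m_def by (intro bergman_space_cmult monB)
  have morth: "bergman_inner A (m k) (m l) = (if k = l then 1 else 0)" for k l
  proof (cases "k = l")
    case True
    have "sqn A (m k) = 1"
      using pos[of k] unfolding m_def sqn_cmult norm_of_real by (simp add: power_divide)
    then show ?thesis using True by (simp add: bergman_inner_self)
  next
    case False
    have "bergman_inner A (m k) (m l) = of_real (1 / sqrt (sqn A (mon k))) * bergman_inner A (mon k) (m l)"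
      unfolding m_def by (rule bergman_inner_cmult_left)
    also have "bergman_inner A (mon k) (m l) = cnj (of_real (1 / sqrt (sqn A (mon l))) * bergman_inner A (mon l) (mon k))"
      using bergman_inner_cnj[of A "mon k" "m l"] unfolding m_def bergman_inner_cmult_left by simp
    also have "bergman_inner A (mon l) (mon k) = 0"
      unfolding mon_def using False by (intro monomials_orthogonal) auto
    finally show ?thesis using False by simp
  qed
  have minj: "inj m"
  proof (rule injI)
    fix k l assume "m k = m l"
    then have "bergman_inner A (m k) (m l) = 1" using morth[of k k] by simp
    then show "k = l" using morth[of k l] by (metis zero_neq_one)
  qed
  \<comment> \<open>Only systems containing the monomials are compared, so that the maximal one is
    infinite.\<close>
  define on where "on = (\<lambda>S. S \<subseteq> bergman_space A \<and> range m \<subseteq> S \<and>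
      (\<forall>f\<in>S. \<forall>g\<in>S. bergman_inner A f g = (if f = g then 1 else 0)))"
  have "\<exists>S\<in>Collect on. \<forall>X\<in>Collect on. S \<subseteq> X \<longrightarrow> X = S"
  proof (rule subset_Zorn_nonempty)
    have "on (range m)" unfolding on_def using mB morth minj by (auto simp: inj_def)
    then show "Collect on \<noteq> {}" by blast
    fix C assume C: "C \<noteq> {}" "subset.chain (Collect on) C"
    then have C1: "\<And>S. S \<in> C \<Longrightarrow> on S" and C2: "\<And>S T. S \<in> C \<Longrightarrow> T \<in> C \<Longrightarrow> S \<subseteq> T \<or> T \<subseteq> S"
      by (auto simp: subset_chain_def)
    have "bergman_inner A f g = (if f = g then 1 else 0)" if fg: "f \<in> \<Union>C" "g \<in> \<Union>C" for f g
    proof -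
      from fg obtain S T where ST: "S \<in> C" "f \<in> S" "T \<in> C" "g \<in> T" by blast
      from C2[OF ST(1,3)] obtain V where "V \<in> C" "f \<in> V" "g \<in> V" using ST by blast
      then show ?thesis using C1[of V] by (simp add: on_def)
    qed
    moreover have "\<Union>C \<subseteq> bergman_space A" "range m \<subseteq> \<Union>C"
      using C1 C(1) unfolding on_def by blast+
    ultimately show "\<Union>C \<in> Collect on" by (simp add: on_def)
  qed
  then obtain S where S: "on S" "\<And>X. on X \<Longrightarrow> S \<subseteq> X \<Longrightarrow> X = S" by blast
  have SB: "S \<subseteq> bergman_space A" and mS: "range m \<subseteq> S"
    and orth: "\<And>f g. f \<in> S \<Longrightarrow> g \<in> S \<Longrightarrow> bergman_inner A f g = (if f = g then 1 else 0)"
    using S(1) by (auto simp: on_def)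
  have iS: "infinite S"
  proof
    assume "finite S"
    then have "finite (range m)" using mS finite_subset by blast
    then show False using minj finite_imageD by fastforce
  qed
  show ?thesis
  proof (rule exI, rule complete_onb_of_maximal[OF SB orth iS])
    fix u assume u: "u \<in> bergman_space A" "\<And>g. g \<in> S \<Longrightarrow> bergman_inner A u g = 0"
    show "bergman_inner A u u \<noteq> 1"
    proof
      assume uu: "bergman_inner A u u = 1"
      have gu: "bergman_inner A g u = 0" if "g \<in> S" for g
        using u(2)[OF that] bergman_inner_cnj[of A g u] by simp
      have "u \<notin> S" using u(2)[of u] uu by auto
      have "bergman_inner A f g = (if f = g then 1 else 0)" if "f \<in> insert u S" "g \<in> insert u S" for f g
        using that orth[of f g] u(2)[of g] gu[of f] uu \<open>u \<notin> S\<close>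
        by (cases "f = u"; cases "g = u") auto
      then have "on (insert u S)"
        unfolding on_def using SB mS u(1) by blast
      then have "insert u S = S" by (rule S(2)) auto
      then show False using \<open>u \<notin> S\<close> by blast
    qed
  qed
qed

abbreviation K :: "complex ^ 'n \<Rightarrow> real" where "K z \<equiv> bergman_kernel_ext A \<Omega> z"

lemma kernel_exists:
  assumes z: "z \<in> \<Omega>"
  obtains k where "reproducing z k" "sqn A k = K z"
proof -
  obtain e where "complete_onb A e" using complete_onb_exists by blast
  then obtain k where k: "reproducing z k" using onb_reproducing z by metis
  have sums: "(\<lambda>j. (cmod (hol_extension A \<Omega> (e j) z))\<^sup>2) sums sqn A k" if "complete_onb A e" for e
    using onb_reproducing[OF that z] reproducing_unique[OF k] by metis
  have "K z = sqn A k"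
    unfolding bergman_kernel_ext_def
  proof (rule the_equality)
    fix x assume "\<forall>e. complete_onb A e \<longrightarrow> (\<lambda>j. (cmod (hol_extension A \<Omega> (e j) z))\<^sup>2) sums x"
    then show "x = sqn A k" using sums \<open>complete_onb A e\<close> sums_unique2 by blast
  qed (use sums in blast)
  then show thesis using that k by simp
qed

lemma kernel_eval:
  assumes z: "z \<in> \<Omega>" and h: "h \<in> hspace"
  shows "(cmod (h z))\<^sup>2 \<le> K z * sqn A h"
proof -
  obtain k where k: "reproducing z k" "sqn A k = K z" using kernel_exists[OF z] .
  have "(cmod (bergman_inner A h k))\<^sup>2 \<le> sqn A h * sqn A k"
    using k(1) h by (intro bergman_Cauchy_Schwarz open_A hspaceD(2)) (auto simp: reproducing_def)
  then show ?thesis using k h by (simp add: reproducing_def mult.commute)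
qed

lemma hspace_one: "(\<lambda>z. 1) \<in> hspace"
  by (rule hspace_bounded[of _ 1]) (auto intro: hol_on_const)

lemma kernel_lower: "z \<in> \<Omega> \<Longrightarrow> 1 \<le> K z * measure lborel A"
  using kernel_eval[OF _ hspace_one, of z] by (simp add: sqn_one)

lemma kernel_pos: "z \<in> \<Omega> \<Longrightarrow> K z > 0"
  using kernel_lower[of z] measure_nonneg[of lborel A]
  by (metis mult_nonneg_nonpos2 not_le order_less_le_trans zero_less_one mult.commute)

text \<open>The function realising the extremal characterisation of the kernel; its value at the origin is
  determined by pairing it with the constant function \<open>1\<close>.\<close>

lemma extremal_function:
  assumes z: "z \<in> \<Omega>"
  obtains f where "f \<in> hspace" "sqn A f = 1" "f z = of_real (sqrt (K z))"
    "\<And>g. g \<in> hspace \<Longrightarrow> bergman_inner A g f = g z / of_real (sqrt (K z))"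
proof -
  obtain k where k: "reproducing z k" "sqn A k = K z" using kernel_exists[OF z] .
  have p: "K z > 0" by (rule kernel_pos[OF z])
  define f where "f = (\<lambda>w. of_real (1 / sqrt (K z)) * k w)"
  have kH: "k \<in> hspace" using k by (simp add: reproducing_def)
  show thesis
  proof (rule that[of f])
    show "f \<in> hspace" unfolding f_def by (rule hspace_cmult[OF kH])
    show "sqn A f = 1" unfolding f_def sqn_cmult norm_of_real k(2) using p by (simp add: power_divide)
    have "f z = of_real (1 / sqrt (K z) * K z)" using reproducing_sqn[OF k(1)] k(2) by (simp add: f_def)
    also have "1 / sqrt (K z) * K z = sqrt (K z)" using p by (simp add: real_div_sqrt)
    finally show "f z = of_real (sqrt (K z))" .
    fix g assume g: "g \<in> hspace"
    have "bergman_inner A g f = cnj (of_real (1 / sqrt (K z)) * bergman_inner A k g)"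
      using bergman_inner_cnj[of A g f] unfolding f_def bergman_inner_cmult_left by simp
    also have "bergman_inner A k g = cnj (g z)"
      using bergman_inner_cnj[of A k g] k(1) g by (simp add: reproducing_def)
    finally show "bergman_inner A g f = g z / of_real (sqrt (K z))" by simp
  qed
qed

end

subsection \<open>Jensen's inequality and Parseval's identity on circles\<close>

text \<open>Real trigonometric polynomials, represented on the circle as real parts of polynomials
  in w alone. This turns the approximants of the Stone-Weierstrass theorem, polynomials in Re w and
  Im w, into data for the maximum principle.\<close>

definition trig_re :: "(complex \<Rightarrow> real) \<Rightarrow> bool" where
  "trig_re g \<longleftrightarrow> (\<exists>p. \<forall>w. cmod w = 1 \<longrightarrow> g w = Re (poly p w))"

lemma trig_re_add: "trig_re f \<Longrightarrow> trig_re g \<Longrightarrow> trig_re (\<lambda>w. f w + g w)"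
  unfolding trig_re_def by (metis plus_complex.simps(1) poly_add)

lemma trig_re_const: "trig_re (\<lambda>w. c)"
  unfolding trig_re_def by (intro exI[of _ "[:of_real c:]"]) simp

lemma trig_re_sum: "(\<And>i. i \<in> I \<Longrightarrow> trig_re (f i)) \<Longrightarrow> trig_re (\<lambda>w. \<Sum>i\<in>I. f i w)"
  by (induction I rule: infinite_finite_induct) (auto intro: trig_re_const trig_re_add)

text \<open>Re x Re y = Re (x y + x cnj y) / 2, and on the unit circle w^i cnj (w^j) = w^(i - j),
  where j <= i keeps the exponent natural.\<close>

lemma trig_re_monom_le:
  assumes "j \<le> i" shows "trig_re (\<lambda>w. Re (a * w ^ i) * Re (b * w ^ j))"
  unfolding trig_re_def
proof (intro exI allI impI)
  fix w :: complex assume w: "cmod w = 1"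
  have ww: "w * cnj w = 1" using complex_norm_square[of w] w by simp
  have "w ^ i * cnj (w ^ j) = w ^ (i - j) * (w * cnj w) ^ j"
    using assms by (simp add: power_mult_distrib mult.assoc[symmetric] power_add[symmetric])
  then have p: "w ^ i * cnj (w ^ j) = w ^ (i - j)" using ww by simp
  have q: "Re x * Re y = Re (x * y / 2 + x * cnj y / 2)" for x y
    by (simp add: field_simps)
  have "Re (a * w ^ i) * Re (b * w ^ j) = Re ((a * w ^ i) * (b * w ^ j) / 2 + (a * w ^ i) * cnj (b * w ^ j) / 2)"
    by (rule q)
  also have "(a * w ^ i) * (b * w ^ j) = a * b * w ^ (i + j)" by (simp add: power_add)
  also have "(a * w ^ i) * cnj (b * w ^ j) = a * cnj b * (w ^ i * cnj (w ^ j))"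
    by (simp only: complex_cnj_mult ac_simps)
  also have "\<dots> = a * cnj b * w ^ (i - j)" by (simp only: p)
  finally show "Re (a * w ^ i) * Re (b * w ^ j) = Re (poly (monom (a * b / 2) (i + j) + monom (a * cnj b / 2) (i - j)) w)"
    by (simp add: poly_monom)
qed

lemma trig_re_mult:
  assumes "trig_re f" "trig_re g" shows "trig_re (\<lambda>w. f w * g w)"
proof -
  obtain p q where p: "\<And>w. cmod w = 1 \<Longrightarrow> f w = Re (poly p w)" and q: "\<And>w. cmod w = 1 \<Longrightarrow> g w = Re (poly q w)"
    using assms by (auto simp: trig_re_def)
  have "trig_re (\<lambda>w. Re (a * w ^ i) * Re (b * w ^ j))" for a b i j
    using trig_re_monom_le[of j i a b] trig_re_monom_le[of i j b a]
    by (cases "j \<le> i") (simp_all add: mult.commute)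
  then have "trig_re (\<lambda>w. \<Sum>i\<le>degree p. \<Sum>j\<le>degree q. Re (coeff p i * w ^ i) * Re (coeff q j * w ^ j))"
    by (intro trig_re_sum)
  then obtain s where s: "(\<Sum>i\<le>degree p. \<Sum>j\<le>degree q. Re (coeff p i * w ^ i) * Re (coeff q j * w ^ j)) = Re (poly s w)"
    if "cmod w = 1" for w
    unfolding trig_re_def by blast
  have "f w * g w = (\<Sum>i\<le>degree p. \<Sum>j\<le>degree q. Re (coeff p i * w ^ i) * Re (coeff q j * w ^ j))"
    if "cmod w = 1" for w
    unfolding p[OF that] q[OF that] by (simp add: poly_altdef sum_product)
  then show ?thesis unfolding trig_re_def using s by (intro exI[of _ s]) simp
qed

lemma real_polynomial_trig_re: "real_polynomial_function g \<Longrightarrow> trig_re g"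
proof (induction g rule: real_polynomial_function.induct)
  case (linear f)
  interpret bounded_linear f by fact
  have "f w = Re (poly [:0, of_real (f 1) - \<i> * of_real (f \<i>):] w)" for w
  proof -
    have "f w = f (Re w *\<^sub>R 1 + Im w *\<^sub>R \<i>)"
      by (rule arg_cong[of _ _ f]) (simp add: complex_eq_iff)
    also have "\<dots> = Re w * f 1 + Im w * f \<i>" by (simp only: add scaleR real_scaleR_def)
    finally show ?thesis by (simp add: algebra_simps)
  qed
  then show ?case unfolding trig_re_def by blast
qed (auto intro: trig_re_const trig_re_add trig_re_mult)

text \<open>Approximate the logarithm on the circle by the real part of a polynomial \<open>p\<close> and apply the
  maximum principle to \<open>\<phi> exp (- p)\<close>: no factorisation of the zeros of \<open>\<phi>\<close> is needed.\<close>

lemma Jensen_inequality_circle: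
  assumes \<phi>: "\<phi> holomorphic_on U" "open U" "cball 0 1 \<subseteq> U" and \<phi>0: "\<phi> 0 \<noteq> 0" and \<delta>: "\<delta> > 0"
  shows "2 * pi * ln ((cmod (\<phi> 0))\<^sup>2) \<le> (LINT t:{0..2*pi}|lborel. ln ((cmod (\<phi> (cis t)))\<^sup>2 + \<delta>))"
    and "set_integrable lborel {0..2*pi} (\<lambda>t. ln ((cmod (\<phi> (cis t)))\<^sup>2 + \<delta>))"
proof -
  \<comment> \<open>The added \<delta> keeps the logarithm finite and continuous at zeros of \<phi>
    on the circle.\<close>
  define v where "v = (\<lambda>w. ln ((cmod (\<phi> w))\<^sup>2 + \<delta>))"
  have pos: "(cmod (\<phi> w))\<^sup>2 + \<delta> > 0" for w using \<delta> by (intro add_nonneg_pos) auto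
  have "sphere 0 1 \<subseteq> U" using \<phi>(3) by auto
  then have contv: "continuous_on (sphere 0 1) v"
    unfolding v_def
    using continuous_on_subset[OF holomorphic_on_imp_continuous_on[OF \<phi>(1)], of "sphere 0 1"] pos
    by (intro continuous_intros) (auto simp: less_imp_neq[symmetric])
  have contcis: "continuous_on {0..2*pi} cis" unfolding cis_conv_exp by (intro continuous_intros)
  have int: "set_integrable lborel {0..2*pi} (\<lambda>t. f (cis t))" if "continuous_on (sphere 0 1) f" for f :: "complex \<Rightarrow> real"
    unfolding set_integrable_def
    by (intro borel_integrable_compact continuous_on_compose2[OF that contcis]) auto
  show iv: "set_integrable lborel {0..2*pi} (\<lambda>t. ln ((cmod (\<phi> (cis t)))\<^sup>2 + \<delta>))"
    using int[OF contv] by (simp add: v_def)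
  have "2 * pi * ln ((cmod (\<phi> 0))\<^sup>2) \<le> (LINT t:{0..2*pi}|lborel. v (cis t)) + \<epsilon>" if "\<epsilon> > 0" for \<epsilon>
  proof -
    \<comment> \<open>An error \<eta> occurs twice over the length 2 pi: in the maximum principle
      and in the integral.\<close>
    define \<eta> where "\<eta> = \<epsilon> / (4 * pi)"
    have \<eta>: "\<eta> > 0" using that by (simp add: \<eta>_def)
    obtain g where g: "real_polynomial_function g" "\<And>w. w \<in> sphere 0 1 \<Longrightarrow> \<bar>v w - g w\<bar> < \<eta>"
      using Stone_Weierstrass_real_polynomial_function[OF compact_sphere contv \<eta>] by blast
    then obtain p where p: "\<And>w. cmod w = 1 \<Longrightarrow> g w = Re (poly p w)"
      using real_polynomial_trig_re unfolding trig_re_def by blast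
    have vp: "\<bar>v w - Re (poly p w)\<bar> < \<eta>" if "cmod w = 1" for w
      using g(2)[of w] p[OF that] that by simp
    have holp: "poly p holomorphic_on S" for S
      unfolding poly_altdef[abs_def] by (intro holomorphic_intros)
    \<comment> \<open>Half of p, because p stands for the logarithm of the squared modulus of
      \<phi>.\<close>
    have "cmod (\<phi> 0 * exp (- poly p 0 / 2)) \<le> exp (\<eta> / 2)"
    proof (rule max_modulus_disc[where \<phi> = "\<lambda>w. \<phi> w * exp (- poly p w / 2)" and U = U and r = 1 and \<mu> = 0])
      show "(\<lambda>w. \<phi> w * exp (- poly p w / 2)) holomorphic_on U"
        by (intro holomorphic_intros \<phi>(1) holp) auto
      fix w :: complex assume w: "cmod w = 1"
      have "(cmod (\<phi> w * exp (- poly p w / 2)))\<^sup>2 = (cmod (\<phi> w))\<^sup>2 * (exp (- Re (poly p w) / 2))\<^sup>2"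
        by (simp add: norm_mult power_mult_distrib)
      also have "(exp (- Re (poly p w) / 2))\<^sup>2 = exp (- Re (poly p w))"
        by (simp flip: exp_double)
      also have "(cmod (\<phi> w))\<^sup>2 * exp (- Re (poly p w)) \<le> exp (v w) * exp (- Re (poly p w))"
        using pos[of w] \<delta> by (intro mult_right_mono) (auto simp: v_def)
      also have "\<dots> \<le> exp \<eta>" using vp[OF w] by (simp flip: exp_add) 
      also have "\<dots> = (exp (\<eta> / 2))\<^sup>2" by (simp flip: exp_double)
      finally show "cmod (\<phi> w * exp (- poly p w / 2)) \<le> exp (\<eta> / 2)"
        by (rule power2_le_imp_le) simp
    qed (use \<phi> in auto)
    then have "ln (cmod (\<phi> 0) * exp (- Re (poly p 0) / 2)) \<le> ln (exp (\<eta> / 2))"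
      using \<phi>0 by (subst ln_le_cancel_iff) (auto simp: norm_mult)
    then have "ln (cmod (\<phi> 0)) - Re (poly p 0) / 2 \<le> \<eta> / 2"
      using \<phi>0 by (simp add: ln_mult)
    then have a: "2 * pi * ln ((cmod (\<phi> 0))\<^sup>2) \<le> 2 * pi * (Re (poly p 0) + \<eta>)"
      using \<phi>0 by (intro mult_left_mono) (auto simp: ln_realpow)
    have cp: "continuous_on (sphere 0 1) (\<lambda>w. Re (poly p w))" by (intro continuous_intros)
    have "(LINT t:{0..2*pi}|lborel. poly p (cis t)) = (2 * pi) *\<^sub>R poly p 0"
      by (rule circle_mean_holomorphic[OF holp[of UNIV]]) auto
    then have "2 * pi * Re (poly p 0) = Re (LINT t:{0..2*pi}|lborel. poly p (cis t))" by simp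
    also have "\<dots> = (LINT t:{0..2*pi}|lborel. Re (poly p (cis t)))"
    proof -
      have "integrable lborel (\<lambda>t. indicator {0..2*pi} t *\<^sub>R poly p (cis t))"
        by (intro borel_integrable_compact continuous_intros contcis) auto
      then have "Re (LINT t|lborel. indicator {0..2*pi} t *\<^sub>R poly p (cis t)) =
        (LINT t|lborel. Re (indicator {0..2*pi} t *\<^sub>R poly p (cis t)))" by (rule integral_Re[symmetric])
      then show ?thesis by (simp add: set_lebesgue_integral_def)
    qed
    also have "\<dots> \<le> (LINT t:{0..2*pi}|lborel. v (cis t) + \<eta>)"
    proof (rule set_integral_mono[OF int[OF cp]])
      show "set_integrable lborel {0..2*pi} (\<lambda>t. v (cis t) + \<eta>)"
        by (rule int[of "\<lambda>w. v w + \<eta>"]) (intro continuous_intros contv)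
      show "Re (poly p (cis t)) \<le> v (cis t) + \<eta>" for t using vp[of "cis t"] by simp
    qed
    also have "\<dots> = (LINT t:{0..2*pi}|lborel. v (cis t)) + 2 * pi * \<eta>"
      using int[OF contv] int[OF continuous_on_const[of _ \<eta>]]
      by (subst set_integral_add) (auto simp: set_integral_const)
    finally have "2 * pi * Re (poly p 0) \<le> (LINT t:{0..2*pi}|lborel. v (cis t)) + 2 * pi * \<eta>" .
    then show ?thesis using a by (simp add: \<eta>_def algebra_simps)
  qed
  then show "2 * pi * ln ((cmod (\<phi> 0))\<^sup>2) \<le> (LINT t:{0..2*pi}|lborel. ln ((cmod (\<phi> (cis t)))\<^sup>2 + \<delta>))"
    unfolding v_def by (rule field_le_epsilon)
qed

text \<open>The next term adds a cross term that is, on the circle, the real part of a polynomial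
  without constant term, since the exponents N - k are positive. Its circle mean is 0.\<close>

lemma circle_Parseval_finite:
  "(LINT t:{0..2*pi}|lborel. (cmod (\<Sum>k<N. b k * cis t ^ k))\<^sup>2) = 2 * pi * (\<Sum>k<N. (cmod (b k))\<^sup>2)"
proof (induction N)
  case 0
  show ?case by simp
next
  case (Suc N)
  let ?s = "\<lambda>w. \<Sum>k<N. b k * w ^ k"
  let ?q = "\<lambda>w. \<Sum>k<N. b N * cnj (b k) * w ^ (N - k)"
  have contcis: "continuous_on {0..2*pi} cis" unfolding cis_conv_exp by (intro continuous_intros)
  have int: "set_integrable lborel {0..2*pi} f" if "continuous_on {0..2*pi} f" for f :: "real \<Rightarrow> real"
    unfolding set_integrable_def by (intro borel_integrable_compact that) auto
  have e: "(cmod (\<Sum>k<Suc N. b k * cis t ^ k))\<^sup>2 = (cmod (?s (cis t)))\<^sup>2 + ((cmod (b N))\<^sup>2 + 2 * Re (?q (cis t)))" for t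
  proof -
    have w: "cis t * cnj (cis t) = 1" by (simp add: cis_cnj cis_mult)
    have "(cmod (x + y))\<^sup>2 = (cmod x)\<^sup>2 + ((cmod y)\<^sup>2 + 2 * Re (y * cnj x))" for x y
      unfolding cmod_power2 by (simp add: power2_eq_square algebra_simps)
    then have "(cmod (?s (cis t) + b N * cis t ^ N))\<^sup>2 =
       (cmod (?s (cis t)))\<^sup>2 + ((cmod (b N * cis t ^ N))\<^sup>2 + 2 * Re (b N * cis t ^ N * cnj (?s (cis t))))" .
    moreover have e2: "cmod (b N * cis t ^ N) = cmod (b N)" by (simp add: norm_mult norm_power)
    moreover have e3: "b N * cis t ^ N * cnj (?s (cis t)) = ?q (cis t)"
    proof -
      have "cis t ^ N * cnj (cis t ^ k) = cis t ^ (N - k)" if "k < N" for k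
      proof -
        have "cis t ^ N * cnj (cis t ^ k) = cis t ^ (N - k) * (cis t * cnj (cis t)) ^ k"
          using that by (simp only: complex_cnj_power power_mult_distrib mult.assoc[symmetric] power_add[symmetric]) simp
        then show ?thesis by (simp only: w) simp
      qed
      then have "b N * cnj (b k) * (cis t ^ N * cnj (cis t ^ k)) = b N * cnj (b k) * cis t ^ (N - k)" if "k < N" for k
        using that by simp
      then show ?thesis
        unfolding cnj_sum sum_distrib_left by (intro sum.cong) (simp_all only: complex_cnj_mult ac_simps lessThan_iff)
    qed
    ultimately show ?thesis unfolding sum.lessThan_Suc by (simp only: e2 e3)
  qed
  have "(LINT t:{0..2*pi}|lborel. ?q (cis t)) = (2 * pi) *\<^sub>R ?q 0"
    by (rule circle_mean_holomorphic[of _ UNIV]) (auto intro!: holomorphic_intros)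
  moreover have "?q 0 = 0" by (intro sum.neutral) auto
  ultimately have "Re (LINT t:{0..2*pi}|lborel. ?q (cis t)) = 0" by simp
  moreover have "integrable lborel (\<lambda>t. indicator {0..2*pi} t *\<^sub>R ?q (cis t))"
    by (intro borel_integrable_compact continuous_intros contcis) auto
  then have "Re (LINT t|lborel. indicator {0..2*pi} t *\<^sub>R ?q (cis t)) =
    (LINT t|lborel. Re (indicator {0..2*pi} t *\<^sub>R ?q (cis t)))" by (rule integral_Re[symmetric])
  ultimately have q0: "(LINT t:{0..2*pi}|lborel. Re (?q (cis t))) = 0"
    by (simp add: set_lebesgue_integral_def)
  have i: "set_integrable lborel {0..2*pi} (\<lambda>t. (cmod (?s (cis t)))\<^sup>2)"
    "set_integrable lborel {0..2*pi} (\<lambda>t. (cmod (b N))\<^sup>2)"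
    "set_integrable lborel {0..2*pi} (\<lambda>t. 2 * Re (?q (cis t)))"
    by (intro int continuous_intros contcis)+
  have "(LINT t:{0..2*pi}|lborel. (cmod (\<Sum>k<Suc N. b k * cis t ^ k))\<^sup>2) =
     (LINT t:{0..2*pi}|lborel. (cmod (?s (cis t)))\<^sup>2) + ((LINT t:{0..2*pi}|lborel. (cmod (b N))\<^sup>2) + (LINT t:{0..2*pi}|lborel. 2 * Re (?q (cis t))))"
    unfolding e using i by (simp only: set_integral_add)
  also have "(LINT t:{0..2*pi}|lborel. (cmod (b N))\<^sup>2) = 2 * pi * (cmod (b N))\<^sup>2"
    by (subst set_integral_const) auto
  finally show ?case using Suc q0 by (simp add: algebra_simps)
qed

text \<open>The coefficients are the squared moduli of the Taylor coefficients at 0 and do not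
  depend on r, so the circle mean becomes a power series in r with nonnegative coefficients.
  Convergence at a slightly larger radius gives absolute convergence at r and with it a dominating
  constant.\<close>

lemma circle_Parseval:
  assumes \<phi>: "\<phi> holomorphic_on ball 0 R"
  obtains a :: "nat \<Rightarrow> real" where "\<And>k. a k \<ge> 0" "a 0 = (cmod (\<phi> 0))\<^sup>2"
    "\<And>r. 0 \<le> r \<Longrightarrow> r < R \<Longrightarrow> (\<lambda>k. a k * r ^ (2 * k)) sums ((LINT t:{0..2*pi}|lborel. (cmod (\<phi> (of_real r * cis t)))\<^sup>2) / (2 * pi))"
proof -
  define c where "c = (\<lambda>k. (deriv ^^ k) \<phi> 0 / fact k)"
  have ser: "(\<lambda>k. c k * w ^ k) sums \<phi> w" if "cmod w < R" for w
    using holomorphic_power_series[OF \<phi>, of w] that by (simp add: c_def)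
  show thesis
  proof (rule that[of "\<lambda>k. (cmod (c k))\<^sup>2"])
    show "(cmod (c 0))\<^sup>2 = (cmod (\<phi> 0))\<^sup>2" by (simp add: c_def)
    fix r :: real assume r: "0 \<le> r" "r < R"
    let ?s = "\<lambda>N t. \<Sum>k<N. c k * of_real r ^ k * cis t ^ k"
    have tm: "c k * (of_real r * cis t) ^ k = c k * of_real r ^ k * cis t ^ k" for k t
      by (simp add: power_mult_distrib mult.assoc)
    have sm: "summable (\<lambda>k. cmod (c k) * r ^ k)"
    proof -
      obtain r' where r': "r < r'" "r' < R" using r dense by blast
      have "cmod (of_real r') < R" using r r' by simp
      from sums_summable[OF ser[OF this]] have "summable (\<lambda>k. c k * of_real r' ^ k)" .
      then have "summable (\<lambda>k. norm (c k * of_real r ^ k))"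
        by (rule powser_insidea) (use r r' in auto)
      then show ?thesis using r by (simp add: norm_mult norm_power)
    qed
    define B where "B = (\<Sum>k. cmod (c k) * r ^ k)"
    have bd: "cmod (?s N t) \<le> B" for N t
    proof -
      have "cmod (?s N t) \<le> (\<Sum>k<N. cmod (c k) * r ^ k)"
        using r by (intro order_trans[OF norm_sum] sum_mono) (simp add: norm_mult norm_power)
      also have "\<dots> \<le> B" unfolding B_def by (rule sum_le_suminf[OF sm]) (use r in auto)
      finally show ?thesis .
    qed
    have lim: "(\<lambda>N. ?s N t) \<longlonglongrightarrow> \<phi> (of_real r * cis t)" for t
      using ser[of "of_real r * cis t"] r unfolding sums_def tm by (simp add: norm_mult)
    have contcis: "continuous_on X cis" for X unfolding cis_conv_exp by (intro continuous_intros)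
    let ?f = "\<lambda>N t. indicator {0..2*pi} t *\<^sub>R (cmod (?s N t))\<^sup>2"
    let ?g = "\<lambda>t. indicator {0..2*pi} t *\<^sub>R (cmod (\<phi> (of_real r * cis t)))\<^sup>2"
    have "(\<lambda>N. integral\<^sup>L lborel (?f N)) \<longlonglongrightarrow> integral\<^sup>L lborel ?g"
    proof (rule integral_dominated_convergence[where w = "\<lambda>t. indicator {0..2*pi} t *\<^sub>R B\<^sup>2"])
      have "continuous_on {0..2*pi} (\<lambda>t. \<phi> (of_real r * cis t))"
        by (rule continuous_on_compose2[OF holomorphic_on_imp_continuous_on[OF \<phi>]])
          (use r in \<open>auto intro!: continuous_intros contcis simp: norm_mult\<close>)
      then show "?g \<in> borel_measurable lborel"
        by (intro borel_measurable_integrable borel_integrable_compact continuous_intros) auto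
      show "?f N \<in> borel_measurable lborel" for N
        by (intro borel_measurable_integrable borel_integrable_compact continuous_intros contcis) auto
      show "integrable lborel (\<lambda>t. indicator {0..2*pi} t *\<^sub>R B\<^sup>2)" by (intro borel_integrable_compact) auto
      show "AE t in lborel. (\<lambda>N. ?f N t) \<longlonglongrightarrow> ?g t"
        by (intro AE_I2 tendsto_intros lim)
      show "AE t in lborel. norm (?f N t) \<le> indicator {0..2*pi} t *\<^sub>R B\<^sup>2" for N
        by (intro AE_I2) (auto simp: indicator_def intro!: power_mono bd)
    qed
    moreover have "integral\<^sup>L lborel (?f N) = 2 * pi * (\<Sum>k<N. (cmod (c k))\<^sup>2 * r ^ (2 * k))" for N
    proof -
      have "(LINT t:{0..2*pi}|lborel. (cmod (?s N t))\<^sup>2) = 2 * pi * (\<Sum>k<N. (cmod (c k * of_real r ^ k))\<^sup>2)"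
        by (rule circle_Parseval_finite)
      then show ?thesis
        using r by (simp add: set_lebesgue_integral_def norm_mult norm_power power_mult_distrib power_mult[symmetric] mult.commute[of 2])
    qed
    ultimately have "(\<lambda>N. 2 * pi * (\<Sum>k<N. (cmod (c k))\<^sup>2 * r ^ (2 * k)) / (2 * pi)) \<longlonglongrightarrow>
        (LINT t:{0..2*pi}|lborel. (cmod (\<phi> (of_real r * cis t)))\<^sup>2) / (2 * pi)"
      unfolding set_lebesgue_integral_def by (intro tendsto_divide tendsto_const) auto
    then show "(\<lambda>k. (cmod (c k))\<^sup>2 * r ^ (2 * k)) sums ((LINT t:{0..2*pi}|lborel. (cmod (\<phi> (of_real r * cis t)))\<^sup>2) / (2 * pi))"
      by (simp add: sums_def)
  qed auto
qed

lemma convex_on_power_nonneg: "convex_on {0::real..} (\<lambda>x. x ^ n)"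
  using convex_power_odd[of n] convex_on_subset[OF convex_power_even[of n], of "{0..}"] by (cases "even n") auto

lemma convex_on_powser_nonneg:
  fixes a :: "nat \<Rightarrow> real"
  assumes a: "\<And>k. a k \<ge> 0" and F: "\<And>r. 0 < r \<Longrightarrow> r < R \<Longrightarrow> (\<lambda>k. a k * r ^ e k) sums F r"
  shows "convex_on {0<..<R} F" "\<And>r s. 0 < r \<Longrightarrow> r \<le> s \<Longrightarrow> s < R \<Longrightarrow> F r \<le> F s"
proof -
  show "F r \<le> F s" if "0 < r" "r \<le> s" "s < R" for r s
    using that by (intro sums_le[OF _ F F] mult_left_mono a power_mono) auto
  show "convex_on {0<..<R} F"
  proof (rule convex_onI)
    fix t x y :: real assume t: "0 < t" "t < 1" and x: "x \<in> {0<..<R}" and y: "y \<in> {0<..<R}"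
    let ?m = "(1 - t) *\<^sub>R x + t *\<^sub>R y"
    have m: "?m \<in> {0<..<R}"
      using convexD_alt[OF convex_real_interval(8) x y, of t] t by simp
    have m': "0 < ?m" "?m < R" using m by auto
    show "F ?m \<le> (1 - t) * F x + t * F y"
    proof (rule sums_le[OF _ F[OF m'] sums_add[OF sums_mult[OF F, of x "1 - t"] sums_mult[OF F, of y t]]])
      fix k
      have "?m ^ e k \<le> (1 - t) * x ^ e k + t * y ^ e k"
        using convex_onD[OF convex_on_power_nonneg[of "e k"], of t x y] t x y by simp
      then have "a k * ?m ^ e k \<le> a k * ((1 - t) * x ^ e k + t * y ^ e k)"
        by (intro mult_left_mono a)
      then show "a k * ?m ^ e k \<le> (1 - t) * (a k * x ^ e k) + t * (a k * y ^ e k)"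
        by (simp add: algebra_simps)
    qed (use x y in auto)
  qed simp
qed

text \<open>The slope is the infimum of the difference quotients to the right of x, nonnegative
  because f increases.\<close>

lemma convex_on_mono_support:
  fixes f :: "real \<Rightarrow> real"
  assumes f: "convex_on {0<..<R} f" and mono: "\<And>r s. 0 < r \<Longrightarrow> r \<le> s \<Longrightarrow> s < R \<Longrightarrow> f r \<le> f s"
    and x: "0 < x" "x < R"
  obtains \<alpha> where "\<alpha> \<ge> 0" "\<And>y. 0 < y \<Longrightarrow> y < R \<Longrightarrow> f y \<ge> f x + \<alpha> * (y - x)"
proof -
  let ?I = "{0<..<R}"
  let ?S = "(\<lambda>t. (f x - f t) / (x - t)) ` ({x<..} \<inter> ?I)"
  have "(x + R) / 2 \<in> {x<..} \<inter> ?I" using x by auto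
  then have "?S \<noteq> {}" by blast
  then have "Inf ?S \<ge> 0"
  proof (rule cInf_greatest)
    fix s assume "s \<in> ?S"
    then obtain t where t: "t > x" "t < R" "s = (f x - f t) / (x - t)" by auto
    then show "0 \<le> s" using mono[of x t] x by (auto intro!: divide_nonpos_nonpos)
  qed
  moreover have "f y \<ge> f x + Inf ?S * (y - x)" if "0 < y" "y < R" for y
    using convex_le_Inf_differential[OF f, of x y] x that by simp
  ultimately show thesis using that by blast
qed

text \<open>Convexity of powers with an explicit quadratic term. In the induction step the missing
  (y - x) x^(k + 2) comes from (y - x) (y^(k + 2) - x^(k + 2)) >= 0.\<close>

lemma power_second_order_lower:
  fixes x y :: real
  assumes "x \<ge> 0" "y \<ge> 0"
  shows "y ^ (k + 2) \<ge> x ^ (k + 2) + real (k + 2) * x ^ (k + 1) * (y - x) + x ^ k * (y - x)\<^sup>2"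
proof (induction k)
  case 0
  show ?case by (simp add: power2_eq_square algebra_simps)
next
  case (Suc k)
  have "0 \<le> (y - x) * (y ^ (k + 2) - x ^ (k + 2)) * 1"
  proof (cases "x \<le> y")
    case True
    then have "x ^ (k + 2) \<le> y ^ (k + 2)" using assms by (intro power_mono) auto
    then show ?thesis using True by (simp del: power_Suc)
  next
    case False
    then have "y ^ (k + 2) \<le> x ^ (k + 2)" using assms by (intro power_mono) auto
    then show ?thesis using False by (simp add: mult_nonpos_nonpos del: power_Suc)
  qed
  moreover have "x * (x ^ (k + 2) + real (k + 2) * x ^ (k + 1) * (y - x) + x ^ k * (y - x)\<^sup>2) \<le> x * y ^ (k + 2)"
    using Suc assms by (intro mult_left_mono) auto
  ultimately show ?case by (simp add: algebra_simps power2_eq_square)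
qed

subsection \<open>The family of shells\<close>

lemma complete_circular_closure:
  assumes "complete_circular S" shows "complete_circular (closure S)"
  unfolding complete_circular_def
proof (intro ballI allI impI)
  fix z c assume z: "z \<in> closure S" and c: "cmod c \<le> 1"
  have "(\<lambda>z. c *s z) ` closure S \<subseteq> closure S"
  proof (rule image_closure_subset)
    show "continuous_on (closure S) (\<lambda>z. c *s z)" by (intro continuous_intros)
    show "(\<lambda>z. c *s z) ` S \<subseteq> closure S"
      using assms c closure_subset[of S] by (auto simp: complete_circular_def)
  qed simp
  then show "c *s z \<in> closure S" using z by blast
qed

lemma complete_circular_shrunk:
  assumes "complete_circular S" shows "complete_circular (shrunk r S)"
  unfolding complete_circular_def
proof (intro ballI allI impI)
  fix z c assume "z \<in> shrunk r S" and c: "cmod c \<le> 1"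
  then obtain w where w: "w \<in> S" "z = r *\<^sub>R w" by (auto simp: shrunk_def)
  have "c *s z = r *\<^sub>R (c *s w)" by (simp add: w(2) vec_eq_iff)
  moreover have "c *s w \<in> S" using assms w c by (auto simp: complete_circular_def)
  ultimately show "c *s z \<in> shrunk r S" by (auto simp: shrunk_def)
qed

context shell
begin

lemma hspace_eval_compact:
  assumes "compact C" "C \<subseteq> \<Omega>"
  obtains M where "M \<ge> 0" "\<And>h z. h \<in> hspace \<Longrightarrow> z \<in> C \<Longrightarrow> (cmod (h z))\<^sup>2 \<le> M * sqn A h"
proof -
  have "\<exists>e M. e > 0 \<and> M \<ge> 0 \<and> (\<forall>h z. h \<in> hspace \<longrightarrow> z \<in> ball z0 e \<longrightarrow> (cmod (h z))\<^sup>2 \<le> M * sqn A h)"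
    if "z0 \<in> C" for z0
    using hspace_eval[of z0] that assms by (metis subsetD)
  then obtain e M where eM: "\<And>z0. z0 \<in> C \<Longrightarrow> e z0 > 0 \<and> M z0 \<ge> 0 \<and>
      (\<forall>h z. h \<in> hspace \<longrightarrow> z \<in> ball z0 (e z0) \<longrightarrow> (cmod (h z))\<^sup>2 \<le> M z0 * sqn A h)" by metis
  have "C \<subseteq> (\<Union>z0\<in>C. ball z0 (e z0))" using eM by force
  then obtain D where D: "D \<subseteq> C" "finite D" "C \<subseteq> (\<Union>z0\<in>D. ball z0 (e z0))"
    by (rule compactE_image[OF assms(1) open_ball])
  show thesis
  proof (rule that[of "\<Sum>z0\<in>D. M z0"])
    show "0 \<le> (\<Sum>z0\<in>D. M z0)" using D eM by (intro sum_nonneg) auto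
    fix h z assume h: "h \<in> hspace" and z: "z \<in> C"
    obtain z0 where z0: "z0 \<in> D" "z \<in> ball z0 (e z0)" using D z by blast
    have "(cmod (h z))\<^sup>2 \<le> M z0 * sqn A h" using eM D z0 h by blast
    also have "\<dots> \<le> (\<Sum>z0\<in>D. M z0) * sqn A h"
      using D eM z0 by (intro mult_right_mono sqn_nonneg member_le_sum) auto
    finally show "(cmod (h z))\<^sup>2 \<le> (\<Sum>z0\<in>D. M z0) * sqn A h" .
  qed
qed

text \<open>The extremal function at z has norm 1, so near z0 it is bounded by a constant
  independent of z, and Lipschitz. Its modulus at z0 is at most the root of the kernel there. This
  one-sided comparison serves upper semicontinuity.\<close>

lemma sqrt_kernel_near:
  assumes z0: "z0 \<in> \<Omega>"
  obtains e B where "e > 0" "B > 0" "ball z0 e \<subseteq> \<Omega>"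
    "\<And>z. norm (z - z0) \<le> e / 2 \<Longrightarrow> sqrt (K z) \<le> sqrt (K z0) + B * norm (z - z0)"
proof -
  obtain e M where e: "e > 0" "M \<ge> 0" "ball z0 e \<subseteq> \<Omega>"
    "\<And>h z. h \<in> hspace \<Longrightarrow> z \<in> ball z0 e \<Longrightarrow> (cmod (h z))\<^sup>2 \<le> M * sqn A h"
    using hspace_eval[OF z0] by metis
  define B where "B = 18 * (sqrt M + 1) / e"
  have B: "B > 0" using e by (simp add: B_def add_nonneg_pos)
  have "sqrt (K z) \<le> sqrt (K z0) + B * norm (z - z0)" if z: "norm (z - z0) \<le> e / 2" for z
  proof (cases "z = z0")
    case False
    define d where "d = norm (z - z0)"
    have d: "d > 0" "d \<le> e / 2" using False z by (auto simp: d_def)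
    have zO: "z \<in> \<Omega>" using e(1,3) z by (auto simp: subset_iff dist_norm norm_minus_commute)
    obtain f where f: "f \<in> hspace" "sqn A f = 1" "f z = of_real (sqrt (K z))"
      using extremal_function[OF zO] by metis
    define u where "u = complex_of_real (e / d) *s (z - z0)"
    have nu: "norm u = e" using d e unfolding u_def norm_cscale norm_of_real by (simp add: d_def)
    have inb: "z0 + \<mu> *s u \<in> ball z0 e" if "cmod \<mu> < 1" for \<mu>
      using that nu e by (simp add: dist_norm norm_cscale)
    have hol: "(\<lambda>\<mu>. f (z0 + \<mu> *s u)) holomorphic_on ball 0 1"
      by (rule holomorphic_on_subset[OF hol_on_slice[OF hspaceD(1)[OF f(1)], unfolded slice_hol_def, rule_format]])
        (use inb e(3) in auto)
    have bd: "cmod (f (z0 + \<mu> *s u)) < sqrt M + 1" if "cmod \<mu> < 1" for \<mu>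
      using real_le_rsqrt[OF e(4)[OF f(1) inb[OF that], unfolded f(2) mult_1_right]] by simp
    let ?\<mu> = "complex_of_real (d / e)"
    have "cmod (f (z0 + ?\<mu> *s u) - f (z0 + 0 *s u)) \<le> 18 * (sqrt M + 1) * cmod ?\<mu>"
      using d e by (intro Taylor_quadratic_bound(2)[OF hol bd]) (auto simp: norm_divide divide_le_eq)
    moreover have "?\<mu> *s u = z - z0" using d e by (simp add: u_def cscale_simps(1)[symmetric])
    moreover have "cmod ?\<mu> = d / e" using d e by (simp add: norm_divide)
    ultimately have le: "cmod (f z - f z0) \<le> B * d" by (simp add: B_def)
    have "(cmod (f z0))\<^sup>2 \<le> K z0" using kernel_eval[OF z0 f(1)] f(2) by simp
    then have "cmod (f z0) \<le> sqrt (K z0)" by (rule real_le_rsqrt)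
    moreover have "sqrt (K z) = cmod (f z)"
      using kernel_pos[OF zO] unfolding f(3) norm_of_real by simp
    ultimately show ?thesis using le norm_triangle_sub[of "f z" "f z0"] by (simp add: d_def)
  qed simp
  then show thesis using that e B by blast
qed

lemma set_integral_hol_mean:
  assumes h: "hol_on h \<Omega>" and S: "S \<in> sets borel" "S \<subseteq> \<Omega>" "\<And>c z. cmod c = 1 \<Longrightarrow> z \<in> S \<Longrightarrow> c *s z \<in> S"
    and int: "set_integrable lborel S h"
  shows "(LINT z:S|lborel. h 0) = (LINT z:S|lborel. h z)"
proof (rule set_integral_circle_mean(2)[OF S(1) S(3) int])
  fix z assume z: "z \<in> S"
  have "cball 0 1 \<subseteq> {\<mu>. \<mu> *s z \<in> \<Omega>}"
    using z S(2) circ_\<Omega> by (auto simp: complete_circular_def)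
  then show "(LINT t:{0..2*pi}|lborel. h (cis t *s z)) = (2 * pi) *\<^sub>R h 0"
    using circle_mean_holomorphic[OF hol_on_line[OF h] open_line[OF open_\<Omega>], of z] by simp
qed

text \<open>0 lies in the hole, yet f 0 is the mean of f over the shell, by rotation invariance. Up
  to the volume this mean is the pairing with the function 1, whose value is given.\<close>

lemma extremal_at_origin:
  assumes f: "f \<in> hspace" and one: "bergman_inner A (\<lambda>z. 1) f = of_real (1 / sqrt (K z))"
    and z: "z \<in> \<Omega>"
  shows "cmod (f 0) * measure lborel A = 1 / sqrt (K z)"
proof -
  have "set_integrable lborel A f"
    using bergman_inner_integrable[OF open_A hspaceD(2)[OF f] hspaceD(2)[OF hspace_one]] by simp
  then have "(LINT w:A|lborel. f 0) = (LINT w:A|lborel. f w)"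
    using rot_A by (intro set_integral_hol_mean hspaceD(1)[OF f] A_borel) auto
  moreover have "(LINT w:A|lborel. f w) = of_real (1 / sqrt (K z))"
    using one bergman_inner_cnj[of A f "\<lambda>z. 1"] by (simp add: bergman_inner_def)
  moreover have "(LINT w:A|lborel. f 0) = of_real (measure lborel A) * f 0"
    using A_borel finite_measure_A by (subst set_integral_const) (auto simp: scaleR_conv_of_real)
  ultimately have "of_real (measure lborel A) * f 0 = of_real (1 / sqrt (K z))" by simp
  then have "cmod (of_real (measure lborel A) * f 0) = cmod (of_real (1 / sqrt (K z)))" by simp
  then show ?thesis
    using kernel_pos[OF z] unfolding norm_mult norm_of_real by (simp add: mult.commute)
qed

end

section \<open>One circular domain with holes of varying radius\<close>

locale ccd =
  fixes \<Omega> :: "(complex ^ 'n) set"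
  assumes card: "CARD('n) \<ge> 2" and open_\<Omega>: "open \<Omega>" and bounded_\<Omega>: "bounded \<Omega>"
    and circ_\<Omega>: "complete_circular \<Omega>" and nonempty: "\<Omega> \<noteq> {}"
begin

abbreviation V :: "(complex ^ 'n) set" where "V \<equiv> closure \<Omega>"
abbreviation Lr :: "real \<Rightarrow> (complex ^ 'n) set" where "Lr r \<equiv> shrunk r V"
abbreviation Ar :: "real \<Rightarrow> (complex ^ 'n) set" where "Ar r \<equiv> \<Omega> - Lr r"
abbreviation Kr :: "real \<Rightarrow> complex ^ 'n \<Rightarrow> real" where "Kr r z \<equiv> bergman_kernel_ext (Ar r) \<Omega> z"

text \<open>The hole has to be a compact part of \<open>\<Omega>\<close>, which r < 1 does not
  guarantee. Example: from the ball of radius 2 remove, on one complex line through 0, the points of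
  norm at least 1. The hole is then the closed ball of radius 2 r, and for r >= 1/2 it contains
  removed points.\<close>

definition adm :: "real \<Rightarrow> bool" where "adm r \<longleftrightarrow> 0 < r \<and> r < 1 \<and> Lr r \<subseteq> \<Omega>"

lemma zero_\<Omega>: "0 \<in> \<Omega>"
proof -
  obtain z where "z \<in> \<Omega>" using nonempty by blast
  then have "0 *s z \<in> \<Omega>" using circ_\<Omega> unfolding complete_circular_def by (metis norm_zero zero_le_one)
  then show ?thesis by simp
qed

lemma zero_V: "0 \<in> V" using zero_\<Omega> closure_subset by blast

lemma compact_V: "compact V" using bounded_\<Omega> by (simp add: compact_closure)

lemma circ_V: "complete_circular V" by (rule complete_circular_closure[OF circ_\<Omega>])

lemma closure_shrunk: "closure (shrunk r \<Omega>) = Lr r"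
  unfolding shrunk_def by (rule closure_scaleR[symmetric])

lemma compact_Lr: "compact (Lr r)"
  unfolding shrunk_def by (intro compact_scaling compact_V)

lemma Lr_borel: "Lr r \<in> sets borel" using compact_Lr by (simp add: borel_compact)

lemma V_borel: "V \<in> sets borel" by simp

lemma shell_r: "adm r \<Longrightarrow> shell \<Omega> (Lr r)"
proof
  assume r: "adm r"
  show "0 \<in> Lr r" using zero_V unfolding shrunk_def by (metis image_eqI scaleR_zero_right)
qed (use card open_\<Omega> bounded_\<Omega> circ_\<Omega> compact_Lr complete_circular_shrunk[OF circ_V] in \<open>auto simp: adm_def\<close>)

lemma Lr_mono:
  assumes "0 < s" "s \<le> r" shows "Lr s \<subseteq> Lr r"
proof
  fix z assume "z \<in> Lr s"
  then obtain w where w: "w \<in> V" "z = s *\<^sub>R w" by (auto simp: shrunk_def)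
  have "z = r *\<^sub>R (of_real (s / r) *s w)" using w assms by (simp add: vec_eq_iff scaleR_conv_of_real[where 'a=complex])
  moreover have "of_real (s / r) *s w \<in> V"
    using circ_V w(1) assms unfolding complete_circular_def by (metis abs_of_nonneg divide_le_eq_1 divide_nonneg_pos less_eq_real_def norm_of_real order_less_le_trans)
  ultimately show "z \<in> Lr r" by (auto simp: shrunk_def)
qed

lemma adm_mono: "adm r \<Longrightarrow> 0 < s \<Longrightarrow> s \<le> r \<Longrightarrow> adm s"
  using Lr_mono[of s r] by (auto simp: adm_def)

text \<open>A compact hole has a margin e inside \<open>\<Omega>\<close>, and raising the radius by
  e / (2 R) moves its points by at most e / 2. The room is needed because near a point an upper
  semicontinuous radius may slightly exceed its value there.\<close>

lemma adm_larger:
  assumes "adm r" obtains r' where "r' > r" "adm r'"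
proof -
  obtain e where e: "e > 0" "(\<Union>x\<in>Lr r. ball x e) \<subseteq> \<Omega>"
    using compact_subset_open_imp_ball_epsilon_subset[OF compact_Lr open_\<Omega>] assms by (auto simp: adm_def)
  obtain R where R: "R > 0" "\<And>w. w \<in> V \<Longrightarrow> norm w \<le> R"
    using compact_imp_bounded[OF compact_V] bounded_pos by metis
  define r' where "r' = min ((r + 1) / 2) (r + e / (2 * R))"
  have r: "0 < r" "r < 1" using assms by (auto simp: adm_def)
  have r'1: "r' > r" unfolding r'_def using r e R by (simp add: min_less_iff_disj)
  have r'2: "r' \<le> (r + 1) / 2" "r' \<le> r + e / (2 * R)" unfolding r'_def by (rule min.cobounded1, rule min.cobounded2)
  have "Lr r' \<subseteq> \<Omega>"
  proof
    fix z assume "z \<in> Lr r'"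
    then obtain w where w: "w \<in> V" "z = r' *\<^sub>R w" by (auto simp: shrunk_def)
    have "dist (r *\<^sub>R w) z = (r' - r) * norm w"
    proof -
      have "dist (r *\<^sub>R w) z = norm ((r - r') *\<^sub>R w)" by (simp add: dist_norm w(2) scaleR_left_diff_distrib)
      then show ?thesis using r'1 by simp
    qed
    also have "\<dots> \<le> (e / (2 * R)) * R" using r'1 r'2 R w e by (intro mult_mono) auto
    also have "\<dots> < e" using e R by simp
    finally have "z \<in> ball (r *\<^sub>R w) e" by simp
    moreover have "r *\<^sub>R w \<in> Lr r" using w by (auto simp: shrunk_def)
    ultimately show "z \<in> \<Omega>" using e(2) by blast
  qed
  then show thesis using r r'1 r'2 by (intro that[of r']) (auto simp: adm_def)
qed

lemma Lr_sub: "adm r \<Longrightarrow> Lr r \<subseteq> \<Omega>" by (simp add: adm_def)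

text \<open>The function space common to all admissible shells (see \<open>hspace_eq\<close>):
  functions holomorphic on \<open>\<Omega>\<close> are bounded on the compact hole, so only the norm
  depends on the radius. An extremal function for one radius can thus compete at another.\<close>

definition sqint_hol :: "(complex ^ 'n \<Rightarrow> complex) set" where
  "sqint_hol = {h. hol_on h \<Omega> \<and> set_integrable lborel \<Omega> (\<lambda>z. (cmod (h z))\<^sup>2)}"

lemma set_integrable_Lr:
  fixes g :: "complex ^ 'n \<Rightarrow> 'b::euclidean_space"
  assumes "adm r" "continuous_on \<Omega> g" shows "set_integrable lborel (Lr r) g"
  unfolding set_integrable_def
  by (intro borel_integrable_compact compact_Lr continuous_on_subset[OF assms(2)] Lr_sub assms(1))

lemma hspace_eq:
  assumes r: "adm r" shows "shell.hspace \<Omega> (Lr r) = sqint_hol"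
proof -
  have "set_integrable lborel (Ar r) (\<lambda>z. (cmod (h z))\<^sup>2) \<longleftrightarrow> set_integrable lborel \<Omega> (\<lambda>z. (cmod (h z))\<^sup>2)"
    if h: "hol_on h \<Omega>" for h
  proof
    assume i: "set_integrable lborel (Ar r) (\<lambda>z. (cmod (h z))\<^sup>2)"
    have "set_integrable lborel (Lr r) (\<lambda>z. (cmod (h z))\<^sup>2)"
      using hol_on_continuous[OF h] by (intro set_integrable_Lr[OF r] continuous_on_power continuous_on_norm)
    then have "set_integrable lborel (Ar r \<union> Lr r) (\<lambda>z. (cmod (h z))\<^sup>2)"
      using i Lr_borel[of r] open_\<Omega> by (intro set_integrable_Un) auto
    then show "set_integrable lborel \<Omega> (\<lambda>z. (cmod (h z))\<^sup>2)"
      using Lr_sub[OF r] by (simp add: Un_absorb2)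
  next
    assume "set_integrable lborel \<Omega> (\<lambda>z. (cmod (h z))\<^sup>2)"
    then show "set_integrable lborel (Ar r) (\<lambda>z. (cmod (h z))\<^sup>2)"
      using open_\<Omega> Lr_borel[of r] by (rule_tac set_integrable_subset) auto
  qed
  then show ?thesis unfolding shell.hspace_def[OF shell_r[OF r]] sqint_hol_def by blast
qed

lemma sqint_holD: "h \<in> sqint_hol \<Longrightarrow> hol_on h \<Omega>" "h \<in> sqint_hol \<Longrightarrow> h \<in> bergman_space \<Omega>"
  by (auto simp: sqint_hol_def bergman_space_def)

lemma sqint_hol_bergman_Ar: "adm r \<Longrightarrow> h \<in> sqint_hol \<Longrightarrow> h \<in> bergman_space (Ar r)"
  using shell.hspaceD(2)[OF shell_r] hspace_eq by blast

lemma sqn_split: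
  assumes r: "adm r" and h: "h \<in> sqint_hol"
  shows "sqn \<Omega> h = sqn (Ar r) h + sqn (Lr r) h"
proof -
  have i1: "set_integrable lborel (Ar r) (\<lambda>z. (cmod (h z))\<^sup>2)"
    using sqint_hol_bergman_Ar[OF r h] by (simp add: bergman_space_def)
  have i2: "set_integrable lborel (Lr r) (\<lambda>z. (cmod (h z))\<^sup>2)"
    using hol_on_continuous[OF sqint_holD(1)[OF h]] by (intro set_integrable_Lr[OF r] continuous_on_power continuous_on_norm)
  have "sqn (Ar r \<union> Lr r) h = sqn (Ar r) h + sqn (Lr r) h"
    unfolding sqn_def by (rule set_integral_Un[OF _ i1 i2]) auto
  then show ?thesis using Lr_sub[OF r] by (simp add: Un_absorb2)
qed

lemma measure_Lr: "r > 0 \<Longrightarrow> measure lborel (Lr r) = r ^ (2 * CARD('n)) * measure lborel V"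
proof -
  assume r: "r > 0"
  have fin: "emeasure lborel (Lr r) < \<infinity>" "emeasure lborel V < \<infinity>"
    by (intro emeasure_bounded_finite compact_imp_bounded compact_Lr compact_V)+
  have "measure lborel (Lr r) = (LINT z:Lr r|lborel. (1::real))"
    using Lr_borel fin by (simp add: set_integral_const)
  also have "\<dots> = r ^ (2 * CARD('n)) *\<^sub>R (LINT z:V|lborel. (1::real))" by (rule set_integral_shrunk(1)[OF r])
  also have "\<dots> = r ^ (2 * CARD('n)) * measure lborel V" using fin by (simp add: set_integral_const)
  finally show ?thesis .
qed

lemma measure_V_pos: "measure lborel V > 0"
proof -
  obtain e where e: "e > 0" "ball 0 e \<subseteq> \<Omega>" using open_\<Omega> zero_\<Omega> open_contains_ball by blast
  have "measure lborel (ball (0 :: complex ^ 'n) e) \<le> measure lborel V"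
    using e closure_subset[of \<Omega>] emeasure_compact_finite[OF compact_V] by (intro measure_mono_fmeasurable fmeasurableI) auto
  with content_ball_pos[OF e(1), of "0 :: complex ^ 'n"] show ?thesis by (rule less_le_trans)
qed

lemma measure_\<Omega>_pos: "measure lborel \<Omega> > 0"
proof -
  obtain e where e: "e > 0" "ball 0 e \<subseteq> \<Omega>" using open_\<Omega> zero_\<Omega> open_contains_ball by blast
  have "measure lborel (ball (0 :: complex ^ 'n) e) \<le> measure lborel \<Omega>"
    using e open_\<Omega> emeasure_bounded_finite[OF bounded_\<Omega>] by (intro measure_mono_fmeasurable fmeasurableI) auto
  with content_ball_pos[OF e(1), of "0 :: complex ^ 'n"] show ?thesis by (rule less_le_trans)
qed

lemma measure_Ar_le: "measure lborel (Ar r) \<le> measure lborel \<Omega>"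
  using open_\<Omega> Lr_borel emeasure_bounded_finite[OF bounded_\<Omega>] by (intro measure_mono_fmeasurable fmeasurableI) auto

lemma Kr_pos: "adm r \<Longrightarrow> z \<in> \<Omega> \<Longrightarrow> Kr r z > 0"
  using shell.kernel_pos[OF shell_r] .

lemma Kr_lower:
  assumes "adm r" "z \<in> \<Omega>" shows "1 / measure lborel \<Omega> \<le> Kr r z"
proof -
  have "1 \<le> Kr r z * measure lborel (Ar r)" using shell.kernel_lower[OF shell_r[OF assms(1)] assms(2)] .
  also have "\<dots> \<le> Kr r z * measure lborel \<Omega>"
    using Kr_pos[OF assms] measure_Ar_le by (intro mult_left_mono) auto
  finally show ?thesis using measure_\<Omega>_pos by (simp add: field_simps)
qed

lemma Kr_eval: "adm r \<Longrightarrow> z \<in> \<Omega> \<Longrightarrow> h \<in> sqint_hol \<Longrightarrow> (cmod (h z))\<^sup>2 \<le> Kr r z * sqn (Ar r) h"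
  using shell.kernel_eval[OF shell_r] hspace_eq by blast

lemma Kr_extremal:
  assumes "adm r" "z \<in> \<Omega>"
  obtains f where "f \<in> sqint_hol" "sqn (Ar r) f = 1" "f z = of_real (sqrt (Kr r z))"
    "\<And>g. g \<in> sqint_hol \<Longrightarrow> bergman_inner (Ar r) g f = g z / of_real (sqrt (Kr r z))"
  using shell.extremal_function[OF shell_r[OF assms(1)] assms(2)] hspace_eq[OF assms(1)] by metis

lemma sqn_Ar_antimono:
  assumes "adm r" "0 < s" "s \<le> r" "h \<in> sqint_hol" shows "sqn (Ar r) h \<le> sqn (Ar s) h"
  unfolding sqn_def
proof (rule set_integral_subset_mono)
  show "set_integrable lborel (Ar s) (\<lambda>z. (cmod (h z))\<^sup>2)"
    using sqint_hol_bergman_Ar[OF adm_mono[OF assms(1-3)] assms(4)] by (simp add: bergman_space_def)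
qed (use open_\<Omega> Lr_borel Lr_mono[OF assms(2,3)] in auto)

lemma Kr_mono:
  assumes "adm r" "0 < s" "s \<le> r" "z \<in> \<Omega>" shows "Kr s z \<le> Kr r z"
proof -
  have s: "adm s" by (rule adm_mono[OF assms(1-3)])
  obtain f where f: "f \<in> sqint_hol" "sqn (Ar s) f = 1" "f z = of_real (sqrt (Kr s z))"
    using Kr_extremal[OF s assms(4)] by metis
  have "Kr s z = (cmod (f z))\<^sup>2"
    using Kr_pos[OF s assms(4)] unfolding f(3) norm_of_real by simp
  also have "\<dots> \<le> Kr r z * sqn (Ar r) f" by (rule Kr_eval[OF assms(1,4) f(1)])
  also have "\<dots> \<le> Kr r z * 1"
    using sqn_Ar_antimono[OF assms(1-3) f(1)] f(2) Kr_pos[OF assms(1,4)] by (intro mult_left_mono) auto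
  finally show ?thesis by simp
qed

lemma sqint_hol_bound_compact:
  assumes "adm r" "compact C" "C \<subseteq> \<Omega>"
  obtains M where "M \<ge> 0" "\<And>h z. h \<in> sqint_hol \<Longrightarrow> z \<in> C \<Longrightarrow> (cmod (h z))\<^sup>2 \<le> M * sqn (Ar r) h"
  using shell.hspace_eval_compact[OF shell_r[OF assms(1)] assms(2,3)] hspace_eq[OF assms(1)] by metis

lemma Kr_bound_compact:
  assumes "adm r" "compact C" "C \<subseteq> \<Omega>"
  obtains M where "M > 0" "\<And>z. z \<in> C \<Longrightarrow> Kr r z \<le> M\<^sup>2"
proof -
  obtain M where M: "M \<ge> 0" "\<And>h z. h \<in> sqint_hol \<Longrightarrow> z \<in> C \<Longrightarrow> (cmod (h z))\<^sup>2 \<le> M * sqn (Ar r) h"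
    by (rule sqint_hol_bound_compact[OF assms]) (rule that)
  have "Kr r z \<le> (M + 1)\<^sup>2" if "z \<in> C" for z
  proof -
    have zO: "z \<in> \<Omega>" using that assms by blast
    obtain f where f: "f \<in> sqint_hol" "sqn (Ar r) f = 1" "f z = of_real (sqrt (Kr r z))"
      using Kr_extremal[OF assms(1) zO] by metis
    have "Kr r z = (cmod (f z))\<^sup>2" using Kr_pos[OF assms(1) zO] unfolding f(3) norm_of_real by simp
    also have "\<dots> \<le> M" using M(2)[OF f(1) that] f(2) by simp
    also have "\<dots> \<le> (M + 1)\<^sup>2" using M(1) by (simp add: power2_eq_square algebra_simps)
    finally show ?thesis .
  qed
  then show thesis using M(1) by (intro that[of "M + 1"]) auto
qed

text \<open>Enlarging the hole from r to s costs the integral over the difference of the holes.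
  There |h|^2 is at most M times the squared norm, and the volume of the difference tends to 0, so
  norms and kernels are comparable with factor q.\<close>

lemma Kr_right_continuous:
  assumes r: "adm r" and q: "0 < q" "q < 1"
  obtains r' where "r' > r" "adm r'" "\<And>z. z \<in> \<Omega> \<Longrightarrow> q * Kr r' z \<le> Kr r z"
proof -
  obtain r1 where r1: "r1 > r" "adm r1" using adm_larger[OF r] .
  have r0: "r > 0" using r by (simp add: adm_def)
  obtain M where M: "M \<ge> 0" "\<And>h z. h \<in> sqint_hol \<Longrightarrow> z \<in> Lr r1 \<Longrightarrow> (cmod (h z))\<^sup>2 \<le> M * sqn (Ar r) h"
    by (rule sqint_hol_bound_compact[OF r compact_Lr Lr_sub[OF r1(2)]]) (rule that)
  define W where "W = measure lborel V"
  have "((\<lambda>s. M * ((s ^ (2 * CARD('n)) - r ^ (2 * CARD('n))) * W)) \<longlongrightarrow> M * ((r ^ (2 * CARD('n)) - r ^ (2 * CARD('n))) * W)) (at_right r)"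
    by (intro tendsto_intros)
  then have "((\<lambda>s. M * ((s ^ (2 * CARD('n)) - r ^ (2 * CARD('n))) * W)) \<longlongrightarrow> 0) (at_right r)" by simp
  then have "\<forall>\<^sub>F s in at_right r. M * ((s ^ (2 * CARD('n)) - r ^ (2 * CARD('n))) * W) < 1 - q"
    using q by (intro order_tendstoD) auto
  moreover have "\<forall>\<^sub>F s in at_right r. s < r1" using r1(1) by (auto simp: eventually_at_right_field intro: exI[of _ r1])
  ultimately have "\<forall>\<^sub>F s in at_right r. M * ((s ^ (2 * CARD('n)) - r ^ (2 * CARD('n))) * W) < 1 - q \<and> s < r1 \<and> s > r"
    using eventually_at_right_less[of r] by eventually_elim auto
  then obtain s where s: "M * ((s ^ (2 * CARD('n)) - r ^ (2 * CARD('n))) * W) < 1 - q" "s < r1" "s > r"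
    using eventually_happens'[OF trivial_limit_at_right_real] by blast
  have adm_s: "adm s" using adm_mono[OF r1(2)] s r0 by simp
  have lower: "q * sqn (Ar r) h \<le> sqn (Ar s) h" if h: "h \<in> sqint_hol" for h
  proof -
    have D: "Lr s - Lr r \<in> sets borel" using Lr_borel by auto
    have fin: "emeasure lborel (Lr s - Lr r) < \<infinity>"
      by (meson Diff_subset bounded_subset compact_Lr compact_imp_bounded emeasure_bounded_finite)
    have int: "set_integrable lborel (Lr s) (\<lambda>z. (cmod (h z))\<^sup>2)"
      using hol_on_continuous[OF sqint_holD(1)[OF h]] by (intro set_integrable_Lr[OF adm_s] continuous_on_power continuous_on_norm)
    have intD: "set_integrable lborel (Lr s - Lr r) (\<lambda>z. (cmod (h z))\<^sup>2)"
      using D by (intro set_integrable_subset[OF int]) auto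
    have intr: "set_integrable lborel (Lr r) (\<lambda>z. (cmod (h z))\<^sup>2)"
      using hol_on_continuous[OF sqint_holD(1)[OF h]] by (intro set_integrable_Lr[OF r] continuous_on_power continuous_on_norm)
    have sub: "Lr r \<subseteq> Lr s" using Lr_mono[OF r0] s by simp
    have "sqn (Lr s) h = sqn (Lr s - Lr r) h + sqn (Lr r) h"
    proof -
      have "sqn ((Lr s - Lr r) \<union> Lr r) h = sqn (Lr s - Lr r) h + sqn (Lr r) h"
        unfolding sqn_def by (rule set_integral_Un[OF _ intD intr]) auto
      then show ?thesis using sub by (simp add: Un_absorb2)
    qed
    moreover have "sqn (Lr s - Lr r) h \<le> (M * sqn (Ar r) h) * ((s ^ (2 * CARD('n)) - r ^ (2 * CARD('n))) * W)"
    proof -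
      have "sqn (Lr s - Lr r) h \<le> (LINT z:Lr s - Lr r|lborel. M * sqn (Ar r) h)"
        unfolding sqn_def
      proof (rule set_integral_mono[OF intD])
        show "set_integrable lborel (Lr s - Lr r) (\<lambda>z. M * (LINT z:Ar r|lborel. (cmod (h z))\<^sup>2))"
          unfolding set_integrable_def using D fin by (intro integrable_scaleR_left integrable_real_indicator) auto
        fix z assume "z \<in> Lr s - Lr r"
        then have "z \<in> Lr r1" using Lr_mono[of s r1] s r0 by auto
        then show "(cmod (h z))\<^sup>2 \<le> M * (LINT z:Ar r|lborel. (cmod (h z))\<^sup>2)"
          using M(2)[OF h] by (simp add: sqn_def)
      qed
      also have "\<dots> = measure lborel (Lr s - Lr r) * (M * sqn (Ar r) h)"
        using D fin by (simp add: set_integral_const)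
      also have "measure lborel (Lr s - Lr r) = (s ^ (2 * CARD('n)) - r ^ (2 * CARD('n))) * W"
      proof -
        have "measure lborel (Lr s - Lr r) = measure lborel (Lr s) - measure lborel (Lr r)"
          using Lr_borel sub emeasure_compact_finite[OF compact_Lr, of s]
          by (intro measure_Diff) auto
        then show ?thesis using measure_Lr[of s] measure_Lr[of r] r0 s by (simp add: W_def algebra_simps)
      qed
      finally show ?thesis by (simp add: mult.commute)
    qed
    moreover have "(M * sqn (Ar r) h) * ((s ^ (2 * CARD('n)) - r ^ (2 * CARD('n))) * W) \<le> (1 - q) * sqn (Ar r) h"
      using mult_right_mono[OF less_imp_le[OF s(1)] sqn_nonneg[of "Ar r" h]] by (simp add: ac_simps)
    moreover have "sqn (Ar s) h = sqn (Ar r) h + sqn (Lr r) h - sqn (Lr s) h"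
      using sqn_split[OF r h] sqn_split[OF adm_s h] by simp
    ultimately show ?thesis by (simp add: algebra_simps)
  qed
  have "q * Kr s z \<le> Kr r z" if z: "z \<in> \<Omega>" for z
  proof -
    obtain f where f: "f \<in> sqint_hol" "sqn (Ar s) f = 1" "f z = of_real (sqrt (Kr s z))"
      using Kr_extremal[OF adm_s z] by metis
    have "q * Kr s z = q * (cmod (f z))\<^sup>2" using Kr_pos[OF adm_s z] unfolding f(3) norm_of_real by simp
    also have "\<dots> \<le> q * (Kr r z * sqn (Ar r) f)" using Kr_eval[OF r z f(1)] q by (intro mult_left_mono) auto
    also have "\<dots> = Kr r z * (q * sqn (Ar r) f)" by simp
    also have "\<dots> \<le> Kr r z * 1" using lower[OF f(1)] f(2) Kr_pos[OF r z] by (intro mult_left_mono) auto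
    finally show ?thesis by simp
  qed
  then show thesis using that s(3) adm_s by blast
qed

text \<open>Joint upper semicontinuity in radius and point: \<open>Kr_right_continuous\<close>
  treats the radius, \<open>sqrt_kernel_near\<close> the point, and monotonicity extends the bound
  from r' to all smaller radii.\<close>

lemma Kr_usc:
  assumes r: "adm r" and z0: "z0 \<in> \<Omega>" and c: "Kr r z0 < c"
  obtains r' d where "r' > r" "adm r'" "d > 0" "ball z0 d \<subseteq> \<Omega>"
    "\<And>z s. z \<in> ball z0 d \<Longrightarrow> 0 < s \<Longrightarrow> s \<le> r' \<Longrightarrow> Kr s z < c"
proof -
  have K0: "Kr r z0 > 0" by (rule Kr_pos[OF r z0])
  obtain c1 where c1: "Kr r z0 < c1" "c1 < c" using c dense by blast
  have c1p: "0 < c1" "0 < c" using K0 c1 by auto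
  \<comment> \<open>The intermediate value \<open>c1\<close> splits the room: the change of point
    stays below \<open>c1\<close>, and the change of radius costs the factor c / c1.\<close>
  define q where "q = c1 / c"
  have q: "0 < q" "q < 1" using c1 c1p by (auto simp: q_def)
  obtain r' where r': "r' > r" "adm r'" "\<And>z. z \<in> \<Omega> \<Longrightarrow> q * Kr r' z \<le> Kr r z"
    using Kr_right_continuous[OF r q] by metis
  obtain e B where e: "e > 0" "B > 0" "ball z0 e \<subseteq> \<Omega>"
    "\<And>z. norm (z - z0) \<le> e / 2 \<Longrightarrow> sqrt (Kr r z) \<le> sqrt (Kr r z0) + B * norm (z - z0)"
    using shell.sqrt_kernel_near[OF shell_r[OF r] z0] by metis
  define g where "g = sqrt c1 - sqrt (Kr r z0)"
  have g: "g > 0" using c1 by (simp add: g_def)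
  define d where "d = min (e / 2) (g / B)"
  have d: "d > 0" using e g by (simp add: d_def)
  have "Kr s z < c" if z: "z \<in> ball z0 d" and s: "0 < s" "s \<le> r'" for z s
  proof -
    have nz: "norm (z - z0) < d" using z by (simp add: dist_norm norm_minus_commute)
    have zO: "z \<in> \<Omega>" using e(1,3) nz by (auto simp: subset_iff dist_norm norm_minus_commute d_def)
    have "B * norm (z - z0) < B * (g / B)" using nz e(2) by (intro mult_strict_left_mono) (auto simp: d_def)
    then have "B * norm (z - z0) < g" using e(2) by simp
    moreover have "norm (z - z0) \<le> e / 2" using nz by (simp add: d_def)
    from e(4)[OF this] have "sqrt (Kr r z) \<le> sqrt (Kr r z0) + B * norm (z - z0)" .
    ultimately have "sqrt (Kr r z) < sqrt c1" unfolding g_def by linarith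
    then have "Kr r z < c1" by simp
    then have "q * Kr r' z < c1" using r'(3)[OF zO] by simp
    then have "Kr r' z < c" using c1p by (simp add: q_def field_simps)
    then show ?thesis using Kr_mono[OF r'(2) s zO] by simp
  qed
  moreover have "ball z0 d \<subseteq> \<Omega>" using e(1,3) by (auto simp: d_def subset_iff)
  ultimately show thesis using that r' d by blast
qed

text \<open>On every line through 0 the circle mean of |h|^2 is a power series in the radius with
  nonnegative coefficients. After multiplication by the Jacobian r^(2n), the terms beyond the
  constant one are convex and increasing and contribute a supporting line of nonnegative slope. The
  constant term carries the explicit second order gain. The slope \<alpha> is the same for all y, as
  averaging over radii requires.\<close>

lemma Q_lower:
  assumes r1: "adm r1" and h: "hol_on h \<Omega>" and x: "0 < x" "x < r1"
  obtains \<alpha> where "\<alpha> \<ge> real (2 * CARD('n)) * ((cmod (h 0))\<^sup>2 * measure lborel V) * x ^ (2 * CARD('n) - 1)"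
    "\<And>y. 0 < y \<Longrightarrow> y < r1 \<Longrightarrow> sqn (Lr y) h \<ge> sqn (Lr x) h + \<alpha> * (y - x)
        + ((cmod (h 0))\<^sup>2 * measure lborel V) * x ^ (2 * CARD('n) - 2) * (y - x)\<^sup>2"
proof -
  define N where "N = 2 * CARD('n)"
  \<comment> \<open>The circle mean that replaces the squared modulus of h (r z) under the integral
    over \<open>V\<close>, by \<open>set_integral_circle_mean\<close>.\<close>
  define D where "D = (\<lambda>z r. (LINT t:{0..2*pi}|lborel. (cmod (h ((of_real r * cis t) *s z)))\<^sup>2) / (2 * pi))"
  \<comment> \<open>The integrand, with its Jacobian, from which the constant Parseval term is
    removed.\<close>
  define F where "F = (\<lambda>z r. r ^ N * (D z r - (cmod (h 0))\<^sup>2))"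
  have r10: "r1 > 0" using r1 by (simp add: adm_def)
  have conv: "convex_on {0<..<r1} (F z)" and mono: "\<And>r s. 0 < r \<Longrightarrow> r \<le> s \<Longrightarrow> s < r1 \<Longrightarrow> F z r \<le> F z s"
    if z: "z \<in> V" for z
  proof -
    have "(\<lambda>\<mu>. h (\<mu> *s z)) holomorphic_on ball 0 r1"
    proof (rule holomorphic_on_subset[OF hol_on_line[OF h]], rule)
      fix \<mu> :: complex assume "\<mu> \<in> ball 0 r1"
      moreover have "r1 *\<^sub>R z \<in> \<Omega>" using z Lr_sub[OF r1] by (auto simp: shrunk_def)
      ultimately show "\<mu> \<in> {\<mu>. \<mu> *s z \<in> \<Omega>}"
        using complete_circular_mono[OF circ_\<Omega>, of \<mu> "of_real r1" z] r10 by (simp add: scaleR_eq_cscale)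
    qed
    from circle_Parseval[OF this] obtain a :: "nat \<Rightarrow> real" where a: "\<And>k. a k \<ge> 0"
      "a 0 = (cmod (h (0 *s z)))\<^sup>2"
      "\<And>r. 0 \<le> r \<Longrightarrow> r < r1 \<Longrightarrow> (\<lambda>k. a k * r ^ (2 * k)) sums
          ((LINT t:{0..2*pi}|lborel. (cmod (h ((of_real r * cis t) *s z)))\<^sup>2) / (2 * pi))"
      by blast
    have S: "(\<lambda>k. a (Suc k) * r ^ (2 * Suc k + N)) sums F z r" if "0 < r" "r < r1" for r
    proof -
      have "(\<lambda>k. a k * r ^ (2 * k)) sums D z r" using a(3)[of r] that by (simp add: D_def)
      then have "(\<lambda>k. a (Suc k) * r ^ (2 * Suc k)) sums (D z r - a 0 * r ^ (2 * 0))"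
        by (subst sums_Suc_iff) simp
      then have "(\<lambda>k. r ^ N * (a (Suc k) * r ^ (2 * Suc k))) sums (r ^ N * (D z r - a 0 * r ^ (2 * 0)))"
        by (rule sums_mult)
      then show ?thesis using a(2) by (simp add: F_def power_add ac_simps)
    qed
    show "convex_on {0<..<r1} (F z)" by (rule convex_on_powser_nonneg(1)[OF _ S]) (use a in auto)
    show "F z r \<le> F z s" if "0 < r" "r \<le> s" "s < r1" for r s
      by (rule convex_on_powser_nonneg(2)[OF _ S that]) (use a in auto)
  qed
  have Dint: "set_integrable lborel V (\<lambda>z. D z r)"
    and Deq: "(LINT z:V|lborel. D z r) = (LINT z:V|lborel. (cmod (h (r *\<^sub>R z)))\<^sup>2)" if r: "0 < r" "r < r1" for r
  proof -
    have adm: "adm r" using adm_mono[OF r1] r by simp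
    have c: "continuous_on V (\<lambda>z. h (r *\<^sub>R z))"
      by (rule continuous_on_compose2[OF hol_on_continuous[OF h]])
        (use Lr_sub[OF adm] in \<open>auto simp: shrunk_def intro!: continuous_intros\<close>)
    have i: "set_integrable lborel V (\<lambda>z. (cmod (h (r *\<^sub>R z)))\<^sup>2)"
      unfolding set_integrable_def
      by (intro borel_integrable_compact compact_V continuous_on_power continuous_on_norm c)
    have circled: "c *s z \<in> V" if "cmod c = 1" "z \<in> V" for c z
      using circ_V that by (simp add: complete_circular_def)
    have F: "(LINT t:{0..2*pi}|lborel. (cmod (h (r *\<^sub>R (cis t *s z))))\<^sup>2) = (2 * pi) *\<^sub>R D z r" for z
    proof -
      have "r *\<^sub>R (cis t *s z) = (of_real r * cis t) *s z" for t by (simp only: scaleR_eq_cscale cscale_simps(1))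
      then show ?thesis by (simp add: D_def)
    qed
    show "set_integrable lborel V (\<lambda>z. D z r)" by (rule set_integral_circle_mean(1)[OF V_borel circled i F])
    show "(LINT z:V|lborel. D z r) = (LINT z:V|lborel. (cmod (h (r *\<^sub>R z)))\<^sup>2)"
      by (rule set_integral_circle_mean(2)[OF V_borel circled i F])
  qed
  have finV: "emeasure lborel V < \<infinity>" by (intro emeasure_bounded_finite compact_imp_bounded compact_V)
  have cint: "set_integrable lborel V (\<lambda>z. (cmod (h 0))\<^sup>2)"
    unfolding set_integrable_def using finV by (intro integrable_scaleR_left integrable_real_indicator) auto
  have Fint: "set_integrable lborel V (\<lambda>z. F z r)" if "0 < r" "r < r1" for r
    unfolding F_def using Dint[OF that] cint by simp
  define R where "R = (\<lambda>r. LINT z:V|lborel. F z r)"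
  define b0 where "b0 = (cmod (h 0))\<^sup>2 * measure lborel V"
  have Q: "sqn (Lr r) h = R r + b0 * r ^ N" if r: "0 < r" "r < r1" for r
  proof -
    have "R r = r ^ N * ((LINT z:V|lborel. D z r) - (LINT z:V|lborel. (cmod (h 0))\<^sup>2))"
      unfolding R_def F_def using Dint[OF r] cint by simp
    also have "(LINT z:V|lborel. (cmod (h 0))\<^sup>2) = b0"
      using finV by (subst set_integral_const) (auto simp: b0_def)
    also have "r ^ N * ((LINT z:V|lborel. D z r) - b0) = r ^ N *\<^sub>R (LINT z:V|lborel. (cmod (h (r *\<^sub>R z)))\<^sup>2) - b0 * r ^ N"
      unfolding Deq[OF r] by (simp add: algebra_simps)
    also have "r ^ N *\<^sub>R (LINT z:V|lborel. (cmod (h (r *\<^sub>R z)))\<^sup>2) = sqn (Lr r) h"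
      unfolding sqn_def N_def by (rule set_integral_shrunk(1)[OF r(1), symmetric])
    finally show ?thesis by simp
  qed
  have convR: "convex_on {0<..<r1} R"
  proof (rule convex_onI)
    fix t u v :: real assume t: "0 < t" "t < 1" and u: "u \<in> {0<..<r1}" and v: "v \<in> {0<..<r1}"
    let ?m = "(1 - t) *\<^sub>R u + t *\<^sub>R v"
    have m: "?m \<in> {0<..<r1}"
      using convexD_alt[OF convex_real_interval(8) u v, of t] t by simp
    have "R ?m \<le> (LINT z:V|lborel. (1 - t) * F z u + t * F z v)"
      unfolding R_def
    proof (rule set_integral_mono)
      show "set_integrable lborel V (\<lambda>z. F z ?m)" using m by (intro Fint) auto
      show "set_integrable lborel V (\<lambda>z. (1 - t) * F z u + t * F z v)"
        using Fint[of u] Fint[of v] u v by simp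
      show "F z ?m \<le> (1 - t) * F z u + t * F z v" if "z \<in> V" for z
        using convex_onD[OF conv[OF that], of t u v] t u v by simp
    qed
    also have "\<dots> = (1 - t) * R u + t * R v"
      unfolding R_def using Fint[of u] Fint[of v] u v by simp
    finally show "R ?m \<le> (1 - t) * R u + t * R v" .
  qed simp
  have monoR: "R r \<le> R s" if "0 < r" "r \<le> s" "s < r1" for r s
    unfolding R_def using that by (intro set_integral_mono Fint mono) auto
  obtain a where a: "a \<ge> 0" "\<And>y. 0 < y \<Longrightarrow> y < r1 \<Longrightarrow> R y \<ge> R x + a * (y - x)"
    using convex_on_mono_support[OF convR monoR x] by metis
  obtain k where k: "N = k + 2"
  proof
    show "N = (N - 2) + 2" using card by (simp add: N_def)
  qed
  have b0: "b0 \<ge> 0" by (simp add: b0_def)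
  show thesis
  proof (rule that[of "a + real N * b0 * x ^ (N - 1)"])
    show "real (2 * CARD('n)) * ((cmod (h 0))\<^sup>2 * measure lborel V) * x ^ (2 * CARD('n) - 1)
      \<le> a + real N * b0 * x ^ (N - 1)"
      using a(1) unfolding N_def b0_def by simp
    fix y assume y: "0 < y" "y < r1"
    have "y ^ N \<ge> x ^ N + real N * x ^ (N - 1) * (y - x) + x ^ (N - 2) * (y - x)\<^sup>2"
      using power_second_order_lower[of x y k] x y by (simp add: k)
    then have "b0 * y ^ N \<ge> b0 * (x ^ N + real N * x ^ (N - 1) * (y - x) + x ^ (N - 2) * (y - x)\<^sup>2)"
      using b0 by (rule mult_left_mono)
    also have "b0 * (x ^ N + real N * x ^ (N - 1) * (y - x) + x ^ (N - 2) * (y - x)\<^sup>2) =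
      b0 * x ^ N + (real N * b0 * x ^ (N - 1)) * (y - x) + b0 * x ^ (N - 2) * (y - x)\<^sup>2"
      by (simp add: algebra_simps)
    finally have "R y + b0 * y ^ N \<ge> (R x + b0 * x ^ N) + (a * (y - x) + (real N * b0 * x ^ (N - 1)) * (y - x))
        + b0 * x ^ (N - 2) * (y - x)\<^sup>2"
      using a(2)[OF y] by linarith
    then show "sqn (Lr y) h \<ge> sqn (Lr x) h + (a + real N * b0 * x ^ (N - 1)) * (y - x)
        + ((cmod (h 0))\<^sup>2 * measure lborel V) * x ^ (2 * CARD('n) - 2) * (y - x)\<^sup>2"
      unfolding Q[OF y] Q[OF x] by (simp add: b0_def N_def distrib_right)
  qed
qed

text \<open>The pairings differ by the integral over the difference of the holes, whose volume is at
  most 2n (y - x) times that of \<open>V\<close>, because the radii are below 1. This makes the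
  cross term in \<open>competitor\<close> linear in the change of radius.\<close>

lemma inner_variation_le:
  assumes r1: "adm r1" and f: "f \<in> sqint_hol" and g: "g \<in> sqint_hol"
    and M: "M \<ge> 0" "\<And>w. w \<in> Lr r1 \<Longrightarrow> cmod (f w) \<le> M" and G: "G \<ge> 0" "\<And>w. w \<in> \<Omega> \<Longrightarrow> cmod (g w) \<le> G"
    and x: "0 < x" "x \<le> y" "y < r1"
  shows "cmod (bergman_inner (Ar x) f g - bergman_inner (Ar y) f g)
      \<le> M * G * measure lborel V * real (2 * CARD('n)) * (y - x)"
proof -
  let ?S = "Lr y - Lr x"
  have ax: "adm x" "adm y" using adm_mono[OF r1] x by auto
  have sub: "Lr x \<subseteq> Lr y" "Lr y \<subseteq> Lr r1" using Lr_mono x by auto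
  have op: "open (Ar y)" "open (Ar x)" using shell.open_A[OF shell_r] ax by auto
  have S: "?S \<in> sets borel" using Lr_borel by auto
  have fin: "emeasure lborel ?S < \<infinity>"
    by (meson Diff_subset bounded_subset compact_Lr compact_imp_bounded emeasure_bounded_finite)
  have i: "set_integrable lborel (Ar x) (\<lambda>z. f z * cnj (g z))" "set_integrable lborel (Ar y) (\<lambda>z. f z * cnj (g z))"
    using f g ax by (intro bergman_inner_integrable op sqint_hol_bergman_Ar; simp)+
  have AxS: "Ar x = Ar y \<union> ?S" using sub Lr_sub[OF ax(2)] by blast
  have iS: "set_integrable lborel ?S (\<lambda>z. f z * cnj (g z))"
    by (rule set_integrable_subset[OF i(1)]) (use S AxS in auto)
  have "bergman_inner (Ar x) f g = bergman_inner (Ar y) f g + bergman_inner ?S f g"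
    unfolding bergman_inner_def AxS by (rule set_integral_Un[OF _ i(2) iS]) auto
  then have "cmod (bergman_inner (Ar x) f g - bergman_inner (Ar y) f g) = cmod (bergman_inner ?S f g)" by simp
  also have "\<dots> \<le> (LINT z:?S|lborel. cmod (f z * cnj (g z)))"
    unfolding bergman_inner_def by (rule set_integral_norm_bound[OF iS])
  also have "\<dots> \<le> (LINT z:?S|lborel. M * G)"
  proof (rule set_integral_mono)
    show "set_integrable lborel ?S (\<lambda>z. cmod (f z * cnj (g z)))" by (rule set_integrable_norm[OF iS])
    show "set_integrable lborel ?S (\<lambda>z. M * G)"
      unfolding set_integrable_def using S fin by (intro integrable_scaleR_left integrable_real_indicator) auto
    fix z assume z: "z \<in> ?S"
    then have "cmod (f z) \<le> M" "cmod (g z) \<le> G" using M(2) G(2) sub Lr_sub[OF r1] by blast+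
    then show "cmod (f z * cnj (g z)) \<le> M * G" using M(1) by (simp add: norm_mult mult_mono)
  qed
  also have "\<dots> = measure lborel ?S * (M * G)" using S fin by (simp add: set_integral_const)
  also have "measure lborel ?S = (y ^ (2 * CARD('n)) - x ^ (2 * CARD('n))) * measure lborel V"
  proof -
    have "measure lborel ?S = measure lborel (Lr y) - measure lborel (Lr x)"
      using Lr_borel sub emeasure_compact_finite[OF compact_Lr, of y]
      by (intro measure_Diff) auto
    then show ?thesis using measure_Lr[of x] measure_Lr[of y] x by (simp add: algebra_simps)
  qed
  also have "y ^ (2 * CARD('n)) - x ^ (2 * CARD('n)) \<le> real (2 * CARD('n)) * (y - x)"
  proof -
    have "norm (y ^ (2 * CARD('n)) - x ^ (2 * CARD('n))) \<le> real (2 * CARD('n)) * norm (y - x)"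
      using x r1 by (intro norm_power_diff) (auto simp: adm_def)
    then show ?thesis using x by simp
  qed
  finally show ?thesis using M G by (simp add: mult_right_mono ac_simps)
qed

lemma inner_variation:
  assumes r1: "adm r1" and f: "f \<in> sqint_hol" and g: "g \<in> sqint_hol"
    and M: "M \<ge> 0" "\<And>w. w \<in> Lr r1 \<Longrightarrow> cmod (f w) \<le> M" and G: "G \<ge> 0" "\<And>w. w \<in> \<Omega> \<Longrightarrow> cmod (g w) \<le> G"
    and x: "0 < x" "x < r1" and y: "0 < y" "y < r1"
  shows "cmod (bergman_inner (Ar y) f g - bergman_inner (Ar x) f g)
      \<le> M * G * measure lborel V * real (2 * CARD('n)) * \<bar>y - x\<bar>"
proof (cases "x \<le> y")
  case True
  then show ?thesis
    using inner_variation_le[OF r1 f g M G x(1) True y(2)] by (simp add: norm_minus_commute)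
next
  case False
  then show ?thesis
    using inner_variation_le[OF r1 f g M G y(1) _ x(2)] by simp
qed

lemma sqint_hol_bounded:
  assumes h: "hol_on h \<Omega>" and B: "\<And>z. z \<in> \<Omega> \<Longrightarrow> cmod (h z) \<le> B" and r: "adm r"
  shows "h \<in> sqint_hol" "sqn (Ar r) h \<le> B\<^sup>2 * measure lborel \<Omega>"
proof -
  interpret s: shell \<Omega> "Lr r" by (rule shell_r[OF r])
  show hs: "h \<in> sqint_hol" using s.hspace_bounded[OF h B] hspace_eq[OF r] by blast
  have "sqn (Ar r) h \<le> (LINT z:Ar r|lborel. B\<^sup>2)"
    unfolding sqn_def
  proof (rule set_integral_mono)
    show "set_integrable lborel (Ar r) (\<lambda>z. (cmod (h z))\<^sup>2)"
      using sqint_hol_bergman_Ar[OF r hs] by (simp add: bergman_space_def)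
    show "set_integrable lborel (Ar r) (\<lambda>z. B\<^sup>2)"
      unfolding set_integrable_def using s.A_borel s.finite_measure_A
      by (intro integrable_scaleR_left integrable_real_indicator) auto
    show "(cmod (h z))\<^sup>2 \<le> B\<^sup>2" if "z \<in> Ar r" for z using B that by (intro power_mono) auto
  qed
  also have "\<dots> = measure lborel (Ar r) * B\<^sup>2"
    using s.A_borel s.finite_measure_A by (simp add: set_integral_const)
  also have "\<dots> \<le> B\<^sup>2 * measure lborel \<Omega>" using mult_left_mono[OF measure_Ar_le[of r], of "B\<^sup>2"] by (simp add: mult.commute)
  finally show "sqn (Ar r) h \<le> B\<^sup>2 * measure lborel \<Omega>" .
qed

text \<open>The Hermitian pairing of w - z0 with b. It vanishes at z0, hence is orthogonal to the
  extremal function for z0. At z0 + \<xi> b with |\<xi>| = 1, its product with cnj \<xi> is the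
  constant (norm b)^2.\<close>

definition lin :: "complex ^ 'n \<Rightarrow> complex ^ 'n \<Rightarrow> complex ^ 'n \<Rightarrow> complex" where
  "lin z0 b w = (\<Sum>j\<in>UNIV. cnj (b $ j) * (w $ j - z0 $ j))"

lemma hol_on_lin: "hol_on (lin z0 b) S"
  unfolding lin_def[abs_def] by (intro hol_on_sum hol_on_cmult hol_on_diff hol_on_nth hol_on_const)

lemma lin_bound: "cmod (lin z0 b w) \<le> norm b * norm (w - z0)"
proof -
  have "cmod (lin z0 b w) \<le> (\<Sum>j\<in>UNIV. cmod (b $ j) * cmod ((w - z0) $ j))"
    unfolding lin_def by (intro order_trans[OF norm_sum] sum_mono) (simp add: norm_mult)
  also have "\<dots> \<le> norm b * norm (w - z0)"
    unfolding norm_vec_def using L2_set_mult_ineq[of "\<lambda>j. cmod (b $ j)" "\<lambda>j. cmod ((w - z0) $ j)" UNIV] by simp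
  finally show ?thesis .
qed

lemma lin_line: "lin z0 b (z0 + \<mu> *s b) = \<mu> * of_real ((norm b)\<^sup>2)"
proof -
  have "lin z0 b (z0 + \<mu> *s b) = \<mu> * (\<Sum>j\<in>UNIV. b $ j * cnj (b $ j))"
    unfolding lin_def by (simp add: sum_distrib_left ac_simps)
  also have "(\<Sum>j\<in>UNIV. b $ j * cnj (b $ j)) = of_real (\<Sum>j\<in>UNIV. (cmod (b $ j))\<^sup>2)"
    by (simp only: complex_norm_square[symmetric] of_real_sum)
  also have "(\<Sum>j\<in>UNIV. (cmod (b $ j))\<^sup>2) = (norm b)\<^sup>2"
    by (simp add: norm_vec_def L2_set_def sum_nonneg)
  finally show ?thesis .
qed

text \<open>The competitor for the extremal problem at a nearby point of the disc: the extremal function at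
  the centre, corrected by a small multiple of a linear function vanishing there. The cross term is
  orthogonal at the centre and is absorbed by the strict convexity in \<open>Q_lower\<close>.\<close>

lemma competitor:
  assumes r1: "adm r1" and x: "0 < x" "x < r1" and z0: "z0 \<in> \<Omega>"
    and f: "f \<in> sqint_hol" "sqn (Ar x) f = 1" "\<And>g. g \<in> sqint_hol \<Longrightarrow> bergman_inner (Ar x) g f = g z0 / of_real (sqrt (Kr x z0))"
    and M: "M \<ge> 0" "\<And>w. w \<in> Lr r1 \<Longrightarrow> cmod (f w) \<le> M"
    and R: "\<And>w. w \<in> \<Omega> \<Longrightarrow> norm w \<le> R"
    and Q: "\<And>y. 0 < y \<Longrightarrow> y < r1 \<Longrightarrow> sqn (Lr y) f \<ge> sqn (Lr x) f + \<alpha> * (y - x) + m * (y - x)\<^sup>2"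
    and m: "m > 0" and y: "0 < y" "y < r1" and c: "c \<ge> 0" and \<xi>: "cmod \<xi> = 1"
  shows "sqn (Ar y) (\<lambda>w. f w + (of_real c * cnj \<xi>) * lin z0 b w) \<le> 1 - \<alpha> * (y - x)
    + c\<^sup>2 * (norm b)\<^sup>2 * ((M * (2 * R) * measure lborel V * real (2 * CARD('n)))\<^sup>2 / m + (2 * R)\<^sup>2 * measure lborel \<Omega>)"
proof -
  have ax: "adm x" and ay: "adm y" using adm_mono[OF r1] x y by auto
  have R0: "R \<ge> 0" using R[OF z0] norm_ge_zero order_trans by blast
  let ?g = "lin z0 b"
  define G where "G = 2 * R * norm b"
  have G0: "G \<ge> 0" using R0 by (simp add: G_def)
  have gG: "cmod (?g w) \<le> G" if "w \<in> \<Omega>" for w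
  proof -
    have "norm (w - z0) \<le> 2 * R" using norm_triangle_ineq4[of w z0] R[OF that] R[OF z0] by linarith
    then have "norm b * norm (w - z0) \<le> norm b * (2 * R)" by (intro mult_left_mono) auto
    then show ?thesis using lin_bound[of z0 b w] by (simp add: G_def ac_simps)
  qed
  have g: "?g \<in> sqint_hol" by (rule sqint_hol_bounded(1)[OF hol_on_lin gG r1])
  have sg: "sqn (Ar y) ?g \<le> G\<^sup>2 * measure lborel \<Omega>" by (rule sqint_hol_bounded(2)[OF hol_on_lin gG ay])
  have "bergman_inner (Ar x) ?g f = 0" using f(3)[OF g] by (simp add: lin_def)
  then have orth: "bergman_inner (Ar x) f ?g = 0" using bergman_inner_cnj[of "Ar x" f ?g] by simp
  define C1 where "C1 = M * (2 * R) * measure lborel V * real (2 * CARD('n))"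
  have C1: "C1 \<ge> 0" using M R0 by (simp add: C1_def)
  have cross: "cmod (bergman_inner (Ar y) f ?g) \<le> C1 * norm b * \<bar>y - x\<bar>"
    using inner_variation[OF r1 f(1) g M G0 gG x y] orth by (simp add: C1_def G_def ac_simps)
  have op: "open (Ar y)" using shell.open_A[OF shell_r[OF ay]] .
  have sf: "sqn (Ar y) f \<le> 1 - \<alpha> * (y - x) - m * (y - x)\<^sup>2"
    using Q[OF y] sqn_split[OF ax f(1)] sqn_split[OF ay f(1)] f(2) by linarith
  let ?d = "of_real c * cnj \<xi>"
  have nd: "cmod ?d = c" using c \<xi> by (simp add: norm_mult)
  have "sqn (Ar y) (\<lambda>w. f w + ?d * ?g w) =
    sqn (Ar y) f + 2 * Re (cnj ?d * bergman_inner (Ar y) f ?g) + (cmod ?d)\<^sup>2 * sqn (Ar y) ?g"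
    by (intro sqn_add_cmult op sqint_hol_bergman_Ar ay f(1) g)
  moreover have "Re (cnj ?d * bergman_inner (Ar y) f ?g) \<le> c * (C1 * norm b * \<bar>y - x\<bar>)"
  proof -
    have "Re (cnj ?d * bergman_inner (Ar y) f ?g) \<le> cmod ?d * cmod (bergman_inner (Ar y) f ?g)"
      using complex_Re_le_cmod[of "cnj ?d * bergman_inner (Ar y) f ?g"] by (simp only: norm_mult complex_mod_cnj)
    also have "\<dots> \<le> c * (C1 * norm b * \<bar>y - x\<bar>)" unfolding nd by (intro mult_left_mono cross c)
    finally show ?thesis .
  qed
  moreover have "(cmod ?d)\<^sup>2 * sqn (Ar y) ?g \<le> c\<^sup>2 * (G\<^sup>2 * measure lborel \<Omega>)"
    unfolding nd by (intro mult_left_mono sg) simp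
  moreover have "2 * (c * (C1 * norm b * \<bar>y - x\<bar>)) - m * (y - x)\<^sup>2 \<le> c\<^sup>2 * (norm b)\<^sup>2 * (C1\<^sup>2 / m)"
  proof -
    \<comment> \<open>Completing the square: the cross term, linear in |y - x|, is paid for by m (y
      - x)^2 from \<open>Q\<close> and a remainder of order c^2.\<close>
    have "0 \<le> (m * \<bar>y - x\<bar> - c * C1 * norm b)\<^sup>2" by simp
    also have "\<dots> = m * (m * (y - x)\<^sup>2 - 2 * (c * (C1 * norm b * \<bar>y - x\<bar>))) + (c * C1 * norm b)\<^sup>2"
      by (simp add: power2_diff power_mult_distrib algebra_simps) (simp add: power2_eq_square)
    finally have "m * (2 * (c * (C1 * norm b * \<bar>y - x\<bar>)) - m * (y - x)\<^sup>2) \<le> (c * C1 * norm b)\<^sup>2"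
      by (simp add: algebra_simps)
    then show ?thesis using m by (simp add: field_simps power_mult_distrib)
  qed
  ultimately have "sqn (Ar y) (\<lambda>w. f w + ?d * ?g w) \<le> 1 - \<alpha> * (y - x) + c\<^sup>2 * (norm b)\<^sup>2 * (C1\<^sup>2 / m) + c\<^sup>2 * (G\<^sup>2 * measure lborel \<Omega>)"
    using sf by linarith
  also have "c\<^sup>2 * (G\<^sup>2 * measure lborel \<Omega>) = c\<^sup>2 * (norm b)\<^sup>2 * ((2 * R)\<^sup>2 * measure lborel \<Omega>)"
    by (simp add: G_def power_mult_distrib)
  finally show ?thesis by (simp add: C1_def distrib_left)
qed

text \<open>At each boundary point the competitor gives |\<phi> (cis t)|^2 <= K (1 - \<alpha>
  (\<rho> t - x) + L) with \<phi> holomorphic on the disc. After 1 + u <= exp u and logarithms,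
  Jensen's inequality treats \<phi>, and only the mean of \<rho> enters, e being a lower bound for
  its excess over x. Here \<rho> is a function of the angle. Centres in C and x >= s keep the
  constants uniform.\<close>

lemma kernel_disc_estimate:
  assumes r1: "adm r1" and C: "compact C" "C \<subseteq> \<Omega>" and s: "0 < s"
  obtains \<alpha>0 \<beta>0 where "\<alpha>0 > 0" "\<beta>0 > 0"
    "\<And>z0 x b \<rho> e. z0 \<in> C \<Longrightarrow> s \<le> x \<Longrightarrow> x < r1 \<Longrightarrow> (\<And>\<xi>. cmod \<xi> \<le> 1 \<Longrightarrow> z0 + \<xi> *s b \<in> \<Omega>) \<Longrightarrow>
      (\<And>t. 0 < \<rho> t \<and> \<rho> t < r1) \<Longrightarrow> set_integrable lborel {0..2*pi} \<rho> \<Longrightarrow>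
      set_integrable lborel {0..2*pi} (\<lambda>t. ln (Kr (\<rho> t) (z0 + cis t *s b))) \<Longrightarrow>
      0 \<le> e \<Longrightarrow> 2 * pi * (x + e) \<le> (LINT t:{0..2*pi}|lborel. \<rho> t) \<Longrightarrow>
      2 * pi * (ln (Kr x z0) + \<alpha>0 * e + \<beta>0 * (norm b)\<^sup>2) \<le> (LINT t:{0..2*pi}|lborel. ln (Kr (\<rho> t) (z0 + cis t *s b)))"
proof -
  \<comment> \<open>\<open>M1\<close> will bound the extremal functions on the largest hole,
    \<open>M2\<close> the root of the kernel at the centres.\<close>
  obtain M1 where M1: "M1 > 0" "\<And>z. z \<in> Lr r1 \<Longrightarrow> Kr r1 z \<le> M1\<^sup>2"
    by (rule Kr_bound_compact[OF r1 compact_Lr Lr_sub[OF r1]]) (rule that)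
  obtain M2 where M2: "M2 > 0" "\<And>z. z \<in> C \<Longrightarrow> Kr r1 z \<le> M2\<^sup>2"
    by (rule Kr_bound_compact[OF r1 C]) (rule that)
  obtain R where R: "R > 0" "\<And>w. w \<in> \<Omega> \<Longrightarrow> norm w \<le> R"
    using bounded_\<Omega> bounded_pos by metis
  define N where "N = 2 * CARD('n)"
  define \<kappa> where "\<kappa> = 1 / measure lborel \<Omega>"
  have \<kappa>: "\<kappa> > 0" using measure_\<Omega>_pos by (simp add: \<kappa>_def)
  \<comment> \<open>A lower bound for |f 0|^2 times the volume of \<open>V\<close>, over all
    extremal functions f that occur: f 0 times the volume of the shell has modulus 1 / sqrt K, which
    is at least 1 / M2, and \<kappa> is the reciprocal volume of \<open>\<Omega>\<close>.\<close>
  define bm where "bm = (\<kappa> / M2)\<^sup>2 * measure lborel V"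
  have bm: "bm > 0" unfolding bm_def using \<kappa> M2 measure_V_pos by simp
  \<comment> \<open>\<open>mm\<close> and \<alpha>0 are the quadratic coefficient and the slope that
    \<open>Q_lower\<close> guarantees at radii x >= s.\<close>
  define mm where "mm = bm * s ^ (N - 2)"
  have mm: "mm > 0" using bm s by (simp add: mm_def)
  define \<alpha>0 where "\<alpha>0 = real N * bm * s ^ (N - 1)"
  have \<alpha>0: "\<alpha>0 > 0" using bm s by (simp add: \<alpha>0_def N_def)
  define C3 where "C3 = (M1 * (2 * R) * measure lborel V * real (2 * CARD('n)))\<^sup>2 / mm + (2 * R)\<^sup>2 * measure lborel \<Omega>"
  have C3: "C3 \<ge> 0" unfolding C3_def using mm by (intro add_nonneg_nonneg mult_nonneg_nonneg divide_nonneg_pos) auto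
  \<comment> \<open>The first bound keeps c (norm b)^2 at most half the root of the kernel at the
    centre, as norm b <= 2 R, so the logarithm can be linearised. The second makes the loss c^2 C3
    smaller than the gain c / M2.\<close>
  define c where "c = min (sqrt \<kappa> / (8 * R\<^sup>2)) (1 / (2 * M2 * C3 + 1))"
  have c0: "c > 0" using \<kappa> R M2 C3 by (simp add: c_def add_nonneg_pos)
  have c1: "c * (4 * R\<^sup>2) \<le> sqrt \<kappa> / 2"
  proof -
    have "c * (4 * R\<^sup>2) \<le> (sqrt \<kappa> / (8 * R\<^sup>2)) * (4 * R\<^sup>2)" by (intro mult_right_mono) (auto simp: c_def)
    then show ?thesis using R by (simp add: field_simps)
  qed
  define \<beta>0 where "\<beta>0 = c / M2 - c\<^sup>2 * C3"
  have \<beta>0: "\<beta>0 > 0"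
  proof -
    have "c * C3 \<le> (1 / (2 * M2 * C3 + 1)) * C3" using C3 by (intro mult_right_mono) (auto simp: c_def)
    also have "\<dots> < 1 / M2"
    proof -
      have "2 * M2 * C3 + 1 > 0" using M2 C3 by (simp add: add_nonneg_pos)
      then show ?thesis using M2 C3 by (simp add: field_simps)
    qed
    finally have "c * (c * C3) < c * (1 / M2)" using c0 by (rule mult_strict_left_mono)
    then show ?thesis by (simp add: \<beta>0_def power2_eq_square)
  qed
  show thesis
  proof (rule that[OF \<alpha>0 \<beta>0])
    fix z0 x b \<rho> and e :: real
    assume z0: "z0 \<in> C" and x: "s \<le> x" "x < r1" and disc: "\<And>\<xi>. cmod \<xi> \<le> 1 \<Longrightarrow> z0 + \<xi> *s b \<in> \<Omega>"
      and \<rho>: "\<And>t. 0 < \<rho> t \<and> \<rho> t < r1" and i\<rho>: "set_integrable lborel {0..2*pi} \<rho>"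
      and iu: "set_integrable lborel {0..2*pi} (\<lambda>t. ln (Kr (\<rho> t) (z0 + cis t *s b)))"
      and e: "0 \<le> e" "2 * pi * (x + e) \<le> (LINT t:{0..2*pi}|lborel. \<rho> t)"
    have x0: "0 < x" using s x by simp
    have ax: "adm x" using adm_mono[OF r1 x0] x by simp
    have zO: "z0 \<in> \<Omega>" using z0 C by blast
    define K0 where "K0 = Kr x z0"
    have K0: "\<kappa> \<le> K0" "K0 > 0" "K0 \<le> M2\<^sup>2"
      using Kr_lower[OF ax zO] Kr_pos[OF ax zO] Kr_mono[OF r1 x0 _ zO] x M2(2)[OF z0] by (auto simp: K0_def \<kappa>_def)
    have sK: "sqrt K0 \<le> M2" "sqrt \<kappa> \<le> sqrt K0" using K0 M2 by (auto intro: real_le_lsqrt)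
    obtain f where f: "f \<in> sqint_hol" "sqn (Ar x) f = 1" "f z0 = of_real (sqrt (Kr x z0))"
      "\<And>g. g \<in> sqint_hol \<Longrightarrow> bergman_inner (Ar x) g f = g z0 / of_real (sqrt (Kr x z0))"
      by (rule Kr_extremal[OF ax zO]) (rule that)
    have fM: "cmod (f w) \<le> M1" if w: "w \<in> Lr r1" for w
    proof -
      have wO: "w \<in> \<Omega>" using w Lr_sub[OF r1] by blast
      have "(cmod (f w))\<^sup>2 \<le> Kr x w" using Kr_eval[OF ax wO f(1)] f(2) by simp
      also have "\<dots> \<le> M1\<^sup>2" using Kr_mono[OF r1 x0 _ wO] x M1(2)[OF w] by simp
      finally show ?thesis by (rule power2_le_imp_le) (use M1(1) in simp)
    qed
    define b0 where "b0 = (cmod (f 0))\<^sup>2 * measure lborel V"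
    have bb: "bm \<le> b0"
    proof -
      interpret sh: shell \<Omega> "Lr x" by (rule shell_r[OF ax])
      have one: "bergman_inner (Ar x) (\<lambda>z. 1) f = of_real (1 / sqrt (Kr x z0))"
        using f(4)[of "\<lambda>z. 1"] sh.hspace_one hspace_eq[OF ax] by simp
      have "cmod (f 0) * measure lborel (Ar x) = 1 / sqrt K0"
        unfolding K0_def using f(1) hspace_eq[OF ax] by (intro sh.extremal_at_origin one zO) simp
      then have "1 / sqrt K0 \<le> cmod (f 0) * measure lborel \<Omega>"
        using mult_left_mono[OF measure_Ar_le, of "cmod (f 0)" x] by simp
      moreover have "1 / M2 \<le> 1 / sqrt K0" using sK K0 M2 by (intro divide_left_mono) auto
      ultimately have "1 / M2 \<le> cmod (f 0) * measure lborel \<Omega>" by linarith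
      then have "(1 / M2) * \<kappa> \<le> cmod (f 0) * measure lborel \<Omega> * \<kappa>" using \<kappa> by (intro mult_right_mono) auto
      then have "\<kappa> / M2 \<le> cmod (f 0)" using measure_\<Omega>_pos by (simp add: \<kappa>_def mult.commute)
      then have "(\<kappa> / M2)\<^sup>2 \<le> (cmod (f 0))\<^sup>2" using \<kappa> M2 by (intro power_mono) auto
      then show ?thesis unfolding bm_def b0_def by (intro mult_right_mono) auto
    qed
    obtain \<alpha> where \<alpha>: "\<alpha> \<ge> real N * b0 * x ^ (N - 1)"
      "\<And>y. 0 < y \<Longrightarrow> y < r1 \<Longrightarrow> sqn (Lr y) f \<ge> sqn (Lr x) f + \<alpha> * (y - x) + b0 * x ^ (N - 2) * (y - x)\<^sup>2"
      by (rule Q_lower[OF r1 sqint_holD(1)[OF f(1)] x0 x(2), folded N_def b0_def]) (rule that)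
    have a\<alpha>: "\<alpha>0 \<le> \<alpha>"
    proof -
      have "real N * bm * s ^ (N - 1) \<le> real N * b0 * x ^ (N - 1)"
        using bb bm s x by (intro mult_mono power_mono) auto
      then show ?thesis using \<alpha>(1) by (simp add: \<alpha>0_def)
    qed
    have mmle: "mm \<le> b0 * x ^ (N - 2)"
      unfolding mm_def using bb bm s x by (intro mult_mono power_mono) auto
    have Qm: "sqn (Lr y) f \<ge> sqn (Lr x) f + \<alpha> * (y - x) + mm * (y - x)\<^sup>2" if "0 < y" "y < r1" for y
      using \<alpha>(2)[OF that] mult_right_mono[OF mmle, of "(y - x)\<^sup>2"] by simp
    \<comment> \<open>On the boundary the factor cnj (cis t) cancels the parameter in
      \<open>lin_line\<close>, so the correction becomes a constant and \<phi> is holomorphic in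
      \<mu>.\<close>
    define \<phi> where "\<phi> = (\<lambda>\<mu>. f (z0 + \<mu> *s b) + of_real (c * (norm b)\<^sup>2))"
    define u where "u = (\<lambda>t. ln (Kr (\<rho> t) (z0 + cis t *s b)))"
    define L where "L = c\<^sup>2 * (norm b)\<^sup>2 * C3"
    have point: "(cmod (\<phi> (cis t)))\<^sup>2 * exp (\<alpha> * (\<rho> t - x) - L) \<le> Kr (\<rho> t) (z0 + cis t *s b)" for t
    proof -
      let ?w = "z0 + cis t *s b"
      have wO: "?w \<in> \<Omega>" by (rule disc) simp
      have ar: "adm (\<rho> t)" using adm_mono[OF r1, of "\<rho> t"] \<rho>[of t] by simp
      let ?h = "\<lambda>w. f w + (of_real c * cnj (cis t)) * lin z0 b w"
      have hN: "sqn (Ar (\<rho> t)) ?h \<le> 1 - \<alpha> * (\<rho> t - x) + L"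
        unfolding L_def C3_def
        by (rule competitor[OF r1 x0 x(2) zO f(1,2,4) less_imp_le[OF M1(1)] fM R(2) Qm mm])
          (use \<rho>[of t] c0 in auto)
      have hh: "?h \<in> sqint_hol"
      proof -
        have "cmod (lin z0 b w) \<le> norm b * (2 * R)" if "w \<in> \<Omega>" for w
        proof -
          have "norm (w - z0) \<le> 2 * R" using norm_triangle_ineq4[of w z0] R(2)[OF that] R(2)[OF zO] by linarith
          then show ?thesis using lin_bound[of z0 b w] mult_left_mono[of "norm (w - z0)" "2 * R" "norm b"] by simp
        qed
        then have "lin z0 b \<in> sqint_hol" by (rule sqint_hol_bounded(1)[OF hol_on_lin _ r1])
        then show ?thesis
          using f(1) shell.hspace_add[OF shell_r[OF r1]] shell.hspace_cmult[OF shell_r[OF r1]] hspace_eq[OF r1] by simp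
      qed
      have "?h ?w = \<phi> (cis t)"
      proof -
        have "of_real c * cnj (cis t) * (cis t * of_real ((norm b)\<^sup>2)) = of_real (c * (norm b)\<^sup>2) * (cis t * cnj (cis t))"
          by (simp only: of_real_mult ac_simps)
        also have "cis t * cnj (cis t) = 1" by (simp add: cis_cnj cis_mult)
        finally show ?thesis unfolding \<phi>_def lin_line by simp
      qed
      then have "(cmod (\<phi> (cis t)))\<^sup>2 \<le> Kr (\<rho> t) ?w * sqn (Ar (\<rho> t)) ?h"
        using Kr_eval[OF ar wO hh] by simp
      also have "\<dots> \<le> Kr (\<rho> t) ?w * exp (- (\<alpha> * (\<rho> t - x) - L))"
      proof (rule mult_left_mono)
        show "sqn (Ar (\<rho> t)) ?h \<le> exp (- (\<alpha> * (\<rho> t - x) - L))"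
          using hN exp_ge_add_one_self[of "- (\<alpha> * (\<rho> t - x) - L)"] by linarith
        show "0 \<le> Kr (\<rho> t) ?w" using Kr_pos[OF ar wO] by simp
      qed
      finally have le: "(cmod (\<phi> (cis t)))\<^sup>2 \<le> Kr (\<rho> t) ?w * exp (- (\<alpha> * (\<rho> t - x) - L))" .
      have "Kr (\<rho> t) ?w * exp (- p) * exp p = Kr (\<rho> t) ?w" for p by (simp add: exp_minus)
      with mult_right_mono[OF le exp_ge_zero, of "\<alpha> * (\<rho> t - x) - L"] show ?thesis by (simp only:)
    qed
    have \<phi>0: "\<phi> 0 = of_real (sqrt K0 + c * (norm b)\<^sup>2)" using f(3) by (simp add: \<phi>_def K0_def)
    have \<phi>0pos: "sqrt K0 + c * (norm b)\<^sup>2 > 0" using K0 c0 by (intro add_pos_nonneg) auto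
    define U where "U = {\<mu>. z0 + \<mu> *s b \<in> \<Omega>}"
    have U: "open U" "cball 0 1 \<subseteq> U" using open_slice[OF open_\<Omega>] disc by (auto simp: U_def)
    have hol\<phi>: "\<phi> holomorphic_on U"
      unfolding \<phi>_def U_def
      using hol_on_slice[OF sqint_holD(1)[OF f(1)], unfolded slice_hol_def, rule_format, of z0 b]
      by (intro holomorphic_intros)
    define X where "X = 2 * pi * ln ((cmod (\<phi> 0))\<^sup>2) + (\<alpha> * ((LINT t:{0..2*pi}|lborel. \<rho> t) - 2 * pi * x) - 2 * pi * L)"
    define Y where "Y = (LINT t:{0..2*pi}|lborel. u t)"
    have XY: "X \<le> Y + \<epsilon>" if \<epsilon>: "\<epsilon> > 0" for \<epsilon>
    proof -
      \<comment> \<open>\<delta> exp \<alpha> equals \<kappa> \<epsilon> / (2 pi), and \<kappa> is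
        below the kernel, so \<delta> costs at most \<epsilon> / (2 pi) after taking
        logarithms.\<close>
      define \<delta> where "\<delta> = \<epsilon> * \<kappa> / (2 * pi * exp \<alpha>)"
      have \<delta>: "\<delta> > 0" using \<epsilon> \<kappa> by (simp add: \<delta>_def)
      let ?l = "\<lambda>t. ln ((cmod (\<phi> (cis t)))\<^sup>2 + \<delta>)"
      have \<phi>0n: "\<phi> 0 \<noteq> 0" unfolding \<phi>0 using \<phi>0pos by (simp only: of_real_eq_0_iff)
      note J = Jensen_inequality_circle[OF hol\<phi> U \<phi>0n \<delta>]
      have pw: "?l t + (\<alpha> * (\<rho> t - x) - L) \<le> u t + \<epsilon> / (2 * pi)" for t
      proof -
        let ?w = "z0 + cis t *s b"
        let ?K = "Kr (\<rho> t) ?w"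
        let ?E = "exp (\<alpha> * (\<rho> t - x) - L)"
        have wO: "?w \<in> \<Omega>" by (rule disc) simp
        have ar: "adm (\<rho> t)" using adm_mono[OF r1, of "\<rho> t"] \<rho>[of t] by simp
        have Kp: "?K > 0" "\<kappa> \<le> ?K" using Kr_pos[OF ar wO] Kr_lower[OF ar wO] by (auto simp: \<kappa>_def)
        have "\<alpha> * (\<rho> t - x) - L \<le> \<alpha> * 1 - 0"
        proof (rule diff_mono)
          show "\<alpha> * (\<rho> t - x) \<le> \<alpha> * 1"
            using a\<alpha> \<alpha>0 \<rho>[of t] r1 x0 by (intro mult_left_mono) (auto simp: adm_def)
          show "0 \<le> L" using C3 by (simp add: L_def)
        qed
        then have E: "?E \<le> exp \<alpha>" by simp
        have "((cmod (\<phi> (cis t)))\<^sup>2 + \<delta>) * ?E \<le> ?K + \<delta> * exp \<alpha>"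
          unfolding distrib_right by (intro add_mono point mult_left_mono E) (use \<delta> in simp)
        also have "\<delta> * exp \<alpha> = \<kappa> * (\<epsilon> / (2 * pi))" by (simp add: \<delta>_def)
        also have "\<kappa> * (\<epsilon> / (2 * pi)) \<le> ?K * (\<epsilon> / (2 * pi))" using Kp \<epsilon> by (intro mult_right_mono) auto
        also have "?K + ?K * (\<epsilon> / (2 * pi)) = ?K * (1 + \<epsilon> / (2 * pi))" by (simp add: distrib_left)
        also have "\<dots> \<le> ?K * exp (\<epsilon> / (2 * pi))"
          using Kp exp_ge_add_one_self[of "\<epsilon> / (2 * pi)"] by (intro mult_left_mono) auto
        finally have le: "((cmod (\<phi> (cis t)))\<^sup>2 + \<delta>) * ?E \<le> ?K * exp (\<epsilon> / (2 * pi))" by simp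
        have p: "(cmod (\<phi> (cis t)))\<^sup>2 + \<delta> > 0" using \<delta> by (intro add_nonneg_pos) auto
        have "ln (((cmod (\<phi> (cis t)))\<^sup>2 + \<delta>) * ?E) \<le> ln (?K * exp (\<epsilon> / (2 * pi)))"
          using le p Kp by (subst ln_le_cancel_iff) auto
        then show ?thesis using p Kp by (simp add: ln_mult u_def)
      qed
      have ic: "set_integrable lborel {0..2*pi} (\<lambda>t. k)" for k :: real
        unfolding set_integrable_def by (intro borel_integrable_compact) auto
      have i1: "set_integrable lborel {0..2*pi} (\<lambda>t. \<alpha> * (\<rho> t - x) - L)"
        using i\<rho> ic by (intro set_integral_diff(1) set_integrable_mult_right) auto
      have "(LINT t:{0..2*pi}|lborel. ?l t + (\<alpha> * (\<rho> t - x) - L)) \<le> (LINT t:{0..2*pi}|lborel. u t + \<epsilon> / (2 * pi))"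
        using iu J(2) i1 ic by (intro set_integral_mono pw set_integral_add(1)) (auto simp: u_def)
      moreover have "(LINT t:{0..2*pi}|lborel. u t + \<epsilon> / (2 * pi)) = Y + \<epsilon>"
        using iu ic[of "\<epsilon> / (2 * pi)"] by (simp add: Y_def u_def set_integral_const)
      moreover have "(LINT t:{0..2*pi}|lborel. ?l t + (\<alpha> * (\<rho> t - x) - L)) =
        (LINT t:{0..2*pi}|lborel. ?l t) + (\<alpha> * ((LINT t:{0..2*pi}|lborel. \<rho> t) - 2 * pi * x) - 2 * pi * L)"
      proof -
        have "(LINT t:{0..2*pi}|lborel. \<alpha> * (\<rho> t - x) - L) = \<alpha> * ((LINT t:{0..2*pi}|lborel. \<rho> t) - 2 * pi * x) - 2 * pi * L"
          using i\<rho> ic[of x] ic[of L] by (simp add: set_integral_const)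
        then show ?thesis using J(2) i1 by simp
      qed
      ultimately show ?thesis using J(1) by (simp add: X_def)
    qed
    have XY': "X \<le> Y" by (rule field_le_epsilon[OF XY])
    have "e * (2 * pi) * \<alpha>0 \<le> \<alpha> * ((LINT t:{0..2*pi}|lborel. \<rho> t) - 2 * pi * x)"
    proof -
      have "\<alpha>0 * (2 * pi * e) \<le> \<alpha> * ((LINT t:{0..2*pi}|lborel. \<rho> t) - 2 * pi * x)"
        using e a\<alpha> \<alpha>0 by (intro mult_mono) (auto simp: algebra_simps)
      then show ?thesis by (simp add: ac_simps)
    qed
    moreover have "ln K0 + c * (norm b)\<^sup>2 / M2 \<le> ln ((cmod (\<phi> 0))\<^sup>2)"
    proof -
      \<comment> \<open>ln (1 + s0) >= s0 - s0^2 >= s0 / 2 for s0 <= 1/2, and the square of the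
        modulus restores the factor 2.\<close>
      define s0 where "s0 = c * (norm b)\<^sup>2 / sqrt K0"
      have bR: "norm b \<le> 2 * R"
        using norm_triangle_ineq4[of "z0 + 1 *s b" z0] R(2)[OF disc[of 1]] R(2)[OF zO] by simp
      have "(norm b)\<^sup>2 \<le> 4 * R\<^sup>2" using power_mono[OF bR, of 2] by (simp add: power_mult_distrib)
      then have "c * (norm b)\<^sup>2 \<le> c * (4 * R\<^sup>2)" using c0 by (intro mult_left_mono) auto
      then have "c * (norm b)\<^sup>2 \<le> sqrt K0 / 2" using c1 sK by linarith
      then have s01: "0 \<le> s0" "s0 \<le> 1 / 2" using c0 K0 by (auto simp: s0_def field_simps)
      have "s0 * s0 \<le> (1 / 2) * s0" using s01 by (intro mult_right_mono) auto
      then have "s0 / 2 \<le> ln (1 + s0)"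
        using ln_one_plus_pos_lower_bound[of s0] s01 by (simp add: power2_eq_square)
      moreover have "c * (norm b)\<^sup>2 / M2 \<le> s0"
        unfolding s0_def using sK K0 M2 c0 by (intro divide_left_mono) auto
      moreover have "ln ((cmod (\<phi> 0))\<^sup>2) = ln K0 + 2 * ln (1 + s0)"
      proof -
        have "(cmod (\<phi> 0))\<^sup>2 = (sqrt K0 + c * (norm b)\<^sup>2)\<^sup>2" unfolding \<phi>0 norm_of_real by simp
        also have "sqrt K0 + c * (norm b)\<^sup>2 = sqrt K0 * (1 + s0)" using K0 by (simp add: s0_def distrib_left)
        also have "\<dots>\<^sup>2 = K0 * (1 + s0)\<^sup>2" using K0 by (simp add: power_mult_distrib)
        finally show ?thesis using K0 s01 by (simp add: ln_mult ln_realpow)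
      qed
      ultimately show ?thesis by linarith
    qed
    then have "2 * pi * (ln K0 + c * (norm b)\<^sup>2 / M2) \<le> 2 * pi * ln ((cmod (\<phi> 0))\<^sup>2)"
      by (intro mult_left_mono) auto
    ultimately have "2 * pi * (ln K0 + c * (norm b)\<^sup>2 / M2) + e * (2 * pi) * \<alpha>0 - 2 * pi * L \<le> Y"
      using XY' unfolding X_def by linarith
    moreover have "2 * pi * (ln K0 + c * (norm b)\<^sup>2 / M2) + e * (2 * pi) * \<alpha>0 - 2 * pi * L
      = 2 * pi * (ln K0 + \<alpha>0 * e + \<beta>0 * (norm b)\<^sup>2)"
      by (simp add: L_def \<beta>0_def algebra_simps)
    ultimately show "2 * pi * (ln (Kr x z0) + \<alpha>0 * e + \<beta>0 * (norm b)\<^sup>2)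
        \<le> (LINT t:{0..2*pi}|lborel. ln (Kr (\<rho> t) (z0 + cis t *s b)))"
      by (simp add: Y_def u_def K0_def)
  qed
qed

end

subsection \<open>Discs in the total space\<close>

lemma usc_onD:
  assumes "usc_on S u" "a \<in> S" "u a < c"
  obtains T where "open T" "a \<in> T" "\<And>x. x \<in> T \<Longrightarrow> x \<in> S \<Longrightarrow> u x < c"
proof -
  have "\<forall>\<^sub>F x in at a within S. u x < c" using assms by (simp add: usc_on_def)
  then obtain T where "open T" "a \<in> T" "\<And>x. x \<in> T \<Longrightarrow> x \<noteq> a \<Longrightarrow> x \<in> S \<Longrightarrow> u x < c"
    unfolding eventually_at_topological by blast
  then show thesis using that[of T] assms(3) by metis
qed

lemma usc_onI:
  assumes "\<And>a c. a \<in> S \<Longrightarrow> u a < c \<Longrightarrow> \<exists>T. open T \<and> a \<in> T \<and> (\<forall>x\<in>T \<inter> S. u x < c)"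
  shows "usc_on S u"
  unfolding usc_on_def eventually_at_topological using assms by (metis IntI)

lemma continuous_on_circle: "continuous_on X (\<lambda>t. a + cis t *s (b :: complex ^ 'k))"
  unfolding cis_conv_exp by (intro continuous_intros)

lemma usc_circle_measurable:
  fixes u :: "complex ^ 'k \<Rightarrow> real"
  assumes u: "usc_on S u" and S: "\<And>t. a + cis t *s b \<in> S"
  shows "set_borel_measurable lborel {0..2*pi} (\<lambda>t. u (a + cis t *s b))"
proof -
  have "open {t. u (a + cis t *s b) < c}" for c
    unfolding open_subopen[of "{t. u (a + cis t *s b) < c}"]
  proof
    fix t assume "t \<in> {t. u (a + cis t *s b) < c}"
    then obtain T where T: "open T" "a + cis t *s b \<in> T" "\<And>x. x \<in> T \<Longrightarrow> x \<in> S \<Longrightarrow> u x < c"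
      using usc_onD[OF u S] by blast
    have "open ((\<lambda>t. a + cis t *s b) -` T)" by (rule open_vimage[OF T(1) continuous_on_circle])
    then show "\<exists>T. open T \<and> t \<in> T \<and> T \<subseteq> {t. u (a + cis t *s b) < c}"
      using T S by (intro exI[of _ "(\<lambda>t. a + cis t *s b) -` T"]) auto
  qed
  then have "(\<lambda>t. u (a + cis t *s b)) \<in> borel_measurable borel"
    by (intro borel_measurableI_less) auto
  then show ?thesis by (simp add: set_borel_measurable_def)
qed

text \<open>The cross terms carry a factor cis t and average to 0. The excess (norm b)^2 translates
  plurisubharmonicity of u - \<epsilon> |z|^2 into a gain \<epsilon> (norm b)^2 for u.\<close>

lemma circle_norm_square:
  fixes a b :: "complex ^ 'k"
  shows "set_integrable lborel {0..2*pi} (\<lambda>t. (norm (a + cis t *s b))\<^sup>2)"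
    and "(LINT t:{0..2*pi}|lborel. (norm (a + cis t *s b))\<^sup>2) = 2 * pi * ((norm a)\<^sup>2 + (norm b)\<^sup>2)"
proof -
  show "set_integrable lborel {0..2*pi} (\<lambda>t. (norm (a + cis t *s b))\<^sup>2)"
    unfolding set_integrable_def
    by (intro borel_integrable_compact continuous_on_power continuous_on_norm continuous_on_circle) auto
  have nv: "(norm v)\<^sup>2 = (\<Sum>j\<in>UNIV. (cmod (v $ j))\<^sup>2)" for v :: "complex ^ 'k"
    by (simp add: norm_vec_def L2_set_def sum_nonneg)
  define q where "q = (\<Sum>j\<in>UNIV. b $ j * cnj (a $ j))"
  have e: "(norm (a + cis t *s b))\<^sup>2 = ((norm a)\<^sup>2 + (norm b)\<^sup>2) + Re (2 * cis t * q)" for t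
  proof -
    have "(cmod ((a + cis t *s b) $ j))\<^sup>2 = (cmod (a $ j))\<^sup>2 + (cmod (b $ j))\<^sup>2 + Re (2 * cis t * (b $ j * cnj (a $ j)))" for j
    proof -
      have "(cmod (x + y))\<^sup>2 = (cmod x)\<^sup>2 + (cmod y)\<^sup>2 + Re (2 * (y * cnj x))" for x y
        unfolding cmod_power2 by (simp add: power2_eq_square algebra_simps)
      then have "(cmod (a $ j + cis t * b $ j))\<^sup>2 = (cmod (a $ j))\<^sup>2 + (cmod (cis t * b $ j))\<^sup>2 + Re (2 * (cis t * b $ j * cnj (a $ j)))" .
      then show ?thesis by (simp add: norm_mult mult.assoc)
    qed
    then have "(norm (a + cis t *s b))\<^sup>2 = (\<Sum>j\<in>UNIV. (cmod (a $ j))\<^sup>2 + (cmod (b $ j))\<^sup>2 + Re (2 * cis t * (b $ j * cnj (a $ j))))"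
      unfolding nv by simp
    also have "\<dots> = ((norm a)\<^sup>2 + (norm b)\<^sup>2) + (\<Sum>j\<in>UNIV. Re (2 * cis t * (b $ j * cnj (a $ j))))"
      unfolding nv by (simp only: sum.distrib)
    also have "(\<Sum>j\<in>UNIV. Re (2 * cis t * (b $ j * cnj (a $ j)))) = Re (2 * cis t * q)"
      unfolding q_def sum_distrib_left Re_sum ..
    finally show ?thesis .
  qed
  have ci: "integrable lborel (\<lambda>t. indicator {0..2*pi} t *\<^sub>R (2 * cis t * q))"
    unfolding cis_conv_exp by (intro borel_integrable_compact continuous_intros) auto
  have Z: "(LINT t:{0..2*pi}|lborel. 2 * cis t * q) = (2 * pi) *\<^sub>R (2 * 0 * q)"
    by (rule circle_mean_holomorphic[of "\<lambda>\<mu>. 2 * \<mu> * q" UNIV]) (auto intro!: holomorphic_intros)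
  have "Re (LINT t|lborel. indicator {0..2*pi} t *\<^sub>R (2 * cis t * q)) = 0"
    unfolding Z[unfolded set_lebesgue_integral_def] by simp
  then have "(LINT t|lborel. Re (indicator {0..2*pi} t *\<^sub>R (2 * cis t * q))) = 0"
    by (subst integral_Re[OF ci])
  then have r0: "(LINT t:{0..2*pi}|lborel. Re (2 * cis t * q)) = 0"
    by (simp add: set_lebesgue_integral_def)
  have ri: "set_integrable lborel {0..2*pi} (\<lambda>t. Re (2 * cis t * q))"
    unfolding set_integrable_def cis_conv_exp by (intro borel_integrable_compact continuous_intros) auto
  have ki: "set_integrable lborel {0..2*pi} (\<lambda>t. (norm a)\<^sup>2 + (norm b)\<^sup>2)"
    unfolding set_integrable_def by (intro borel_integrable_compact continuous_intros) auto
  show "(LINT t:{0..2*pi}|lborel. (norm (a + cis t *s b))\<^sup>2) = 2 * pi * ((norm a)\<^sup>2 + (norm b)\<^sup>2)"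
    unfolding e set_integral_add(2)[OF ki ri] r0 by (subst set_integral_const) auto
qed

lemma part_simps:
  fixes a b :: "complex ^ ('m::finite + 'n::finite)"
  shows "fst_part (a + c *s b) = fst_part a + c *s fst_part b" "snd_part (a + c *s b) = snd_part a + c *s snd_part b"
    "fst_part (r *\<^sub>R b) = r *\<^sub>R fst_part b" "snd_part (r *\<^sub>R b) = r *\<^sub>R snd_part b"
  by (simp_all add: fst_part_def snd_part_def vec_eq_iff)

lemma norm_parts:
  fixes a :: "complex ^ ('m::finite + 'n::finite)"
  shows "(norm a)\<^sup>2 = (norm (fst_part a))\<^sup>2 + (norm (snd_part a))\<^sup>2"
proof -
  have "(\<Sum>j\<in>UNIV. (cmod (a $ j))\<^sup>2) = (\<Sum>j\<in>UNIV. (cmod (a $ Inl j))\<^sup>2) + (\<Sum>j\<in>UNIV. (cmod (a $ Inr j))\<^sup>2)"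
    using sum.Plus[of "UNIV :: 'm set" "UNIV :: 'n set" "\<lambda>j. (cmod (a $ j))\<^sup>2"] by (simp add: o_def)
  then show ?thesis by (simp add: norm_vec_def L2_set_def sum_nonneg fst_part_def snd_part_def)
qed

lemma continuous_parts: "continuous_on X fst_part" "continuous_on X snd_part"
  unfolding fst_part_def[abs_def] snd_part_def[abs_def] by (intro continuous_intros)+

lemma parts_eq_0: "b = 0 \<longleftrightarrow> fst_part b = 0 \<and> snd_part b = 0"
proof -
  have "(norm b)\<^sup>2 = 0 \<longleftrightarrow> fst_part b = 0 \<and> snd_part b = 0"
    unfolding norm_parts sum_power2_eq_zero_iff by simp
  then show ?thesis by simp
qed

section \<open>The family of shells over the base\<close>

locale hartogs_family = ccd \<Omega> for \<Omega> :: "(complex ^ 'n) set" +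
  fixes U :: "(complex ^ 'm) set" and \<rho> :: "complex ^ 'm \<Rightarrow> real"
  assumes open_U: "open U" and \<rho>_usc: "usc_on U \<rho>" and \<rho>_adm: "\<And>\<zeta>. \<zeta> \<in> U \<Longrightarrow> adm (\<rho> \<zeta>)"
begin

lemma log_K_eq: "log_K \<rho> \<Omega> w = ln (Kr (\<rho> (fst_part w)) (snd_part w))"
  by (simp add: log_K_def annulus_def closure_shrunk)

lemma \<rho>_pos: "\<zeta> \<in> U \<Longrightarrow> 0 < \<rho> \<zeta>" using \<rho>_adm by (auto simp: adm_def)

lemma open_cprod: "open (cprod U \<Omega>)"
proof -
  have "open (fst_part -` U \<inter> snd_part -` \<Omega>)"
    by (intro open_Int open_vimage continuous_parts open_U open_\<Omega>)
  moreover have "fst_part -` U \<inter> snd_part -` \<Omega> = cprod U \<Omega>" by (auto simp: cprod_def)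
  ultimately show ?thesis by simp
qed

text \<open>A radius slightly above the value of \<rho> at the centre dominates \<rho> nearby, and
  \<open>Kr_usc\<close> covers all radii up to it.\<close>

lemma log_K_usc: "usc_on (cprod U \<Omega>) (log_K \<rho> \<Omega>)"
proof (rule usc_onI)
  fix a c assume "a \<in> cprod U \<Omega>" and c: "log_K \<rho> \<Omega> a < c"
  then have a: "fst_part a \<in> U" "snd_part a \<in> \<Omega>" by (auto simp: cprod_def)
  have "Kr (\<rho> (fst_part a)) (snd_part a) < exp c"
    using c Kr_pos[OF \<rho>_adm[OF a(1)] a(2)] unfolding log_K_eq by (metis exp_less_mono exp_ln)
  from Kr_usc[OF \<rho>_adm[OF a(1)] a(2) this] obtain r' d where r': "r' > \<rho> (fst_part a)" "d > 0"
    "\<And>z s. z \<in> ball (snd_part a) d \<Longrightarrow> 0 < s \<Longrightarrow> s \<le> r' \<Longrightarrow> Kr s z < exp c" by metis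
  obtain T where T: "open T" "fst_part a \<in> T" "\<And>x. x \<in> T \<Longrightarrow> x \<in> U \<Longrightarrow> \<rho> x < r'"
    using usc_onD[OF \<rho>_usc a(1) r'(1)] by blast
  let ?W = "fst_part -` T \<inter> snd_part -` ball (snd_part a) d"
  have "open ?W" by (intro open_Int open_vimage continuous_parts T(1) open_ball)
  moreover have "a \<in> ?W" using T r' by simp
  moreover have "log_K \<rho> \<Omega> x < c" if "x \<in> ?W \<inter> cprod U \<Omega>" for x
  proof -
    have x: "fst_part x \<in> U" "snd_part x \<in> \<Omega>" "\<rho> (fst_part x) < r'" "snd_part x \<in> ball (snd_part a) d"
      using that T by (auto simp: cprod_def)
    have "Kr (\<rho> (fst_part x)) (snd_part x) < exp c" using r'(3)[OF x(4) \<rho>_pos[OF x(1)]] x(3) by simp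
    then show ?thesis
      using Kr_pos[OF \<rho>_adm[OF x(1)] x(2)] unfolding log_K_eq by (metis ln_exp ln_less_cancel_iff exp_gt_zero)
  qed
  ultimately show "\<exists>T. open T \<and> a \<in> T \<and> (\<forall>x\<in>T \<inter> cprod U \<Omega>. log_K \<rho> \<Omega> x < c)" by blast
qed

text \<open>Finitely many neighbourhoods cover C, each with an admissible radius above \<rho>. Their
  maximum is one of these radii, hence admissible. For empty C an admissible radius is produced
  directly.\<close>

lemma \<rho>_bound_compact:
  assumes "compact C" "C \<subseteq> U"
  obtains r1 where "adm r1" "\<And>\<zeta>. \<zeta> \<in> C \<Longrightarrow> \<rho> \<zeta> < r1"
proof (cases "C = {}")
  case True
  obtain r where "adm r"
  proof -
    obtain e where e: "e > 0" "ball 0 e \<subseteq> \<Omega>" using open_\<Omega> zero_\<Omega> open_contains_ball by blast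
    obtain R where R: "R > 0" "\<And>w. w \<in> V \<Longrightarrow> norm w \<le> R"
      using compact_imp_bounded[OF compact_V] bounded_pos by metis
    define r where "r = min (1/2) (e / (2 * R))"
    have r: "0 < r" "r < 1" "r \<le> e / (2 * R)" using e R by (auto simp: r_def)
    have "Lr r \<subseteq> \<Omega>"
    proof
      fix z assume "z \<in> Lr r"
      then obtain w where w: "w \<in> V" "z = r *\<^sub>R w" by (auto simp: shrunk_def)
      have "norm z = r * norm w" using r w by simp
      also have "\<dots> \<le> e / (2 * R) * R" using r R w e by (intro mult_mono) auto
      also have "\<dots> < e" using e R by simp
      finally show "z \<in> \<Omega>" using e(2) by auto
    qed
    then show thesis using that r by (simp add: adm_def)
  qed
  then show thesis using that True by blast
next
  case False
  have "\<exists>r T. adm r \<and> open T \<and> \<zeta> \<in> T \<and> (\<forall>x\<in>T \<inter> U. \<rho> x < r)" if \<zeta>: "\<zeta> \<in> C" for \<zeta>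
  proof -
    have \<zeta>U: "\<zeta> \<in> U" using \<zeta> assms by blast
    obtain r where r: "r > \<rho> \<zeta>" "adm r" using adm_larger[OF \<rho>_adm[OF \<zeta>U]] .
    show ?thesis using usc_onD[OF \<rho>_usc \<zeta>U r(1)] r(2) by (metis IntD1 IntD2)
  qed
  then obtain r T where rT: "\<And>\<zeta>. \<zeta> \<in> C \<Longrightarrow> adm (r \<zeta>) \<and> open (T \<zeta>) \<and> \<zeta> \<in> T \<zeta> \<and> (\<forall>x\<in>T \<zeta> \<inter> U. \<rho> x < r \<zeta>)" by metis
  have cov: "C \<subseteq> (\<Union>\<zeta>\<in>C. T \<zeta>)" using rT by blast
  have opT: "\<And>\<zeta>. \<zeta> \<in> C \<Longrightarrow> open (T \<zeta>)" using rT by blast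
  obtain D where D: "D \<subseteq> C" "finite D" "C \<subseteq> (\<Union>\<zeta>\<in>D. T \<zeta>)"
    by (rule compactE_image[OF assms(1) opT cov])
  have "D \<noteq> {}" using D False by auto
  then have "Max (r ` D) \<in> r ` D" using D by simp
  then obtain \<xi> where \<xi>: "\<xi> \<in> D" "Max (r ` D) = r \<xi>" by auto
  then have "\<xi> \<in> C" using D(1) by blast
  then have "adm (Max (r ` D))" using rT[of \<xi>] \<xi>(2) by simp
  moreover have "\<rho> \<zeta> < Max (r ` D)" if \<zeta>: "\<zeta> \<in> C" for \<zeta>
  proof -
    obtain \<xi> where \<xi>: "\<xi> \<in> D" "\<zeta> \<in> T \<xi>" using D \<zeta> by blast
    then have "\<rho> \<zeta> < r \<xi>" using rT D assms \<zeta> by blast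
    also have "\<dots> \<le> Max (r ` D)" using D \<xi> by simp
    finally show ?thesis .
  qed
  ultimately show thesis using that by blast
qed

lemma compact_disc: "compact ((\<lambda>\<mu>. a + \<mu> *s (b :: complex ^ 'k)) ` cball 0 1)"
  by (intro compact_continuous_image continuous_intros compact_cball)

text \<open>Semicontinuity gives measurability. The kernel lies between the reciprocal volume of
  \<open>\<Omega>\<close> and the kernel for a radius dominating \<rho> on the disc, which is
  bounded on compact sets.\<close>

lemma log_K_circle_integrable:
  assumes disc: "\<And>c. cmod c \<le> 1 \<Longrightarrow> a + c *s b \<in> cprod U \<Omega>"
  shows "set_integrable lborel {0..2*pi} (\<lambda>t. log_K \<rho> \<Omega> (a + cis t *s b))"
proof -
  have d: "fst_part a + c *s fst_part b \<in> U" "snd_part a + c *s snd_part b \<in> \<Omega>" if "cmod c \<le> 1" for c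
    using disc[OF that] by (auto simp: cprod_def part_simps)
  let ?C1 = "(\<lambda>\<mu>. fst_part a + \<mu> *s fst_part b) ` cball 0 1"
  let ?C2 = "(\<lambda>\<mu>. snd_part a + \<mu> *s snd_part b) ` cball 0 1"
  have sub1: "?C1 \<subseteq> U" and sub2: "?C2 \<subseteq> \<Omega>" using d by auto
  obtain r1 where r1: "adm r1" "\<And>\<zeta>. \<zeta> \<in> ?C1 \<Longrightarrow> \<rho> \<zeta> < r1"
    by (rule \<rho>_bound_compact[OF compact_disc sub1]) (rule that)
  obtain M where M: "M > 0" "\<And>z. z \<in> ?C2 \<Longrightarrow> Kr r1 z \<le> M\<^sup>2"
    by (rule Kr_bound_compact[OF r1(1) compact_disc sub2]) (rule that)
  define B where "B = \<bar>ln (1 / measure lborel \<Omega>)\<bar> + \<bar>ln (M\<^sup>2)\<bar>"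
  show ?thesis
  proof (rule set_integrable_bound)
    show "set_integrable lborel {0..2*pi} (\<lambda>t. B)"
      unfolding set_integrable_def by (intro borel_integrable_compact) auto
    show "set_borel_measurable lborel {0..2*pi} (\<lambda>t. log_K \<rho> \<Omega> (a + cis t *s b))"
      by (rule usc_circle_measurable[OF log_K_usc]) (rule disc, simp)
    have "\<bar>log_K \<rho> \<Omega> (a + cis t *s b)\<bar> \<le> B" for t
    proof -
      let ?\<zeta> = "fst_part a + cis t *s fst_part b" and ?z = "snd_part a + cis t *s snd_part b"
      have c: "?\<zeta> \<in> U" "?z \<in> \<Omega>" using d[of "cis t"] by auto
      have "?\<zeta> \<in> ?C1" "?z \<in> ?C2" by auto
      then have k1: "Kr (\<rho> ?\<zeta>) ?z \<le> M\<^sup>2"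
        using order_trans[OF Kr_mono[OF r1(1) \<rho>_pos[OF c(1)] less_imp_le[OF r1(2)] c(2)] M(2)] by blast
      have k2: "1 / measure lborel \<Omega> \<le> Kr (\<rho> ?\<zeta>) ?z" by (rule Kr_lower[OF \<rho>_adm[OF c(1)] c(2)])
      have k3: "0 < 1 / measure lborel \<Omega>" using measure_\<Omega>_pos by simp
      note k4 = less_le_trans[OF k3 k2]
      have "ln (1 / measure lborel \<Omega>) \<le> ln (Kr (\<rho> ?\<zeta>) ?z)" "ln (Kr (\<rho> ?\<zeta>) ?z) \<le> ln (M\<^sup>2)"
        by (rule iffD2[OF ln_le_cancel_iff[OF k3 k4] k2], rule iffD2[OF ln_le_cancel_iff[OF k4 less_le_trans[OF k4 k1]] k1])
      then show ?thesis unfolding log_K_eq part_simps B_def by linarith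
    qed
    then show "AE t in lborel. t \<in> {0..2*pi} \<longrightarrow> norm (log_K \<rho> \<Omega> (a + cis t *s b)) \<le> norm B"
      by (intro AE_I2) (simp add: order_trans[OF _ abs_ge_self])
  qed
qed

text \<open>\<open>kernel_disc_estimate\<close> transferred to discs with centre a and direction b
  in the product; e is a lower bound for the excess of the circle mean of \<rho> over its central
  value. The predicate fixes the constants before the discs are chosen.\<close>

definition disc_estimate :: "real \<Rightarrow> (complex ^ 'n) set \<Rightarrow> real \<Rightarrow> real \<Rightarrow> real \<Rightarrow> bool" where
  "disc_estimate r1 C s \<alpha> \<beta> \<longleftrightarrow> (\<forall>a b e. snd_part a \<in> C \<and> s \<le> \<rho> (fst_part a) \<and>
      (\<forall>c. cmod c \<le> 1 \<longrightarrow> a + c *s b \<in> cprod U \<Omega> \<and> \<rho> (fst_part a + c *s fst_part b) < r1) \<and>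
      set_integrable lborel {0..2*pi} (\<lambda>t. \<rho> (fst_part a + cis t *s fst_part b)) \<and>
      0 \<le> e \<and> \<rho> (fst_part a) + e \<le> circle_mean \<rho> (fst_part a) (fst_part b) \<longrightarrow>
      log_K \<rho> \<Omega> a + \<alpha> * e + \<beta> * (norm (snd_part b))\<^sup>2 \<le> circle_mean (log_K \<rho> \<Omega>) a b)"

lemma disc_estimate_exists:
  assumes r1: "adm r1" and C: "compact C" "C \<subseteq> \<Omega>" and s: "0 < s"
  obtains \<alpha> \<beta> where "\<alpha> > 0" "\<beta> > 0" "disc_estimate r1 C s \<alpha> \<beta>"
proof (rule kernel_disc_estimate[OF r1 C s])
  fix \<alpha> \<beta> :: real
  assume ab: "\<alpha> > 0" "\<beta> > 0" and
    key: "\<And>z0 x b \<rho> e. z0 \<in> C \<Longrightarrow> s \<le> x \<Longrightarrow> x < r1 \<Longrightarrow> (\<And>\<xi>. cmod \<xi> \<le> 1 \<Longrightarrow> z0 + \<xi> *s b \<in> \<Omega>) \<Longrightarrow>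
      (\<And>t. 0 < \<rho> t \<and> \<rho> t < r1) \<Longrightarrow> set_integrable lborel {0..2*pi} \<rho> \<Longrightarrow>
      set_integrable lborel {0..2*pi} (\<lambda>t. ln (Kr (\<rho> t) (z0 + cis t *s b))) \<Longrightarrow>
      0 \<le> e \<Longrightarrow> 2 * pi * (x + e) \<le> (LINT t:{0..2*pi}|lborel. \<rho> t) \<Longrightarrow>
      2 * pi * (ln (Kr x z0) + \<alpha> * e + \<beta> * (norm b)\<^sup>2) \<le> (LINT t:{0..2*pi}|lborel. ln (Kr (\<rho> t) (z0 + cis t *s b)))"
  have "disc_estimate r1 C s \<alpha> \<beta>"
    unfolding disc_estimate_def
  proof (intro allI impI, elim conjE)
    fix a :: "complex ^ ('m + 'n)" and b and e :: real
    assume z: "snd_part a \<in> C" and s: "s \<le> \<rho> (fst_part a)"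
      and D: "\<forall>c. cmod c \<le> 1 \<longrightarrow> a + c *s b \<in> cprod U \<Omega> \<and> \<rho> (fst_part a + c *s fst_part b) < r1"
      and i: "set_integrable lborel {0..2*pi} (\<lambda>t. \<rho> (fst_part a + cis t *s fst_part b))"
      and e: "0 \<le> e" "\<rho> (fst_part a) + e \<le> circle_mean \<rho> (fst_part a) (fst_part b)"
    have disc: "a + c *s b \<in> cprod U \<Omega>" and lt: "\<rho> (fst_part a + c *s fst_part b) < r1" if "cmod c \<le> 1" for c
      using D that by blast+
    have d: "fst_part a + c *s fst_part b \<in> U" "snd_part a + c *s snd_part b \<in> \<Omega>" if "cmod c \<le> 1" for c
      using disc[OF that] by (auto simp: cprod_def part_simps)
    have "2 * pi * (ln (Kr (\<rho> (fst_part a)) (snd_part a)) + \<alpha> * e + \<beta> * (norm (snd_part b))\<^sup>2)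
      \<le> (LINT t:{0..2*pi}|lborel. ln (Kr (\<rho> (fst_part a + cis t *s fst_part b)) (snd_part a + cis t *s snd_part b)))"
    proof (rule key[OF z s _ _ _ i _ e(1)])
      show "\<rho> (fst_part a) < r1" using lt[of 0] by simp
      show "0 < \<rho> (fst_part a + cis t *s fst_part b) \<and> \<rho> (fst_part a + cis t *s fst_part b) < r1" for t
        using lt[of "cis t"] \<rho>_pos[OF d(1)[of "cis t"]] by simp
      show "set_integrable lborel {0..2*pi} (\<lambda>t. ln (Kr (\<rho> (fst_part a + cis t *s fst_part b)) (snd_part a + cis t *s snd_part b)))"
        using log_K_circle_integrable[OF disc] unfolding log_K_eq part_simps .
      show "2 * pi * (\<rho> (fst_part a) + e) \<le> (LINT t:{0..2*pi}|lborel. \<rho> (fst_part a + cis t *s fst_part b))"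
        using e(2) pi_gt_zero by (simp add: circle_mean_def field_simps)
    qed (use d in auto)
    then show "log_K \<rho> \<Omega> a + \<alpha> * e + \<beta> * (norm (snd_part b))\<^sup>2 \<le> circle_mean (log_K \<rho> \<Omega>) a b"
      using pi_gt_zero unfolding circle_mean_def log_K_eq part_simps by (simp add: field_simps)
  qed
  then show thesis using that ab by blast
qed

lemma disc_estimateD:
  assumes "disc_estimate r1 C s \<alpha> \<beta>" "snd_part a \<in> C" "s \<le> \<rho> (fst_part a)"
    "\<And>c. cmod c \<le> 1 \<Longrightarrow> a + c *s b \<in> cprod U \<Omega>"
    "\<And>c. cmod c \<le> 1 \<Longrightarrow> \<rho> (fst_part a + c *s fst_part b) < r1"
    "set_integrable lborel {0..2*pi} (\<lambda>t. \<rho> (fst_part a + cis t *s fst_part b))"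
    "0 \<le> e" "\<rho> (fst_part a) + e \<le> circle_mean \<rho> (fst_part a) (fst_part b)"
  shows "log_K \<rho> \<Omega> a + \<alpha> * e + \<beta> * (norm (snd_part b))\<^sup>2 \<le> circle_mean (log_K \<rho> \<Omega>) a b"
  using assms unfolding disc_estimate_def by blast

text \<open>The disc estimate with e = 0, as plurisubharmonicity of \<rho> provides a nonnegative
  excess. The constants may depend on the disc, so one point serves as C and the radius at the
  centre as s.\<close>

lemma log_K_psh:
  assumes \<rho>: "psh_on U \<rho>" shows "psh_on (cprod U \<Omega>) (log_K \<rho> \<Omega>)"
  unfolding psh_on_def
proof (intro conjI allI impI log_K_usc)
  fix a b assume d: "\<forall>c. cmod c \<le> 1 \<longrightarrow> a + c *s b \<in> cprod U \<Omega>"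
  then have disc: "\<And>c. cmod c \<le> 1 \<Longrightarrow> a + c *s b \<in> cprod U \<Omega>" by blast
  show "set_integrable lborel {0..2*pi} (\<lambda>t. log_K \<rho> \<Omega> (a + cis t *s b))" by (rule log_K_circle_integrable[OF disc])
  have dU: "fst_part a + c *s fst_part b \<in> U" "snd_part a + c *s snd_part b \<in> \<Omega>" if "cmod c \<le> 1" for c
    using disc[OF that] by (auto simp: cprod_def part_simps)
  have aU: "fst_part a \<in> U" "snd_part a \<in> \<Omega>" using dU[of 0] by auto
  have sub: "(\<lambda>\<mu>. fst_part a + \<mu> *s fst_part b) ` cball 0 1 \<subseteq> U" using dU by auto
  obtain r1 where r1: "adm r1" "\<And>\<zeta>. \<zeta> \<in> (\<lambda>\<mu>. fst_part a + \<mu> *s fst_part b) ` cball 0 1 \<Longrightarrow> \<rho> \<zeta> < r1"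
    by (rule \<rho>_bound_compact[OF compact_disc sub]) (rule that)
  have C: "compact {snd_part a}" "{snd_part a} \<subseteq> \<Omega>" using aU by auto
  obtain \<alpha> \<beta> where ab: "\<alpha> > 0" "\<beta> > 0" "disc_estimate r1 {snd_part a} (\<rho> (fst_part a)) \<alpha> \<beta>"
    by (rule disc_estimate_exists[OF r1(1) C \<rho>_pos[OF aU(1)]])
  have p: "set_integrable lborel {0..2*pi} (\<lambda>t. \<rho> (fst_part a + cis t *s fst_part b))"
    "\<rho> (fst_part a) \<le> circle_mean \<rho> (fst_part a) (fst_part b)"
    using \<rho> dU(1) unfolding psh_on_def by blast+
  have "log_K \<rho> \<Omega> a + \<alpha> * 0 + \<beta> * (norm (snd_part b))\<^sup>2 \<le> circle_mean (log_K \<rho> \<Omega>) a b"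
  proof (rule disc_estimateD[OF ab(3) _ _ disc _ p(1)])
    show "\<rho> (fst_part a + c *s fst_part b) < r1" if "cmod c \<le> 1" for c
      using that by (intro r1(2) imageI) simp
  qed (use p in auto)
  moreover have "0 \<le> \<beta> * (norm (snd_part b))\<^sup>2" using ab by simp
  ultimately show "log_K \<rho> \<Omega> a \<le> circle_mean (log_K \<rho> \<Omega>) a b" by linarith
qed

text \<open>The centre is fixed and the discs shrink, so one point again serves as C and s is \<rho>
  at the centre. In a vertical direction, where \<open>fst_part b\<close> is 0, \<rho> is constant
  on the disc and the gain comes from \<beta>; otherwise it comes from \<alpha> times the excess of
  \<rho>.\<close>

lemma log_K_strictly_psh:
  assumes \<rho>: "strictly_psh_on U \<rho>" shows "strictly_psh_on (cprod U \<Omega>) (log_K \<rho> \<Omega>)"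
  unfolding strictly_psh_on_def
proof (intro conjI ballI allI impI)
  have psh: "psh_on U \<rho>" using \<rho> by (simp add: strictly_psh_on_def)
  show "psh_on (cprod U \<Omega>) (log_K \<rho> \<Omega>)" by (rule log_K_psh[OF psh])
  fix a b :: "complex ^ ('m + 'n)" assume a: "a \<in> cprod U \<Omega>" and b: "b \<noteq> 0"
  have aU: "fst_part a \<in> U" "snd_part a \<in> \<Omega>" using a by (auto simp: cprod_def)
  obtain r1 where r1: "r1 > \<rho> (fst_part a)" "adm r1" using adm_larger[OF \<rho>_adm[OF aU(1)]] .
  obtain T where T: "open T" "fst_part a \<in> T" "\<And>x. x \<in> T \<Longrightarrow> x \<in> U \<Longrightarrow> \<rho> x < r1"
    using usc_onD[OF \<rho>_usc aU(1) r1(1)] by blast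
  have C: "compact {snd_part a}" "{snd_part a} \<subseteq> \<Omega>" using aU by auto
  obtain \<alpha> \<beta> where ab: "\<alpha> > 0" "\<beta> > 0" "disc_estimate r1 {snd_part a} (\<rho> (fst_part a)) \<alpha> \<beta>"
    by (rule disc_estimate_exists[OF r1(2) C \<rho>_pos[OF aU(1)]])
  have "open (cprod U \<Omega> \<inter> fst_part -` T)" by (intro open_Int open_cprod open_vimage T(1) continuous_parts)
  moreover have "a \<in> cprod U \<Omega> \<inter> fst_part -` T" using a T by simp
  ultimately obtain d where d: "d > 0" "ball a d \<subseteq> cprod U \<Omega> \<inter> fst_part -` T" using open_contains_ball by metis
  have disc: "a + c *s (r *\<^sub>R b) \<in> cprod U \<Omega>" "\<rho> (fst_part a + c *s fst_part (r *\<^sub>R b)) < r1"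
    if r: "0 < r" "r < d / norm b" and c: "cmod c \<le> 1" for r c
  proof -
    have nb: "norm b > 0" using b by simp
    have "norm (c *s (r *\<^sub>R b)) \<le> 1 * (r * norm b)"
      unfolding norm_cscale using c r by (intro mult_mono) auto
    also have "\<dots> < d" using r nb by (simp add: field_simps)
    finally have "a + c *s (r *\<^sub>R b) \<in> ball a d" by (simp add: dist_norm)
    then have m: "a + c *s (r *\<^sub>R b) \<in> cprod U \<Omega>" "fst_part (a + c *s (r *\<^sub>R b)) \<in> T" using d(2) by blast+
    then show "a + c *s (r *\<^sub>R b) \<in> cprod U \<Omega>" by simp
    have "fst_part (a + c *s (r *\<^sub>R b)) \<in> U" using m by (simp add: cprod_def)
    from T(3)[OF m(2) this] show "\<rho> (fst_part a + c *s fst_part (r *\<^sub>R b)) < r1" by (simp only: part_simps(1))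
  qed
  have est: "log_K \<rho> \<Omega> a + \<alpha> * e + \<beta> * (norm (snd_part (r *\<^sub>R b)))\<^sup>2 \<le> circle_mean (log_K \<rho> \<Omega>) a (r *\<^sub>R b)"
    if r: "0 < r" "r < d / norm b" and e: "0 \<le> e" "\<rho> (fst_part a) + e \<le> circle_mean \<rho> (fst_part a) (fst_part (r *\<^sub>R b))" for r e
  proof (rule disc_estimateD[OF ab(3) _ _ disc(1)[OF r] disc(2)[OF r] _ e])
    have "fst_part a + c *s fst_part (r *\<^sub>R b) \<in> U" if "cmod c \<le> 1" for c
      using disc(1)[OF r that] by (simp add: cprod_def part_simps)
    then show "set_integrable lborel {0..2*pi} (\<lambda>t. \<rho> (fst_part a + cis t *s fst_part (r *\<^sub>R b)))"
      using psh unfolding psh_on_def by blast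
  qed auto
  have small: "\<forall>\<^sub>F r in at_right (0::real). 0 < r \<and> r < d / norm b"
    unfolding eventually_at_right_field using d(1) b by (intro exI[of _ "d / norm b"]) auto
  show "\<exists>\<epsilon>>0. \<forall>\<^sub>F r in at_right (0::real). log_K \<rho> \<Omega> a + \<epsilon> * r\<^sup>2 \<le> circle_mean (log_K \<rho> \<Omega>) a (r *\<^sub>R b)"
  proof (cases "fst_part b = 0")
    case True
    then have b2: "norm (snd_part b) > 0" using b parts_eq_0[of b] by auto
    have "log_K \<rho> \<Omega> a + (\<beta> * (norm (snd_part b))\<^sup>2) * r\<^sup>2 \<le> circle_mean (log_K \<rho> \<Omega>) a (r *\<^sub>R b)"
      if r: "0 < r \<and> r < d / norm b" for r
    proof -
      have "circle_mean \<rho> (fst_part a) (fst_part (r *\<^sub>R b)) = \<rho> (fst_part a)"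
        unfolding circle_mean_def part_simps True by (simp add: set_integral_const)
      then have "log_K \<rho> \<Omega> a + \<alpha> * 0 + \<beta> * (norm (snd_part (r *\<^sub>R b)))\<^sup>2 \<le> circle_mean (log_K \<rho> \<Omega>) a (r *\<^sub>R b)"
        using r by (intro est) auto
      then show ?thesis by (simp add: part_simps power_mult_distrib ac_simps)
    qed
    then have "\<forall>\<^sub>F r in at_right (0::real). log_K \<rho> \<Omega> a + (\<beta> * (norm (snd_part b))\<^sup>2) * r\<^sup>2 \<le> circle_mean (log_K \<rho> \<Omega>) a (r *\<^sub>R b)"
      using small by (rule eventually_mono[rotated])
    moreover have "\<beta> * (norm (snd_part b))\<^sup>2 > 0" using ab b2 by simp
    ultimately show ?thesis by blast
  next
    case False
    then obtain \<epsilon> where \<epsilon>: "\<epsilon> > 0" "\<forall>\<^sub>F r in at_right (0::real). \<rho> (fst_part a) + \<epsilon> * r\<^sup>2 \<le> circle_mean \<rho> (fst_part a) (r *\<^sub>R fst_part b)"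
      using \<rho> aU(1) unfolding strictly_psh_on_def by blast
    from \<epsilon>(2) small have "\<forall>\<^sub>F r in at_right (0::real). log_K \<rho> \<Omega> a + (\<alpha> * \<epsilon>) * r\<^sup>2 \<le> circle_mean (log_K \<rho> \<Omega>) a (r *\<^sub>R b)"
    proof eventually_elim
      case (elim r)
      have "log_K \<rho> \<Omega> a + \<alpha> * (\<epsilon> * r\<^sup>2) + \<beta> * (norm (snd_part (r *\<^sub>R b)))\<^sup>2 \<le> circle_mean (log_K \<rho> \<Omega>) a (r *\<^sub>R b)"
        using elim \<epsilon>(1) by (intro est) (auto simp: part_simps)
      moreover have "0 \<le> \<beta> * (norm (snd_part (r *\<^sub>R b)))\<^sup>2" using ab by simp
      ultimately show ?case by (simp add: mult.assoc)
    qed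
    moreover have "\<alpha> * \<epsilon> > 0" using ab \<epsilon> by simp
    ultimately show ?thesis by blast
  qed
qed

text \<open>Now the centres vary, so the constants require one lower bound s for \<rho> near the
  point. Upper semicontinuity does not give it, and \<open>loc_bounded_away_from_0\<close> does. The
  gains in the base and fibre parts of b combine to \<epsilon> (norm b)^2.\<close>

lemma log_K_loc_unif_strictly_psh:
  assumes \<rho>: "loc_unif_strictly_psh_on U \<rho>" and low: "loc_bounded_away_from_0 U \<rho>"
  shows "loc_unif_strictly_psh_on (cprod U \<Omega>) (log_K \<rho> \<Omega>)"
  unfolding loc_unif_strictly_psh_on_def
proof
  fix p :: "complex ^ ('m + 'n)" assume p: "p \<in> cprod U \<Omega>"
  have pU: "fst_part p \<in> U" "snd_part p \<in> \<Omega>" using p by (auto simp: cprod_def)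
  obtain r0 \<epsilon>0 where r0: "r0 > 0" "\<epsilon>0 > 0" "ball (fst_part p) r0 \<subseteq> U"
    "psh_on (ball (fst_part p) r0) (\<lambda>z. \<rho> z - \<epsilon>0 * (norm z)\<^sup>2)"
    using \<rho> pU(1) unfolding loc_unif_strictly_psh_on_def by meson
  obtain c0 where c0: "c0 > 0" "\<forall>\<^sub>F x in at (fst_part p) within U. c0 \<le> \<rho> x"
    using low pU(1) unfolding loc_bounded_away_from_0_def by blast
  obtain T0 where T0: "open T0" "fst_part p \<in> T0" "\<And>x. x \<in> T0 \<Longrightarrow> x \<noteq> fst_part p \<Longrightarrow> x \<in> U \<Longrightarrow> c0 \<le> \<rho> x"
    using c0(2) unfolding eventually_at_topological by blast
  \<comment> \<open>The filter \<open>at\<close> omits the point itself, hence the minimum with the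
    value there.\<close>
  define s where "s = min c0 (\<rho> (fst_part p))"
  have s: "s > 0" using c0 \<rho>_pos[OF pU(1)] by (simp add: s_def)
  have s_le: "s \<le> \<rho> x" if "x \<in> T0" "x \<in> U" for x
    using T0(3)[of x] that by (cases "x = fst_part p") (auto simp: s_def)
  obtain r1 where r1: "r1 > \<rho> (fst_part p)" "adm r1" using adm_larger[OF \<rho>_adm[OF pU(1)]] .
  obtain T where T: "open T" "fst_part p \<in> T" "\<And>x. x \<in> T \<Longrightarrow> x \<in> U \<Longrightarrow> \<rho> x < r1"
    using usc_onD[OF \<rho>_usc pU(1) r1(1)] by blast
  obtain d2 where d2: "d2 > 0" "cball (snd_part p) d2 \<subseteq> \<Omega>" using open_\<Omega> pU(2) open_contains_cball by blast
  obtain \<alpha> \<beta> where ab: "\<alpha> > 0" "\<beta> > 0" "disc_estimate r1 (cball (snd_part p) d2) s \<alpha> \<beta>"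
    by (rule disc_estimate_exists[OF r1(2) compact_cball d2(2) s])
  have "open (cprod U \<Omega> \<inter> fst_part -` (T \<inter> T0 \<inter> ball (fst_part p) r0) \<inter> snd_part -` ball (snd_part p) d2)"
    by (intro open_Int open_cprod open_vimage T(1) T0(1) open_ball continuous_parts)
  moreover have "p \<in> cprod U \<Omega> \<inter> fst_part -` (T \<inter> T0 \<inter> ball (fst_part p) r0) \<inter> snd_part -` ball (snd_part p) d2"
    using p T T0 r0 d2 by simp
  ultimately obtain r where r: "r > 0"
    "ball p r \<subseteq> cprod U \<Omega> \<inter> fst_part -` (T \<inter> T0 \<inter> ball (fst_part p) r0) \<inter> snd_part -` ball (snd_part p) d2"
    using open_contains_ball by metis
  define \<epsilon> where "\<epsilon> = min (\<alpha> * \<epsilon>0) \<beta>"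
  have \<epsilon>: "\<epsilon> > 0" "\<epsilon> \<le> \<alpha> * \<epsilon>0" "\<epsilon> \<le> \<beta>" using ab r0 by (auto simp: \<epsilon>_def)
  have sub: "ball p r \<subseteq> cprod U \<Omega>" using r(2) by blast
  have "psh_on (ball p r) (\<lambda>z. log_K \<rho> \<Omega> z - \<epsilon> * (norm z)\<^sup>2)"
    unfolding psh_on_def
  proof (intro conjI allI impI)
    show "usc_on (ball p r) (\<lambda>z. log_K \<rho> \<Omega> z - \<epsilon> * (norm z)\<^sup>2)"
    proof (rule usc_onI)
      fix a c assume a: "a \<in> ball p r" and c: "log_K \<rho> \<Omega> a - \<epsilon> * (norm a)\<^sup>2 < c"
      define \<eta> where "\<eta> = (c - (log_K \<rho> \<Omega> a - \<epsilon> * (norm a)\<^sup>2)) / 2"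
      have \<eta>: "\<eta> > 0" using c by (simp add: \<eta>_def)
      have "a \<in> cprod U \<Omega>" using a sub by blast
      moreover have "log_K \<rho> \<Omega> a < log_K \<rho> \<Omega> a + \<eta>" using \<eta> by simp
      ultimately obtain T1 where T1: "open T1" "a \<in> T1" "\<And>x. x \<in> T1 \<Longrightarrow> x \<in> cprod U \<Omega> \<Longrightarrow> log_K \<rho> \<Omega> x < log_K \<rho> \<Omega> a + \<eta>"
        using usc_onD[OF log_K_usc] by blast
      have "open {x. \<epsilon> * (norm a)\<^sup>2 - \<eta> < \<epsilon> * (norm x)\<^sup>2}" by (intro open_Collect_less continuous_intros)
      then have "open (T1 \<inter> {x. \<epsilon> * (norm a)\<^sup>2 - \<eta> < \<epsilon> * (norm x)\<^sup>2})" using T1(1) by blast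
      moreover have "log_K \<rho> \<Omega> x - \<epsilon> * (norm x)\<^sup>2 < c"
        if x: "x \<in> T1" "\<epsilon> * (norm a)\<^sup>2 - \<eta> < \<epsilon> * (norm x)\<^sup>2" "x \<in> ball p r" for x
      proof -
        have "x \<in> cprod U \<Omega>" using x(3) sub by blast
        from T1(3)[OF x(1) this] x(2) show ?thesis unfolding \<eta>_def by (simp add: field_simps)
      qed
      ultimately show "\<exists>T. open T \<and> a \<in> T \<and> (\<forall>x\<in>T \<inter> ball p r. log_K \<rho> \<Omega> x - \<epsilon> * (norm x)\<^sup>2 < c)"
        using T1(2) \<eta> by (intro exI[of _ "T1 \<inter> {x. \<epsilon> * (norm a)\<^sup>2 - \<eta> < \<epsilon> * (norm x)\<^sup>2}"]) auto
    qed
    fix a b assume D: "\<forall>c. cmod c \<le> 1 \<longrightarrow> a + c *s b \<in> ball p r"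
    have disc: "a + c *s b \<in> cprod U \<Omega>" and df: "fst_part a + c *s fst_part b \<in> T \<inter> T0 \<inter> ball (fst_part p) r0"
      and ds: "snd_part a + c *s snd_part b \<in> ball (snd_part p) d2" if "cmod c \<le> 1" for c
    proof -
      have "a + c *s b \<in> ball p r" using D that by blast
      then have m: "a + c *s b \<in> cprod U \<Omega>" "fst_part (a + c *s b) \<in> T \<inter> T0 \<inter> ball (fst_part p) r0"
        "snd_part (a + c *s b) \<in> ball (snd_part p) d2" using r(2) by blast+
      then show "a + c *s b \<in> cprod U \<Omega>" "fst_part a + c *s fst_part b \<in> T \<inter> T0 \<inter> ball (fst_part p) r0"
        "snd_part a + c *s snd_part b \<in> ball (snd_part p) d2" by (simp_all only: part_simps)
    qed
    have dU: "fst_part a + c *s fst_part b \<in> U" if "cmod c \<le> 1" for c using disc[OF that] by (simp add: cprod_def part_simps)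
    let ?\<rho>' = "\<lambda>z. \<rho> z - \<epsilon>0 * (norm z)\<^sup>2"
    \<comment> \<open>The sub-mean value inequality of the shifted function is read as an excess of
      the mean of \<rho>, of size \<epsilon>0 times the squared norm of
      \<open>fst_part b\<close>.\<close>
    have P: "set_integrable lborel {0..2*pi} (\<lambda>t. ?\<rho>' (fst_part a + cis t *s fst_part b))"
      "?\<rho>' (fst_part a) \<le> circle_mean ?\<rho>' (fst_part a) (fst_part b)"
      using r0(4) df unfolding psh_on_def by blast+
    note n1 = circle_norm_square[of "fst_part a" "fst_part b"]
    have "set_integrable lborel {0..2*pi} (\<lambda>t. ?\<rho>' (fst_part a + cis t *s fst_part b) + \<epsilon>0 * (norm (fst_part a + cis t *s fst_part b))\<^sup>2)"
      using P(1) n1(1) by (intro set_integral_add(1) set_integrable_mult_right) auto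
    then have i\<rho>: "set_integrable lborel {0..2*pi} (\<lambda>t. \<rho> (fst_part a + cis t *s fst_part b))" by simp
    have "circle_mean ?\<rho>' (fst_part a) (fst_part b) = circle_mean \<rho> (fst_part a) (fst_part b) - \<epsilon>0 * ((norm (fst_part a))\<^sup>2 + (norm (fst_part b))\<^sup>2)"
      unfolding circle_mean_def using i\<rho> n1 by (simp add: field_simps)
    then have m\<rho>: "\<rho> (fst_part a) + \<epsilon>0 * (norm (fst_part b))\<^sup>2 \<le> circle_mean \<rho> (fst_part a) (fst_part b)"
      using P(2) by (simp add: algebra_simps)
    have "log_K \<rho> \<Omega> a + \<alpha> * (\<epsilon>0 * (norm (fst_part b))\<^sup>2) + \<beta> * (norm (snd_part b))\<^sup>2 \<le> circle_mean (log_K \<rho> \<Omega>) a b"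
    proof (rule disc_estimateD[OF ab(3) _ _ disc _ i\<rho> _ m\<rho>])
      show "snd_part a \<in> cball (snd_part p) d2" using ds[of 0] by simp
      show "s \<le> \<rho> (fst_part a)" using s_le[of "fst_part a"] df[of 0] dU[of 0] by simp
      show "\<rho> (fst_part a + c *s fst_part b) < r1" if "cmod c \<le> 1" for c
        using T(3) df[OF that] dU[OF that] by blast
    qed (use r0 in auto)
    moreover have "\<epsilon> * (norm b)\<^sup>2 \<le> \<alpha> * (\<epsilon>0 * (norm (fst_part b))\<^sup>2) + \<beta> * (norm (snd_part b))\<^sup>2"
      unfolding norm_parts[of b] distrib_left mult.assoc[symmetric]
      by (intro add_mono mult_right_mono \<epsilon>(2,3)) auto
    ultimately have main: "log_K \<rho> \<Omega> a + \<epsilon> * (norm b)\<^sup>2 \<le> circle_mean (log_K \<rho> \<Omega>) a b" by linarith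
    note n2 = circle_norm_square[of a b]
    have iu: "set_integrable lborel {0..2*pi} (\<lambda>t. log_K \<rho> \<Omega> (a + cis t *s b))" by (rule log_K_circle_integrable[OF disc])
    show "set_integrable lborel {0..2*pi} (\<lambda>t. log_K \<rho> \<Omega> (a + cis t *s b) - \<epsilon> * (norm (a + cis t *s b))\<^sup>2)"
      using iu n2(1) by (intro set_integral_diff(1) set_integrable_mult_right) auto
    have "circle_mean (\<lambda>z. log_K \<rho> \<Omega> z - \<epsilon> * (norm z)\<^sup>2) a b = circle_mean (log_K \<rho> \<Omega>) a b - \<epsilon> * ((norm a)\<^sup>2 + (norm b)\<^sup>2)"
      unfolding circle_mean_def using iu n2 by (simp add: field_simps)
    then show "log_K \<rho> \<Omega> a - \<epsilon> * (norm a)\<^sup>2 \<le> circle_mean (\<lambda>z. log_K \<rho> \<Omega> z - \<epsilon> * (norm z)\<^sup>2) a b"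
      using main by (simp add: algebra_simps)
  qed
  then show "\<exists>r>0. \<exists>\<epsilon>>0. ball p r \<subseteq> cprod U \<Omega> \<and> psh_on (ball p r) (\<lambda>z. log_K \<rho> \<Omega> z - \<epsilon> * (norm z)\<^sup>2)"
    using r(1) \<epsilon>(1) sub by blast
qed

end

text \<open>Positivity of the kernel belongs to the conclusion because \<open>ln\<close> is total
  and has its usual meaning only at positive arguments. The inclusion
  \<open>compactly_inside\<close> makes the hole compact in \<open>\<Omega>\<close>, as the
  extension theorem for \<open>shell\<close> assumes; it does not follow from \<rho> < 1 (see
  \<open>adm\<close>). Strictness is treated in both its pointwise and its locally uniform
  form.\<close>

theorem theorem1p1:
  fixes \<Omega> :: "(complex ^ 'n) set"
    and U :: "(complex ^ 'm) set"
    and \<rho> :: "complex ^ 'm \<Rightarrow> real"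
  assumes n: "CARD('n) \<ge> 2"
    and \<Omega>: "domain_in \<Omega>" "bounded \<Omega>" "complete_circular \<Omega>"
    and U: "domain_in U"
    and \<rho>_usc: "usc_on U \<rho>"
    and \<rho>_bounds: "\<forall>\<zeta>\<in>U. 0 < \<rho> \<zeta> \<and> \<rho> \<zeta> < 1"
    and compactly_inside: "\<forall>\<zeta>\<in>U. closure (shrunk (\<rho> \<zeta>) \<Omega>) \<subseteq> \<Omega>"
  shows "(\<forall>\<zeta>\<in>U. \<forall>z\<in>\<Omega>. 0 < bergman_kernel_ext (annulus (\<rho> \<zeta>) \<Omega>) \<Omega> z)
    \<and> (psh_on U \<rho> \<longrightarrow> psh_on (cprod U \<Omega>) (log_K \<rho> \<Omega>))
    \<and> (strictly_psh_on U \<rho> \<longrightarrow> strictly_psh_on (cprod U \<Omega>) (log_K \<rho> \<Omega>))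
    \<and> (loc_unif_strictly_psh_on U \<rho> \<and> loc_bounded_away_from_0 U \<rho>
        \<longrightarrow> loc_unif_strictly_psh_on (cprod U \<Omega>) (log_K \<rho> \<Omega>))"
proof -
  interpret ccd \<Omega>
    by unfold_locales (use n \<Omega> in \<open>auto simp: domain_in_def\<close>)
  interpret hartogs_family \<Omega> U \<rho>
    by unfold_locales
      (use U \<rho>_usc \<rho>_bounds compactly_inside closure_shrunk in \<open>auto simp: domain_in_def adm_def\<close>)
  have "0 < bergman_kernel_ext (annulus (\<rho> \<zeta>) \<Omega>) \<Omega> z" if "\<zeta> \<in> U" "z \<in> \<Omega>" for \<zeta> z
    using Kr_pos[OF \<rho>_adm[OF that(1)] that(2)] by (simp add: annulus_def closure_shrunk)
  then show ?thesis
    using log_K_psh log_K_strictly_psh log_K_loc_unif_strictly_psh by blast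
qed

end
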